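(* $\Vdash(\gimel\kappa\text{ is countable})\to$ there exists an injection from $\gimel\kappa_+$ into $\mathbb R$.
   Context: Realizability algebra $\mathcal A$ (terms $\Lambda$, stacks $\Pi$, instructions $B,C,I,K,W,\mathrm{cc}$, continuations $k_\pi$, execution $\succ$ given by $(\xi)\eta\star\pi\succ\xi\star\eta\cdot\pi$, $I\star\xi\cdot\pi\succ\xi\star\pi$, $K\star\xi\cdot\eta\cdot\pi\succ\xi\star\pi$, $W\star\xi\cdot\eta\cdot\pi\succ\xi\star\eta\cdot\eta\cdot\pi$, $C\star\xi\cdot\eta\cdot\zeta\cdot\pi\succ\xi\star\zeta\cdot\eta\cdot\pi$, $B\star\xi\cdot\eta\cdot\zeta\cdot\pi\succ\xi\star(\eta)\zeta\cdot\pi$, $\mathrm{cc}\star\xi\cdot\pi\succ\xi\star k_\pi\cdot\pi$, $k_\pi\star\xi\cdot\varpi\succ\xi\star\pi$; set $\perp\!\!\!\perp$ of processes closed under anti-execution; proof-like terms QP), coherent, in a ground model $\mathcal M\models$ ZF+$V=L$. Realizability model $\mathcal N_{\mathcal A}$: individuals of $\mathcal M$; $\|\top\|=\emptyset$, $\|\bot\|=\Pi$, $\|a\not\varepsilon b\|=\{\pi:(a,\pi)\in b\}$, $\|a\subset b\|=\bigcup_c\{\xi\cdot\pi:(c,\pi)\in a,\xi\Vdash c\notin b\}$, $\|a\notin b\|=\bigcup_c\{\xi\cdot\xi'\cdot\pi:(c,\pi)\in b,\xi\Vdash a\subset c,\xi'\Vdash c\subset a\}$, $\|A\to B\|=\{\xi\cdot\pi:\xi\Vdash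 A,\pi\in\|B\|\}$, $\|\forall xA\|=\bigcup_a\|A[a/x]\|$; $\xi\Vdash F$ iff $\xi\star\pi\in\perp\!\!\!\perp$ for all $\pi\in\|F\|$; $\Vdash F$ means some proof-like term realizes $F$ (read as a ZF statement in $\mathcal N_{\mathcal A}$, whose set of reals is $\mathbb R$). $\gimel X=X\times\Pi$. In $\mathcal M$, $\kappa=\mathrm{card}(\Lambda\cup\Pi\cup\mathbb N)$ and $\kappa_+=\mathcal P(\kappa)$. *)

theory Defs
  imports Main
begin

section \<open>First-order formulas of set theory\<close>

text \<open>De Bruijn indices; they are needed only to state the two axiom schemas of ZF.\<close>

datatype fm = FMem nat nat | FEq nat nat | FNot fm | FAnd fm fm | FAll fm

primrec sat :: "('m \<Rightarrow> 'm \<Rightarrow> bool) \<Rightarrow> fm \<Rightarrow> (nat \<Rightarrow> 'm) \<Rightarrow> bool" where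
  "sat mem (FMem i j) e \<longleftrightarrow> mem (e i) (e j)"
| "sat mem (FEq i j) e \<longleftrightarrow> e i = e j"
| "sat mem (FNot p) e \<longleftrightarrow> \<not> sat mem p e"
| "sat mem (FAnd p q) e \<longleftrightarrow> sat mem p e \<and> sat mem q e"
| "sat mem (FAll p) e \<longleftrightarrow> (\<forall>x. sat mem p (case_nat x e))"


section \<open>Set-theoretic notions inside a structure\<close>

text \<open>
  The ground model is an arbitrary structure \<open>('m, mem)\<close>; it need not be well-founded, and its
  natural numbers may be nonstandard. All notions below are therefore the internal ones: the
  quantifiers range over individuals of the structure only. \<open>ext a\<close> is the external set of elements
  of \<open>a\<close>, and \<open>setof X\<close> is the individual with extension \<open>X\<close>, meaningful only if \<open>coded X\<close>.
\<close>

locale membership =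
  fixes mem :: "'m \<Rightarrow> 'm \<Rightarrow> bool"
begin

definition ext :: "'m \<Rightarrow> 'm set" where
  "ext a = {x. mem x a}"

definition coded :: "'m set \<Rightarrow> bool" where
  "coded X \<longleftrightarrow> (\<exists>a. ext a = X)"

definition setof :: "'m set \<Rightarrow> 'm" where
  "setof X = (THE a. ext a = X)"

definition opair :: "'m \<Rightarrow> 'm \<Rightarrow> 'm" where
  "opair a b = setof {setof {a}, setof {a, b}}"

definition succ :: "'m \<Rightarrow> 'm" where
  "succ a = setof (insert a (ext a))"

definition pow :: "'m \<Rightarrow> 'm" where
  "pow a = setof {x. ext x \<subseteq> ext a}"

definition cart :: "'m \<Rightarrow> 'm \<Rightarrow> 'm" where
  "cart a b = setof {opair x y | x y. x \<in> ext a \<and> y \<in> ext b}"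

definition is_inductive :: "'m \<Rightarrow> bool" where
  "is_inductive z \<longleftrightarrow> setof {} \<in> ext z \<and> (\<forall>x \<in> ext z. succ x \<in> ext z)"

definition omega :: "'m" where
  "omega = setof {n. \<forall>z. is_inductive z \<longrightarrow> n \<in> ext z}"

definition transitive_set :: "'m \<Rightarrow> bool" where
  "transitive_set a \<longleftrightarrow> (\<forall>x \<in> ext a. ext x \<subseteq> ext a)"

text \<open>This is the usual notion of von Neumann ordinal because of the axiom of foundation.\<close>

definition ordinal :: "'m \<Rightarrow> bool" where
  "ordinal a \<longleftrightarrow> transitive_set a \<and> (\<forall>x \<in> ext a. transitive_set x)"

definition is_fun :: "'m \<Rightarrow> 'm \<Rightarrow> 'm \<Rightarrow> bool" where
  "is_fun f a b \<longleftrightarrow> ext f \<subseteq> {opair x y | x y. x \<in> ext a \<and> y \<in> ext b}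
     \<and> (\<forall>x \<in> ext a. \<exists>!y. opair x y \<in> ext f)"

definition val :: "'m \<Rightarrow> 'm \<Rightarrow> 'm" where
  "val f x = (THE y. opair x y \<in> ext f)"

definition equipotent :: "'m \<Rightarrow> 'm \<Rightarrow> bool" where
  "equipotent a b \<longleftrightarrow> (\<exists>f. is_fun f a b \<and> bij_betw (val f) (ext a) (ext b))"

definition cardinality :: "'m \<Rightarrow> 'm" where
  "cardinality a = (THE k. ordinal k \<and> equipotent k a \<and> (\<forall>b \<in> ext k. \<not> equipotent b a))"

definition internal_op :: "'m \<Rightarrow> 'm \<Rightarrow> ('m \<Rightarrow> 'm) \<Rightarrow> bool" where
  "internal_op a b f \<longleftrightarrow> (\<forall>x \<in> ext a. f x \<in> ext b) \<and> coded {opair x (f x) | x. x \<in> ext a}"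

definition internal_op2 :: "'m \<Rightarrow> 'm \<Rightarrow> 'm \<Rightarrow> ('m \<Rightarrow> 'm \<Rightarrow> 'm) \<Rightarrow> bool" where
  "internal_op2 a b c f \<longleftrightarrow> (\<forall>x \<in> ext a. \<forall>y \<in> ext b. f x y \<in> ext c)
     \<and> coded {opair (opair x y) (f x y) | x y. x \<in> ext a \<and> y \<in> ext b}"


subsection \<open>The constructible hierarchy\<close>

text \<open>
  Definability over a set is expressed inside the structure as in Kunen's textbook: the definable
  \<open>n\<close>-ary relations on \<open>A\<close>, for \<open>n\<close> in the \<open>\<omega>\<close> of the structure, form the least
  family containing the membership and equality relations of two coordinates and closed under
  complement, intersection and projection. A family is an individual with elements \<open>(n, R)\<close>.
\<close>

definition tuples :: "'m \<Rightarrow> 'm \<Rightarrow> 'm set" where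
  "tuples A n = {s. is_fun s n A}"

definition snoc :: "'m \<Rightarrow> 'm \<Rightarrow> 'm \<Rightarrow> 'm" where
  "snoc s n x = setof (insert (opair n x) (ext s))"

definition definability_closed :: "'m \<Rightarrow> 'm \<Rightarrow> bool" where
  "definability_closed A D \<longleftrightarrow> (\<forall>n \<in> ext omega.
     (\<forall>i \<in> ext n. \<forall>j \<in> ext n.
        opair n (setof {s \<in> tuples A n. mem (val s i) (val s j)}) \<in> ext D \<and>
        opair n (setof {s \<in> tuples A n. val s i = val s j}) \<in> ext D) \<and>
     (\<forall>R. opair n R \<in> ext D \<longrightarrow> opair n (setof (tuples A n - ext R)) \<in> ext D) \<and>
     (\<forall>R S. opair n R \<in> ext D \<longrightarrow> opair n S \<in> ext D \<longrightarrow>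
        opair n (setof (ext R \<inter> ext S)) \<in> ext D) \<and>
     (\<forall>R. opair (succ n) R \<in> ext D \<longrightarrow>
        opair n (setof {s \<in> tuples A n. \<exists>x \<in> ext A. snoc s n x \<in> ext R}) \<in> ext D))"

definition definable_rel :: "'m \<Rightarrow> 'm \<Rightarrow> 'm \<Rightarrow> bool" where
  "definable_rel A n R \<longleftrightarrow> (\<forall>D. definability_closed A D \<longrightarrow> opair n R \<in> ext D)"

text \<open>Subsets of \<open>A\<close> definable over \<open>(A, \<in>)\<close> with a finite sequence \<open>s\<close> of parameters.\<close>

definition definable_subsets :: "'m \<Rightarrow> 'm set" where
  "definable_subsets A = {X. \<exists>n \<in> ext omega. \<exists>s \<in> tuples A n. \<exists>R.
     definable_rel A (succ n) R \<and> ext X = {x \<in> ext A. snoc s n x \<in> ext R}}"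

text \<open>\<open>f\<close> is the sequence of the \<open>L\<^sub>\<beta> = (\<Union>\<gamma><\<beta>. Def L\<^sub>\<gamma>)\<close> for \<open>\<beta> \<le> \<alpha>\<close>.\<close>

definition constructible_hierarchy :: "'m \<Rightarrow> 'm \<Rightarrow> bool" where
  "constructible_hierarchy \<alpha> f \<longleftrightarrow> (\<exists>b. is_fun f (succ \<alpha>) b) \<and>
     (\<forall>\<beta> \<in> ext (succ \<alpha>). ext (val f \<beta>) = (\<Union>\<gamma> \<in> ext \<beta>. definable_subsets (val f \<gamma>)))"

definition constructible :: "'m \<Rightarrow> bool" where
  "constructible x \<longleftrightarrow>
     (\<exists>\<alpha> f. ordinal \<alpha> \<and> constructible_hierarchy \<alpha> f \<and> x \<in> ext (val f \<alpha>))"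

end


section \<open>The ground model\<close>

locale ZFL_model = membership +
  assumes extensionality: "(\<forall>x. mem x a \<longleftrightarrow> mem x b) \<Longrightarrow> a = b"
    and foundation: "(\<exists>x. mem x a) \<Longrightarrow> \<exists>x. mem x a \<and> (\<forall>y. mem y x \<longrightarrow> \<not> mem y a)"
    and pairing: "\<exists>c. \<forall>x. mem x c \<longleftrightarrow> x = a \<or> x = b"
    and union: "\<exists>u. \<forall>x. mem x u \<longleftrightarrow> (\<exists>y. mem y a \<and> mem x y)"
    and power_set: "\<exists>p. \<forall>x. mem x p \<longleftrightarrow> (\<forall>y. mem y x \<longrightarrow> mem y a)"
    and infinity: "\<exists>w. (\<exists>z. mem z w \<and> (\<forall>x. \<not> mem x z)) \<and>
                       (\<forall>n. mem n w \<longrightarrow> (\<exists>m. mem m w \<and> (\<forall>x. mem x m \<longleftrightarrow> mem x n \<or> x = n)))"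
    and separation: "\<exists>b. \<forall>x. mem x b \<longleftrightarrow> mem x a \<and> sat mem p (case_nat x e)"
    and replacement: "(\<forall>x. mem x a \<longrightarrow> (\<exists>!y. sat mem p (case_nat y (case_nat x e)))) \<Longrightarrow>
                      \<exists>b. \<forall>y. mem y b \<longleftrightarrow> (\<exists>x. mem x a \<and> sat mem p (case_nat y (case_nat x e)))"
    and V_eq_L: "constructible x"


section \<open>Formulas of non-extensional set theory\<close>

text \<open>
  Closed formulas with individuals as parameters. The body of a quantifier is the function
  \<open>a \<mapsto> A[a/x]\<close>.
\<close>

datatype 'm rfm =
    Top
  | Bot
  | NotEps 'm 'm
  | NotIn 'm 'm
  | Sub 'm 'm
  | Imp "'m rfm" "'m rfm" (infixr "\<^bold>\<rightarrow>" 50)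
  | All "'m \<Rightarrow> 'm rfm" (binder "\<^bold>\<forall>" 45)

abbreviation Neg :: "'m rfm \<Rightarrow> 'm rfm" where
  "Neg A \<equiv> A \<^bold>\<rightarrow> Bot"

definition Conj :: "'m rfm \<Rightarrow> 'm rfm \<Rightarrow> 'm rfm" (infixr "\<^bold>\<and>" 60) where
  "A \<^bold>\<and> B = Neg (A \<^bold>\<rightarrow> B \<^bold>\<rightarrow> Bot)"

definition Disj :: "'m rfm \<Rightarrow> 'm rfm \<Rightarrow> 'm rfm" (infixr "\<^bold>\<or>" 55) where
  "A \<^bold>\<or> B = (Neg A \<^bold>\<rightarrow> Neg B \<^bold>\<rightarrow> Bot)"

definition Iff :: "'m rfm \<Rightarrow> 'm rfm \<Rightarrow> 'm rfm" where
  "Iff A B = ((A \<^bold>\<rightarrow> B) \<^bold>\<and> (B \<^bold>\<rightarrow> A))"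

definition Ex :: "('m \<Rightarrow> 'm rfm) \<Rightarrow> 'm rfm" (binder "\<^bold>\<exists>" 45) where
  "(\<^bold>\<exists>x. A x) = Neg (\<^bold>\<forall>x. Neg (A x))"

definition Eps :: "'m \<Rightarrow> 'm \<Rightarrow> 'm rfm" (infix "\<^bold>\<epsilon>" 70) where
  "a \<^bold>\<epsilon> b = Neg (NotEps a b)"

definition In :: "'m \<Rightarrow> 'm \<Rightarrow> 'm rfm" (infix "\<^bold>\<in>" 70) where
  "a \<^bold>\<in> b = Neg (NotIn a b)"

text \<open>Extensional equality, which is the equality of ZF.\<close>

definition ExtEq :: "'m \<Rightarrow> 'm \<Rightarrow> 'm rfm" (infix "\<^bold>\<simeq>" 70) where
  "a \<^bold>\<simeq> b = (Sub a b \<^bold>\<and> Sub b a)"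

text \<open>Leibniz equality, which is the equality of individuals.\<close>

definition LeibnizEq :: "'m \<Rightarrow> 'm \<Rightarrow> 'm rfm" (infix "\<^bold>=" 70) where
  "a \<^bold>= b = (\<^bold>\<forall>z. NotEps b z \<^bold>\<rightarrow> NotEps a z)"


subsection \<open>Natural numbers and reals of the realizability model\<close>

text \<open>\<open>\<omega>\<close> is the least inductive set of ZF, and the reals are the subsets of \<open>\<omega>\<close>.\<close>

definition Inductive_fm :: "'m \<Rightarrow> 'm rfm" where
  "Inductive_fm z =
     ((\<^bold>\<exists>e. e \<^bold>\<in> z \<^bold>\<and> (\<^bold>\<forall>u. NotIn u e)) \<^bold>\<and>
      (\<^bold>\<forall>u. u \<^bold>\<in> z \<^bold>\<rightarrow> (\<^bold>\<exists>v. v \<^bold>\<in> z \<^bold>\<and> (\<^bold>\<forall>t. Iff (t \<^bold>\<in> v) (t \<^bold>\<in> u \<^bold>\<or> t \<^bold>\<simeq> u)))))"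

definition Nat_fm :: "'m \<Rightarrow> 'm rfm" where
  "Nat_fm n = (\<^bold>\<forall>z. Inductive_fm z \<^bold>\<rightarrow> n \<^bold>\<in> z)"

definition Real_fm :: "'m \<Rightarrow> 'm rfm" where
  "Real_fm r = (\<^bold>\<forall>n. n \<^bold>\<in> r \<^bold>\<rightarrow> Nat_fm n)"

context membership
begin

text \<open>
  There is an injection from \<open>X\<close> into the class \<open>P\<close>. Here \<open>X\<close> is the collection of
  individuals \<open>x \<epsilon> X\<close>, distinguished by Leibniz equality, and \<open>P\<close> is a class of ZF,
  whose equality is the extensional one. The graph \<open>f\<close> consists of pairs formed with the pairing
  function of the ground model, used as a function symbol of the realizability model.

  Strong membership and Leibniz equality are essential on the side of \<open>X\<close>. An ordinal, or a
  set of ordinals, has no ordered pair as an element; so all such individuals are names of the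
  empty set. Hence \<open>gimel kappa\<close> and \<open>gimel kappa_plus\<close> below would both be read as
  \<open>{\<emptyset>}\<close> if membership and equality in them were extensional.
\<close>

definition Injects_fm :: "'m \<Rightarrow> ('m \<Rightarrow> 'm rfm) \<Rightarrow> 'm rfm" where
  "Injects_fm X P = (\<^bold>\<exists>f.
     (\<^bold>\<forall>x. x \<^bold>\<epsilon> X \<^bold>\<rightarrow> (\<^bold>\<exists>y. opair x y \<^bold>\<epsilon> f \<^bold>\<and> P y)) \<^bold>\<and>
     (\<^bold>\<forall>x. \<^bold>\<forall>y. \<^bold>\<forall>y'. x \<^bold>\<epsilon> X \<^bold>\<rightarrow> opair x y \<^bold>\<epsilon> f \<^bold>\<rightarrow> opair x y' \<^bold>\<epsilon> f \<^bold>\<rightarrow> y \<^bold>\<simeq> y') \<^bold>\<and>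
     (\<^bold>\<forall>x. \<^bold>\<forall>x'. \<^bold>\<forall>y. \<^bold>\<forall>y'. x \<^bold>\<epsilon> X \<^bold>\<rightarrow> x' \<^bold>\<epsilon> X \<^bold>\<rightarrow>
        opair x y \<^bold>\<epsilon> f \<^bold>\<rightarrow> opair x' y' \<^bold>\<epsilon> f \<^bold>\<rightarrow> y \<^bold>\<simeq> y' \<^bold>\<rightarrow> x \<^bold>= x'))"

definition Countable_fm :: "'m \<Rightarrow> 'm rfm" where
  "Countable_fm X = Injects_fm X Nat_fm"

definition Injects_into_reals_fm :: "'m \<Rightarrow> 'm rfm" where
  "Injects_into_reals_fm X = Injects_fm X Real_fm"

end


section \<open>Realizability algebras and realizability models\<close>

text \<open>
  \<open>Lam\<close>, \<open>Pi\<close> and \<open>Proc\<close> are the individuals of terms, stacks and processes; the process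
  \<open>\<xi> \<star> \<pi>\<close> is \<open>proc \<xi> \<pi>\<close>. The operations matter only on these sets.
\<close>

locale realizability_structure = membership mem for mem :: "'m \<Rightarrow> 'm \<Rightarrow> bool" +
  fixes Lam Pi Proc :: 'm
    and app :: "'m \<Rightarrow> 'm \<Rightarrow> 'm"
    and push :: "'m \<Rightarrow> 'm \<Rightarrow> 'm"
    and proc :: "'m \<Rightarrow> 'm \<Rightarrow> 'm"  (infix "\<star>" 60)
    and cont :: "'m \<Rightarrow> 'm"
    and cB cC cI cK cW cc :: 'm
    and pole :: 'm
    and QP :: 'm
begin

inductive step :: "'m \<Rightarrow> 'm \<Rightarrow> bool" where
  step_app: "\<lbrakk>\<xi> \<in> ext Lam; \<eta> \<in> ext Lam; \<pi> \<in> ext Pi\<rbrakk> \<Longrightarrow> step (app \<xi> \<eta> \<star> \<pi>) (\<xi> \<star> push \<eta> \<pi>)"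
| step_I: "\<lbrakk>\<xi> \<in> ext Lam; \<pi> \<in> ext Pi\<rbrakk> \<Longrightarrow> step (cI \<star> push \<xi> \<pi>) (\<xi> \<star> \<pi>)"
| step_K: "\<lbrakk>\<xi> \<in> ext Lam; \<eta> \<in> ext Lam; \<pi> \<in> ext Pi\<rbrakk> \<Longrightarrow>
    step (cK \<star> push \<xi> (push \<eta> \<pi>)) (\<xi> \<star> \<pi>)"
| step_W: "\<lbrakk>\<xi> \<in> ext Lam; \<eta> \<in> ext Lam; \<pi> \<in> ext Pi\<rbrakk> \<Longrightarrow>
    step (cW \<star> push \<xi> (push \<eta> \<pi>)) (\<xi> \<star> push \<eta> (push \<eta> \<pi>))"
| step_C: "\<lbrakk>\<xi> \<in> ext Lam; \<eta> \<in> ext Lam; \<zeta> \<in> ext Lam; \<pi> \<in> ext Pi\<rbrakk> \<Longrightarrow>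
    step (cC \<star> push \<xi> (push \<eta> (push \<zeta> \<pi>))) (\<xi> \<star> push \<zeta> (push \<eta> \<pi>))"
| step_B: "\<lbrakk>\<xi> \<in> ext Lam; \<eta> \<in> ext Lam; \<zeta> \<in> ext Lam; \<pi> \<in> ext Pi\<rbrakk> \<Longrightarrow>
    step (cB \<star> push \<xi> (push \<eta> (push \<zeta> \<pi>))) (\<xi> \<star> push (app \<eta> \<zeta>) \<pi>)"
| step_cc: "\<lbrakk>\<xi> \<in> ext Lam; \<pi> \<in> ext Pi\<rbrakk> \<Longrightarrow> step (cc \<star> push \<xi> \<pi>) (\<xi> \<star> push (cont \<pi>) \<pi>)"
| step_cont: "\<lbrakk>\<xi> \<in> ext Lam; \<pi> \<in> ext Pi; \<rho> \<in> ext Pi\<rbrakk> \<Longrightarrow>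
    step (cont \<pi> \<star> push \<xi> \<rho>) (\<xi> \<star> \<pi>)"

text \<open>
  The least preorder of the ground model that contains \<open>step\<close>. It may properly contain the external
  reflexive transitive closure of \<open>step\<close>, as the ground model may have nonstandard integers.
\<close>

definition exec :: "'m \<Rightarrow> 'm \<Rightarrow> bool" (infix "\<succ>" 50) where
  "p \<succ> q \<longleftrightarrow> p \<in> ext Proc \<and> q \<in> ext Proc \<and>
     (\<forall>r. (\<forall>x \<in> ext Proc. opair x x \<in> ext r) \<and>
          (\<forall>x \<in> ext Proc. \<forall>y \<in> ext Proc. \<forall>z \<in> ext Proc.
             opair x y \<in> ext r \<longrightarrow> opair y z \<in> ext r \<longrightarrow> opair x z \<in> ext r) \<and>
          (\<forall>x y. step x y \<longrightarrow> opair x y \<in> ext r)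
        \<longrightarrow> opair p q \<in> ext r)"

text \<open>\<open>\<xi>\<close> realizes a formula with truth value \<open>X\<close>.\<close>

definition forces :: "'m \<Rightarrow> 'm set \<Rightarrow> bool" (infix "\<tturnstile>" 50) where
  "\<xi> \<tturnstile> X \<longleftrightarrow> \<xi> \<in> ext Lam \<and> (\<forall>\<pi> \<in> X. \<xi> \<star> \<pi> \<in> ext pole)"

text \<open>
  The truth values of \<open>a \<subset> b\<close> and \<open>a \<notin> b\<close> are defined by simultaneous
  well-founded recursion inside the ground model, so they are obtained in the usual way from
  set-sized approximations: \<open>T\<close> is a set of individuals closed under the relevant
  predecessors, \<open>S\<close> and \<open>N\<close> are sets of triples \<open>((a, b), \<pi>)\<close> with \<open>a\<close>, \<open>b\<close> in \<open>T\<close>,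
  and their slices satisfy the recursive clauses.
\<close>

definition slice :: "'m \<Rightarrow> 'm \<Rightarrow> 'm \<Rightarrow> 'm set" where
  "slice S a b = {\<pi> \<in> ext Pi. opair (opair a b) \<pi> \<in> ext S}"

definition approximation :: "'m \<Rightarrow> 'm \<Rightarrow> 'm \<Rightarrow> bool" where
  "approximation T S N \<longleftrightarrow>
     (\<forall>b \<in> ext T. \<forall>c. \<forall>\<pi> \<in> ext Pi. opair c \<pi> \<in> ext b \<longrightarrow> c \<in> ext T) \<and>
     (\<forall>a \<in> ext T. \<forall>b \<in> ext T.
        slice S a b = {push \<xi> \<pi> | c \<xi> \<pi>. \<pi> \<in> ext Pi \<and> opair c \<pi> \<in> ext a \<and> \<xi> \<tturnstile> slice N c b} \<and>
        slice N a b = {push \<xi> (push \<xi>' \<pi>) | c \<xi> \<xi>' \<pi>. \<pi> \<in> ext Pi \<and> opair c \<pi> \<in> ext b \<and>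
                         \<xi> \<tturnstile> slice S a c \<and> \<xi>' \<tturnstile> slice S c a})"

definition tv_Sub :: "'m \<Rightarrow> 'm \<Rightarrow> 'm set" where
  "tv_Sub a b = {\<pi>. \<exists>T S N. approximation T S N \<and> a \<in> ext T \<and> b \<in> ext T \<and> \<pi> \<in> slice S a b}"

definition tv_NotIn :: "'m \<Rightarrow> 'm \<Rightarrow> 'm set" where
  "tv_NotIn a b = {\<pi>. \<exists>T S N. approximation T S N \<and> a \<in> ext T \<and> b \<in> ext T \<and> \<pi> \<in> slice N a b}"

primrec tv :: "'m rfm \<Rightarrow> 'm set" where
  "tv Top = {}"
| "tv Bot = ext Pi"
| "tv (NotEps a b) = {\<pi> \<in> ext Pi. opair a \<pi> \<in> ext b}"
| "tv (NotIn a b) = tv_NotIn a b"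
| "tv (Sub a b) = tv_Sub a b"
| "tv (Imp A B) = {push \<xi> \<pi> | \<xi> \<pi>. \<xi> \<tturnstile> tv A \<and> \<pi> \<in> tv B}"
| "tv (All A) = (\<Union>a. tv (A a))"

definition realized :: "'m rfm \<Rightarrow> bool" where
  "realized F \<longleftrightarrow> (\<exists>\<theta> \<in> ext QP. \<theta> \<tturnstile> tv F)"

definition gimel :: "'m \<Rightarrow> 'm" where
  "gimel X = cart X Pi"

definition kappa :: 'm where
  "kappa = cardinality (setof (ext Lam \<union> ext Pi \<union> ext omega))"

definition kappa_plus :: 'm where
  "kappa_plus = pow kappa"

end

locale realizability_algebra = ZFL_model mem + realizability_structure mem Lam Pi Proc app push proc cont cB cC cI cK cW cc pole QP
  for mem :: "'m \<Rightarrow> 'm \<Rightarrow> bool" and Lam Pi Proc app push and proc (infix "\<star>" 60) and cont cB cC cI cK cW cc pole QP +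
  assumes app: "internal_op2 Lam Lam Lam app"
    and push: "internal_op2 Lam Pi Pi push"
    and proc: "internal_op2 Lam Pi Proc proc"
    and cont: "internal_op Pi Lam cont"
    and pole_subset: "ext pole \<subseteq> ext Proc"
    and pole_anti_exec: "p \<succ> q \<Longrightarrow> q \<in> ext pole \<Longrightarrow> p \<in> ext pole"
    and QP_subset: "ext QP \<subseteq> ext Lam"
    and QP_combinators: "{cB, cC, cI, cK, cW, cc} \<subseteq> ext QP"
    and QP_app: "\<xi> \<in> ext QP \<Longrightarrow> \<eta> \<in> ext QP \<Longrightarrow> app \<xi> \<eta> \<in> ext QP"

locale coherent_realizability_algebra = realizability_algebra +
  assumes coherent: "\<theta> \<in> ext QP \<Longrightarrow> \<exists>\<pi> \<in> ext Pi. \<theta> \<star> \<pi> \<notin> ext pole"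

end

theory Submission
  imports Defs
begin

text \<open>
A set \<open>X \<subseteq> \<kappa>\<close> of the ground model is coded by the graph of its characteristic function, a set
\<open>\<chi>\<^sub>X \<subseteq> \<kappa>\<close>, such that \<open>\<chi>\<^sub>X \<subseteq> \<chi>\<^sub>Y\<close> only if \<open>X = Y\<close>. Given an injection \<open>f\<close> of \<open>\<gimel>\<kappa>\<close> into \<open>\<omega>\<close> in the
realizability model, send \<open>X\<close> to the real \<open>y\<^sub>X = {f z | z \<in> \<chi>\<^sub>X}\<close>, for which
\<open>y\<^sub>X = {(n, \<pi>) | \<exists>z \<in> \<chi>\<^sub>X. ((z, n), \<pi>) \<in> f}\<close> is a name. If \<open>y\<^sub>X = y\<^sub>Y\<close>, choose in the ground model \<open>z \<in> \<chi>\<^sub>X\<close>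
such that \<open>z \<in> \<chi>\<^sub>Y\<close> implies \<open>X = Y\<close>. Then \<open>f z \<in> y\<^sub>Y\<close> yields \<open>z' \<in> \<chi>\<^sub>Y\<close> with \<open>z = z'\<close>, hence \<open>X = Y\<close>.
The choice of \<open>z\<close> does not enter the realizer, which is therefore uniform in \<open>X\<close> and \<open>Y\<close>.

Membership of \<open>X\<close> itself would not do: \<open>\<gimel>2\<close> may have more than two elements, and the elements \<open>x\<close> of
\<open>\<gimel>\<kappa>\<close> for which the truth value of \<open>x \<in> X\<close> is \<open>1\<close> do not determine \<open>X\<close>. The coding
uses an injection of \<open>\<kappa> \<times> 2\<close> into \<open>\<kappa>\<close>, so \<open>\<kappa>\<close> must be an infinite initial ordinal, and this is where
the axiom of choice, a consequence of \<open>V = L\<close>, is needed in the ground model. There, each level of the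
constructible hierarchy lies in the closure of an ordinal under finitely many partial operations, and
such a closure can be enumerated along the ordinals.
\<close>

section \<open>Definability with parameters\<close>

text \<open>The ground model is an arbitrary structure, possibly ill-founded and with nonstandard
  integers. Isabelle's own recursion and induction therefore do not run along its sets, ordinals or
  integers, and a collection is a set only if a formula with parameters separates it. Hence the
  calculus of \<open>Dfn\<close> and \<open>Tm\<close>, to which the inductions and comprehensions
  inside the model appeal; in particular, realizing a \<subset> b has to be shown definable before
  induction on the name a is possible.

  In the realizability model, one term has to serve all instances of a quantifier. Case distinctions
  in the ground model are harmless as long as they leave the term alone: an empty truth value is
  realized by anything, and an implication between equations of the ground model becomes an
  inclusion of truth values. This is why the condition on z is an implication that also covers the
  case X = Y. Extensional equality, in contrast, is defined by recursion on names, so its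
  reflexivity and transitivity call for realizers that apply themselves.\<close>

primrec ren :: "(nat \<Rightarrow> nat) \<Rightarrow> fm \<Rightarrow> fm" where
  "ren r (FMem i j) = FMem (r i) (r j)"
| "ren r (FEq i j) = FEq (r i) (r j)"
| "ren r (FNot p) = FNot (ren r p)"
| "ren r (FAnd p q) = FAnd (ren r p) (ren r q)"
| "ren r (FAll p) = FAll (ren (case_nat 0 (\<lambda>i. Suc (r i))) p)"

lemma sat_ren: "sat mem (ren r p) e \<longleftrightarrow> sat mem p (\<lambda>i. e (r i))"
proof (induction p arbitrary: r e)
  case (FAll p)
  have "(\<lambda>i. case_nat x e (case_nat 0 (\<lambda>i. Suc (r i)) i)) = case_nat x (\<lambda>i. e (r i))" for x
    by (auto split: nat.split)
  with FAll show ?case by simp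
qed auto

text \<open>The variables of a formula sit at the even positions of its environment, the parameters at
  the odd ones.\<close>

definition join :: "(nat \<Rightarrow> 'm) \<Rightarrow> (nat \<Rightarrow> 'm) \<Rightarrow> nat \<Rightarrow> 'm" where
  "join v e = (\<lambda>i. if even i then v (i div 2) else e (i div 2))"

text \<open>A quantifier of \<open>fm\<close> shifts all positions by one, whereas a new variable in
  front should shift the variables by two and leave the parameters alone. The renaming reconciles
  this: an even position i > 0 is found at i - 1, an odd one at i + 1.\<close>

lemma join_case_nat:
  "join (case_nat x v) e = (\<lambda>i. case_nat x (join v e) (if i = 0 then 0 else if even i then i - 1 else i + 1))"
proof
  fix i show "join (case_nat x v) e i
      = case_nat x (join v e) (if i = 0 then 0 else if even i then i - 1 else i + 1)"
    by (cases i) (auto simp: join_def elim!: oddE evenE split: nat.split)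
qed

named_theorems dfn

context membership
begin

text \<open>The parameter sequence e is quantified existentially, so any individual fixed in the
  context counts as a constant.\<close>

definition Dfn :: "((nat \<Rightarrow> 'm) \<Rightarrow> bool) \<Rightarrow> bool" where
  "Dfn P \<longleftrightarrow> (\<exists>p e. \<forall>v. P v \<longleftrightarrow> sat mem p (join v e))"

definition Tm :: "((nat \<Rightarrow> 'm) \<Rightarrow> 'm) \<Rightarrow> bool" where
  "Tm t \<longleftrightarrow> Dfn (\<lambda>v. v 0 = t (\<lambda>i. v (Suc i)))"

lemma DfnI: "(\<And>v. P v \<longleftrightarrow> sat mem p (join v e)) \<Longrightarrow> Dfn P"
  unfolding Dfn_def by blast

lemma Dfn_cong: "Dfn Q \<Longrightarrow> (\<And>v. P v \<longleftrightarrow> Q v) \<Longrightarrow> Dfn P"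
  unfolding Dfn_def by simp

lemma Dfn_reindex:
  assumes "Dfn P" shows "Dfn (\<lambda>v. P (\<lambda>i. v (r i)))"
proof -
  obtain p e where p: "\<And>v. P v \<longleftrightarrow> sat mem p (join v e)"
    using assms unfolding Dfn_def by blast
  show ?thesis
    by (rule DfnI[of _ "ren (\<lambda>i. if even i then 2 * r (i div 2) else i) p" e])
      (auto simp: p sat_ren join_def intro!: arg_cong[where f = "sat mem p"])
qed

lemma Dfn_not[dfn]: assumes "Dfn P" shows "Dfn (\<lambda>v. \<not> P v)"
proof -
  obtain p e where p: "\<And>v. P v \<longleftrightarrow> sat mem p (join v e)"
    using assms unfolding Dfn_def by blast
  show ?thesis by (rule DfnI[of _ "FNot p" e]) (simp add: p)
qed

lemma Dfn_conj[dfn]: assumes "Dfn P" "Dfn Q" shows "Dfn (\<lambda>v. P v \<and> Q v)"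
proof -
  obtain p e where p: "\<And>v. P v \<longleftrightarrow> sat mem p (join v e)"
    using assms(1) unfolding Dfn_def by blast
  obtain q f where q: "\<And>v. Q v \<longleftrightarrow> sat mem q (join v f)"
    using assms(2) unfolding Dfn_def by blast
  \<comment> \<open>The two parameter sequences are interleaved: the i-th parameter of p moves from
    position 2i + 1 to 4i + 1, that of q to 4i + 3.\<close>
  have 1: "(\<lambda>i. join v (join e f) (if even i then i else 2 * (i - 1) + 1)) = join v e" for v
    by (auto simp: fun_eq_iff join_def elim!: oddE)
  have 2: "(\<lambda>i. join v (join e f) (if even i then i else 2 * i + 1)) = join v f" for v
    by (auto simp: join_def)
  show ?thesis
    by (rule DfnI[of _ "FAnd (ren (\<lambda>i. if even i then i else 2 * (i - 1) + 1) p)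
        (ren (\<lambda>i. if even i then i else 2 * i + 1) q)" "join e f"])
      (simp add: p q sat_ren 1 2)
qed

lemma Dfn_disj[dfn]: "Dfn P \<Longrightarrow> Dfn Q \<Longrightarrow> Dfn (\<lambda>v. P v \<or> Q v)"
  by (rule Dfn_cong[OF Dfn_not[OF Dfn_conj[OF Dfn_not Dfn_not]]]) auto

lemma Dfn_imp[dfn]: "Dfn P \<Longrightarrow> Dfn Q \<Longrightarrow> Dfn (\<lambda>v. P v \<longrightarrow> Q v)"
  by (rule Dfn_cong[OF Dfn_disj[OF Dfn_not]]) auto

lemma Dfn_iff[dfn]: "Dfn P \<Longrightarrow> Dfn Q \<Longrightarrow> Dfn (\<lambda>v. P v \<longleftrightarrow> Q v)"
  by (rule Dfn_cong[of "\<lambda>v. (P v \<longrightarrow> Q v) \<and> (Q v \<longrightarrow> P v)"]) (auto intro: dfn)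

lemma Dfn_all[dfn]:
  assumes "Dfn (\<lambda>v. P (v 0) (\<lambda>i. v (Suc i)))" shows "Dfn (\<lambda>v. \<forall>x. P x v)"
proof -
  obtain p e where p: "\<And>v. P (v 0) (\<lambda>i. v (Suc i)) \<longleftrightarrow> sat mem p (join v e)"
    using assms unfolding Dfn_def by blast
  have "P x v \<longleftrightarrow> sat mem p (join (case_nat x v) e)" for x v
    using p[of "case_nat x v"] by simp
  then show ?thesis
    by (intro DfnI[of _ "FAll (ren (\<lambda>i. if i = 0 then 0 else if even i then i - 1 else i + 1) p)" e])
      (simp add: sat_ren join_case_nat)
qed

lemma Dfn_ex[dfn]: "Dfn (\<lambda>v. P (v 0) (\<lambda>i. v (Suc i))) \<Longrightarrow> Dfn (\<lambda>v. \<exists>x. P x v)"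
  by (rule Dfn_cong[OF Dfn_not[OF Dfn_all[OF Dfn_not]]]) auto

lemma Dfn_const[dfn]: "Dfn (\<lambda>v. P)"
proof (cases P)
  case True
  have "Dfn (\<lambda>v. v 0 = v 0)" by (rule DfnI[of _ "FEq 0 0"]) simp
  with True show ?thesis by simp
next
  case False
  have "Dfn (\<lambda>v. v 0 \<noteq> v 0)" by (rule DfnI[of _ "FNot (FEq 0 0)"]) simp
  with False show ?thesis by simp
qed

lemma Tm_var[dfn]: "Tm (\<lambda>v. v i)"
  unfolding Tm_def by (rule DfnI[of _ "FEq 0 (2 * Suc i)"]) (simp add: join_def)

lemma Tm_const[dfn]: "Tm (\<lambda>v. c)"
  unfolding Tm_def by (rule DfnI[of _ "FEq 0 1" "\<lambda>_. c"]) (simp add: join_def)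

lemma TmI: "Dfn (\<lambda>v. v 0 = t (\<lambda>i. v (Suc i))) \<Longrightarrow> Tm t"
  unfolding Tm_def .

lemma Tm_shift:
  assumes "Tm t" shows "Tm (\<lambda>v. t (\<lambda>i. v (r i)))"
  using Dfn_reindex[OF assms[unfolded Tm_def], of "case_nat 0 (\<lambda>i. Suc (r i))"]
  unfolding Tm_def by simp

lemma Dfn_subst:
  assumes "Dfn (\<lambda>v. P (v 0) (\<lambda>i. v (Suc i)))" "Tm t"
  shows "Dfn (\<lambda>v. P (t v) v)"
  by (rule Dfn_cong[OF Dfn_ex[where P = "\<lambda>x v. x = t v \<and> P x v", OF Dfn_conj[OF assms(2)[unfolded Tm_def] assms(1)]]]) auto

lemma Dfn1:
  assumes "Dfn (\<lambda>v. P (v 0))" "Tm t" shows "Dfn (\<lambda>v. P (t v))"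
  using Dfn_subst[of "\<lambda>x v. P x"] assms by simp

lemma Dfn2:
  assumes "Dfn (\<lambda>v. P (v 0) (v 1))" "Tm s" "Tm t" shows "Dfn (\<lambda>v. P (s v) (t v))"
proof (rule Dfn_subst[of "\<lambda>x v. P x (t v)", OF _ assms(2)])
  have "Tm (\<lambda>v. t (\<lambda>i. v (Suc i)))" by (rule Tm_shift[OF assms(3)])
  moreover have "Dfn (\<lambda>v. P (v 1) (v 0))"
    using Dfn_reindex[OF assms(1), of "\<lambda>i. 1 - i"] by simp
  ultimately show "Dfn (\<lambda>v. P (v 0) (t (\<lambda>i. v (Suc i))))"
    using Dfn_subst[of "\<lambda>x v. P (v 0) x"] by simp
qed

lemma Dfn_mem[dfn]: "Tm s \<Longrightarrow> Tm t \<Longrightarrow> Dfn (\<lambda>v. mem (s v) (t v))"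
  by (rule Dfn2[of mem]) (rule DfnI[of _ "FMem 0 2"], simp add: join_def)

lemma Dfn_eq[dfn]: "Tm s \<Longrightarrow> Tm t \<Longrightarrow> Dfn (\<lambda>v. s v = t v)"
  by (rule Dfn2[of "(=)"]) (rule DfnI[of _ "FEq 0 2"], simp add: join_def)

lemma Dfn3:
  assumes P: "Dfn (\<lambda>v. P (v 0) (v 1) (v 2))" and t: "Tm s" "Tm t" "Tm u"
  shows "Dfn (\<lambda>v. P (s v) (t v) (u v))"
proof -
  \<comment> \<open>The nested existential quantifiers below give the innermost variable the index
    0, hence the reversed order.\<close>
  have "Dfn (\<lambda>v. P (v 2) (v 1) (v 0))"
    using Dfn_reindex[OF P, of "\<lambda>i. 2 - i"] by simp
  then have "Dfn (\<lambda>v. \<exists>x. x = s v \<and> (\<exists>y. y = t v \<and> (\<exists>z. z = u v \<and> P x y z)))"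
    by (intro dfn t[THEN Tm_shift]) (simp add: numeral_eq_Suc)
  then show ?thesis by (rule Dfn_cong) auto
qed

lemma Dfn4:
  assumes P: "Dfn (\<lambda>v. P (v 0) (v 1) (v 2) (v 3))" and t: "Tm s" "Tm t" "Tm u" "Tm w"
  shows "Dfn (\<lambda>v. P (s v) (t v) (u v) (w v))"
proof -
  have "Dfn (\<lambda>v. P (v 3) (v 2) (v 1) (v 0))"
    using Dfn_reindex[OF P, of "\<lambda>i. 3 - i"] by simp
  then have "Dfn (\<lambda>v. \<exists>x. x = s v \<and> (\<exists>y. y = t v \<and> (\<exists>z. z = u v \<and> (\<exists>a. a = w v \<and> P x y z a))))"
    by (intro dfn t[THEN Tm_shift]) (simp add: numeral_eq_Suc)
  then show ?thesis by (rule Dfn_cong) auto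
qed

lemma Dfn_ext[dfn]: "Tm s \<Longrightarrow> Tm t \<Longrightarrow> Dfn (\<lambda>v. s v \<in> ext (t v))"
  unfolding ext_def by (auto intro: dfn)

lemma Dfn_ball[dfn]:
  assumes "Tm t" "Dfn (\<lambda>v. P (v 0) (\<lambda>i. v (Suc i)))"
  shows "Dfn (\<lambda>v. \<forall>x \<in> ext (t v). P x v)"
  unfolding Ball_def by (intro dfn assms Tm_shift[OF assms(1)])

lemma Dfn_bex[dfn]:
  assumes "Tm t" "Dfn (\<lambda>v. P (v 0) (\<lambda>i. v (Suc i)))"
  shows "Dfn (\<lambda>v. \<exists>x \<in> ext (t v). P x v)"
  unfolding Bex_def by (intro dfn assms Tm_shift[OF assms(1)])

lemma Dfn_ex1[dfn]:
  assumes "Dfn (\<lambda>v. P (v 0) (\<lambda>i. v (Suc i)))"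
  shows "Dfn (\<lambda>v. \<exists>!x. P x v)"
proof -
  have "Dfn (\<lambda>v. P (v 0) (\<lambda>i. v (Suc (Suc i))))"
    using Dfn_reindex[OF assms, of "\<lambda>i. case i of 0 \<Rightarrow> 0 | Suc j \<Rightarrow> Suc (Suc j)"] by simp
  then show ?thesis unfolding Ex1_def by (intro dfn assms)
qed

lemma Dfn_subset[dfn]: "Tm s \<Longrightarrow> Tm t \<Longrightarrow> Dfn (\<lambda>v. ext (s v) \<subseteq> ext (t v))"
  by (rule Dfn2[of "\<lambda>x y. ext x \<subseteq> ext y"]) (unfold subset_eq, intro dfn)

end

section \<open>Elementary set theory in the ground model\<close>

context membership
begin

abbreviation emp :: 'm where "emp \<equiv> setof {}"

lemma Tm1:
  assumes "Tm (\<lambda>v. f (v 0))" "Tm s" shows "Tm (\<lambda>v. f (s v))"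
  unfolding Tm_def
  by (rule Dfn2[of "\<lambda>z x. z = f x"])
    (use assms[unfolded Tm_def] in \<open>simp_all add: Tm_var Tm_shift[OF assms(2)]\<close>)

lemma Tm2:
  assumes "Tm (\<lambda>v. f (v 0) (v 1))" "Tm s" "Tm t" shows "Tm (\<lambda>v. f (s v) (t v))"
  unfolding Tm_def
  by (rule Dfn3[of "\<lambda>z x y. z = f x y"])
    (use assms[unfolded Tm_def] in \<open>simp_all add: numeral_eq_Suc Tm_var assms(2,3)[THEN Tm_shift]\<close>)

end

context ZFL_model
begin

lemma ext_inject: "ext a = ext b \<longleftrightarrow> a = b"
  by (auto simp: ext_def intro: extensionality)

lemma setof_ext[simp]: "setof (ext a) = a"
  unfolding setof_def by (simp add: ext_inject)

lemma ext_setof: "coded X \<Longrightarrow> ext (setof X) = X"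
  by (auto simp: coded_def)

lemma coded_ext[simp]: "coded (ext a)"
  by (auto simp: coded_def)

lemma set_eqI: "(\<And>x. x \<in> ext a \<longleftrightarrow> x \<in> ext b) \<Longrightarrow> a = b"
  by (simp add: set_eq_iff flip: ext_inject)

lemma eq_setof_iff: "coded X \<Longrightarrow> y = setof X \<longleftrightarrow> (\<forall>x. x \<in> ext y \<longleftrightarrow> x \<in> X)"
  by (simp add: ext_setof set_eq_iff flip: ext_inject)

section \<open>Separation and replacement for definable predicates\<close>

lemma coded_sep:
  assumes "Dfn (\<lambda>v. P (v 0))" shows "coded {x \<in> ext a. P x}"
proof -
  obtain p e where p: "\<And>v. P (v 0) \<longleftrightarrow> sat mem p (join v e)"
    using assms unfolding Dfn_def by blast
  \<comment> \<open>The predicate looks only at \<open>v 0\<close>, so the tail of the assignment is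
    immaterial; the parameter sequence e fills it.\<close>
  have "P x \<longleftrightarrow> sat mem (ren (\<lambda>i. if i = 0 then 0 else if even i then i - 1 else i + 1) p)
      (case_nat x (join e e))" for x
    using p[of "case_nat x e"] by (simp add: sat_ren join_case_nat)
  then obtain b where "\<forall>x. mem x b \<longleftrightarrow> mem x a \<and> P x"
    using separation[where a = a] by presburger
  then show ?thesis unfolding coded_def ext_def by blast
qed

lemma coded_bounded:
  assumes "Dfn (\<lambda>v. P (v 0))" "\<And>x. P x \<Longrightarrow> x \<in> ext a" shows "coded {x. P x}"
  using coded_sep[OF assms(1), of a] assms(2) by (metis (mono_tags, lifting) Collect_cong)

lemma coded_image_total:
  assumes "Dfn (\<lambda>v. R (v 0) (v 1))" and "\<And>x. x \<in> ext a \<Longrightarrow> \<exists>!y. R x y"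
  shows "coded {y. \<exists>x \<in> ext a. R x y}"
proof -
  have "Dfn (\<lambda>v. R (v 1) (v 0))" using Dfn_reindex[OF assms(1), of "\<lambda>i. 1 - i"] by simp
  then obtain p e where p: "\<And>v. R (v 1) (v 0) \<longleftrightarrow> sat mem p (join v e)"
    unfolding Dfn_def by blast
  let ?r = "\<lambda>i::nat. if i = 0 then 0 else if even i then i - 1 else i + 1"
  let ?q = "ren (\<lambda>i. case_nat 0 (\<lambda>i. Suc (?r i)) (?r i)) p"
  have key: "case_nat y (\<lambda>i. F (?r i)) k = case_nat y F (case_nat 0 (\<lambda>i. Suc (?r i)) k)"
    for y k and F :: "nat \<Rightarrow> 'a"
    by (cases k) simp_all
  have "join (case_nat y (case_nat x e)) e = (\<lambda>i. case_nat y (case_nat x (join e e))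
      (case_nat 0 (\<lambda>i. Suc (?r i)) (?r i)))" for x y
    by (simp only: join_case_nat[of y] join_case_nat[of x] key[of y "case_nat x (join e e)"])
  then have q: "R x y \<longleftrightarrow> sat mem ?q (case_nat y (case_nat x (join e e)))" for x y
    using p[of "case_nat y (case_nat x e)"] by (simp only: sat_ren nat.case One_nat_def)
  have "\<forall>x. mem x a \<longrightarrow> (\<exists>!y. sat mem ?q (case_nat y (case_nat x (join e e))))"
    using assms(2) unfolding q ext_def by blast
  from replacement[OF this] obtain b where "\<forall>y. mem y b \<longleftrightarrow> (\<exists>x. mem x a \<and> R x y)"
    unfolding q by blast
  then show ?thesis unfolding coded_def ext_def by blast
qed

text \<open>Replacement is stated for relations that are total on a, so the domain is cut down by
  separation to the points where R has a value.\<close>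

lemma coded_image:
  assumes R: "Dfn (\<lambda>v. R (v 0) (v 1))"
    and fn: "\<And>x y z. x \<in> ext a \<Longrightarrow> R x y \<Longrightarrow> R x z \<Longrightarrow> y = z"
  shows "coded {y. \<exists>x \<in> ext a. R x y}"
proof -
  have "Dfn (\<lambda>v. \<exists>y. R (v 0) y)"
    by (intro dfn Dfn2[OF R])
  from ext_setof[OF coded_sep[OF this, of a]]
  have a': "ext (setof {x \<in> ext a. \<exists>y. R x y}) = {x \<in> ext a. \<exists>y. R x y}" .
  have "coded {y. \<exists>x \<in> ext (setof {x \<in> ext a. \<exists>y. R x y}). R x y}"
    by (rule coded_image_total[OF R]) (use fn in \<open>auto simp: a'\<close>)
  moreover have "{y. \<exists>x \<in> ext (setof {x \<in> ext a. \<exists>y. R x y}). R x y} = {y. \<exists>x \<in> ext a. R x y}"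
    by (auto simp: a')
  ultimately show ?thesis by simp
qed

text \<open>\<open>setof\<close> is a definite description; because the collection is coded for
  every value of the variables, an equation with it can be replaced by an elementwise
  comparison.\<close>

lemma Tm_setof:
  assumes "\<And>v. coded {x. P x v}" "Dfn (\<lambda>v. P (v 0) (\<lambda>i. v (Suc i)))"
  shows "Tm (\<lambda>v. setof {x. P x v})"
proof (rule TmI)
  have "Dfn (\<lambda>v. P (v 0) (\<lambda>i. v (Suc (Suc i))))"
    using Dfn_reindex[OF assms(2), of "case_nat 0 (\<lambda>i. Suc (Suc i))"] by simp
  then have "Dfn (\<lambda>v. \<forall>x. x \<in> ext (v 0) \<longleftrightarrow> P x (\<lambda>i. v (Suc i)))" by (intro dfn)
  then show "Dfn (\<lambda>v. v 0 = setof {x. P x (\<lambda>i. v (Suc i))})"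
    by (rule Dfn_cong) (simp add: eq_setof_iff[OF assms(1)])
qed

lemma coded_empty[simp]: "coded {}"
  using coded_sep[of "\<lambda>_. False"] by (simp add: Dfn_const)

lemma coded_doubleton[simp]: "coded {a, b}"
  using pairing[of a b] unfolding coded_def ext_def by blast

lemma coded_singleton[simp]: "coded {a}"
  using coded_doubleton[of a a] by simp

lemma coded_Union: "coded (\<Union>y \<in> ext a. ext y)"
  using union[of a] unfolding coded_def ext_def by blast

lemma coded_Un[simp]: assumes "coded X" "coded Y" shows "coded (X \<union> Y)"
  using coded_Union[of "setof {setof X, setof Y}"] assms by (simp add: ext_setof)

lemma coded_insert[simp]: "coded X \<Longrightarrow> coded (insert a X)"
  using coded_Un[of "{a}" X] by simp

lemma coded_pow: "coded {x. ext x \<subseteq> ext a}"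
  using power_set[of a] unfolding coded_def ext_def subset_eq by simp blast

lemma ext_emp[simp]: "ext emp = {}" by (simp add: ext_setof)

lemma ext_pow[simp]: "ext (pow a) = {x. ext x \<subseteq> ext a}"
  unfolding pow_def by (simp add: ext_setof coded_pow)

lemma ext_succ[simp]: "ext (succ a) = insert a (ext a)"
  unfolding succ_def by (simp add: ext_setof)

lemma ext_opair: "ext (opair a b) = {setof {a}, setof {a, b}}"
  unfolding opair_def by (simp add: ext_setof)

lemma setof_inject: "coded X \<Longrightarrow> coded Y \<Longrightarrow> setof X = setof Y \<longleftrightarrow> X = Y"
  using ext_setof by metis

lemma opair_inject[simp]: "opair a b = opair c d \<longleftrightarrow> a = c \<and> b = d"
  unfolding opair_def by (auto simp: setof_inject doubleton_eq_iff)

lemma Tm_insert_setof: "Tm s \<Longrightarrow> Tm t \<Longrightarrow> Tm (\<lambda>v. setof {s v, t v})"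
proof (rule Tm2[of "\<lambda>x y. setof {x, y}"])
  have "{x. x = a \<or> x = b} = {a, b}" for a b :: 'a by auto
  moreover from this have "Tm (\<lambda>v. setof {x. x = v 0 \<or> x = v 1})"
    by (intro Tm_setof dfn) simp
  ultimately show "Tm (\<lambda>v. setof {v 0, v 1})" by simp
qed

lemma Tm_opair[dfn]: "Tm s \<Longrightarrow> Tm t \<Longrightarrow> Tm (\<lambda>v. opair (s v) (t v))"
  unfolding opair_def using Tm_insert_setof[of s s] by (intro Tm_insert_setof) auto

lemma Tm_succ[dfn]: "Tm s \<Longrightarrow> Tm (\<lambda>v. succ (s v))"
proof (rule Tm1[of succ])
  have "{x. x = a \<or> x \<in> ext a} = insert a (ext a)" for a by auto
  moreover from this have "Tm (\<lambda>v. setof {x. x = v 0 \<or> x \<in> ext (v 0)})"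
    by (intro Tm_setof dfn) simp
  ultimately show "Tm (\<lambda>v. succ (v 0))" unfolding succ_def by simp
qed

lemma coded_cart: "coded {opair x y | x y. x \<in> ext a \<and> y \<in> ext b}"
  by (rule coded_bounded[where a = "pow (pow (setof (ext a \<union> ext b)))"])
    (auto intro!: dfn simp: ext_setof ext_opair)

lemma ext_cart: "ext (cart a b) = {opair x y | x y. x \<in> ext a \<and> y \<in> ext b}"
  unfolding cart_def by (simp add: ext_setof coded_cart)

lemma opair_in_cart[simp]: "opair x y \<in> ext (cart a b) \<longleftrightarrow> x \<in> ext a \<and> y \<in> ext b"
  by (auto simp: ext_cart)

lemma is_min: "x \<in> ext a \<Longrightarrow> \<exists>x \<in> ext a. \<forall>y \<in> ext x. y \<notin> ext a"
  using foundation[of a] unfolding ext_def by auto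

lemma mem_irrefl[simp]: "x \<notin> ext x"
  using is_min[of x "setof {x}"] by (auto simp: ext_setof)

lemma mem_asym: "x \<in> ext y \<Longrightarrow> y \<notin> ext x"
  using is_min[of x "setof {x, y}"] by (auto simp: ext_setof)

lemma succ_inject[simp]: "succ a = succ b \<longleftrightarrow> a = b"
  using mem_asym by (metis ext_succ insert_iff)

lemma succ_ne_emp[simp]: "succ a \<noteq> emp" "emp \<noteq> succ a"
  by (metis ext_emp ext_succ insert_not_empty)+

subsection \<open>Least fixed points\<close>

definition closed_under :: "'a \<Rightarrow> ('a \<Rightarrow> 'a \<Rightarrow> bool) \<Rightarrow> 'a \<Rightarrow> bool" where
  "closed_under U \<Phi> Y \<longleftrightarrow> (\<forall>x \<in> ext U. \<Phi> Y x \<longrightarrow> x \<in> ext Y)"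

text \<open>The intersection runs over individuals of the model only: this is the least closed set
  among the sets of the model, and induction over it is confined to definable predicates.\<close>

definition lfix :: "'a \<Rightarrow> ('a \<Rightarrow> 'a \<Rightarrow> bool) \<Rightarrow> 'a" where
  "lfix U \<Phi> = setof {x \<in> ext U. \<forall>Y. closed_under U \<Phi> Y \<longrightarrow> x \<in> ext Y}"

context
  fixes \<Phi> :: "'a \<Rightarrow> 'a \<Rightarrow> bool" and U :: 'a
  assumes D: "Dfn (\<lambda>v. \<Phi> (v 0) (v 1))"
    and monotone: "\<forall>Y Y' x. ext Y \<subseteq> ext Y' \<longrightarrow> \<Phi> Y x \<longrightarrow> \<Phi> Y' x"
begin

private lemmas mono = monotone[rule_format]

lemma ext_lfix: "ext (lfix U \<Phi>) = {x \<in> ext U. \<forall>Y. closed_under U \<Phi> Y \<longrightarrow> x \<in> ext Y}"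
proof -
  have "Dfn (\<lambda>v. \<forall>Y. closed_under U \<Phi> Y \<longrightarrow> v 0 \<in> ext Y)"
    unfolding closed_under_def by (intro dfn Dfn2[OF D])
  then show ?thesis unfolding lfix_def by (intro ext_setof coded_sep)
qed

lemma lfix_least: "closed_under U \<Phi> Y \<Longrightarrow> ext (lfix U \<Phi>) \<subseteq> ext Y"
  unfolding ext_lfix by blast

lemma lfix_closed: "x \<in> ext U \<Longrightarrow> \<Phi> (lfix U \<Phi>) x \<Longrightarrow> x \<in> ext (lfix U \<Phi>)"
  using mono[OF lfix_least] unfolding ext_lfix[unfolded set_eq_iff, rule_format] closed_under_def
  by blast

lemma lfix_unfold: "x \<in> ext (lfix U \<Phi>) \<longleftrightarrow> x \<in> ext U \<and> \<Phi> (lfix U \<Phi>) x"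
proof
  \<comment> \<open>One application of \<Phi> to the fixed point is again closed, so it contains the
    fixed point.\<close>
  let ?I = "lfix U \<Phi>" and ?J = "setof {x \<in> ext U. \<Phi> (lfix U \<Phi>) x}"
  have E: "ext ?J = {x \<in> ext U. \<Phi> ?I x}"
    by (intro ext_setof coded_sep Dfn2[OF D] dfn)
  have "ext ?J \<subseteq> ext ?I" using lfix_closed unfolding E by blast
  from mono[OF this] have "closed_under U \<Phi> ?J" unfolding closed_under_def E by blast
  from lfix_least[OF this] show "x \<in> ext ?I \<Longrightarrow> x \<in> ext U \<and> \<Phi> ?I x" unfolding E by blast
qed (use lfix_closed in auto)

text \<open>The hypothesis is phrased with an individual Y because \<Phi> acts on sets of the model;
  in the proof, Y is the part of the fixed point where Q holds.\<close>

lemma lfix_induct: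
  assumes Q: "Dfn (\<lambda>v. Q (v 0))"
    and step: "\<And>Y x. x \<in> ext U \<Longrightarrow> ext Y \<subseteq> ext (lfix U \<Phi>) \<Longrightarrow> (\<And>y. y \<in> ext Y \<Longrightarrow> Q y) \<Longrightarrow>
      \<Phi> Y x \<Longrightarrow> Q x"
    and x: "x \<in> ext (lfix U \<Phi>)"
  shows "Q x"
proof -
  let ?I = "lfix U \<Phi>" and ?J = "setof {x \<in> ext (lfix U \<Phi>). Q x}"
  have E: "ext ?J = {x \<in> ext ?I. Q x}"
    by (intro ext_setof coded_sep Q)
  have "closed_under U \<Phi> ?J"
    unfolding closed_under_def
  proof (intro ballI impI)
    fix x assume x: "x \<in> ext U" "\<Phi> ?J x"
    have J: "ext ?J \<subseteq> ext ?I" unfolding E by blast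
    have "x \<in> ext ?I" using lfix_closed[OF x(1) mono[OF J x(2)]] .
    moreover have "Q x" by (rule step[OF x(1) J _ x(2)]) (simp add: E)
    ultimately show "x \<in> ext ?J" unfolding E by blast
  qed
  from lfix_least[OF this] x show "Q x" unfolding E by blast
qed

end

subsection \<open>Natural numbers and ordinals\<close>

lemma is_inductive_exists: "\<exists>w. is_inductive w"
proof -
  obtain w where w: "\<exists>z. mem z w \<and> (\<forall>x. \<not> mem x z)"
    "\<forall>n. mem n w \<longrightarrow> (\<exists>m. mem m w \<and> (\<forall>x. mem x m \<longleftrightarrow> mem x n \<or> x = n))"
    using infinity by blast
  have "emp \<in> ext w"
  proof -
    obtain z where z: "mem z w" "\<forall>x. \<not> mem x z" using w(1) by blast
    have "z = emp" using z(2) by (intro set_eqI) (simp add: ext_def[of z])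
    with z show ?thesis by (simp add: ext_def)
  qed
  moreover have "succ n \<in> ext w" if n: "n \<in> ext w" for n
  proof -
    obtain m where m: "mem m w" "\<forall>x. mem x m \<longleftrightarrow> mem x n \<or> x = n"
      using w(2) n unfolding ext_def by blast
    have "m = succ n" using m(2) by (intro set_eqI) (auto simp: ext_def[of m] ext_def[of n])
    with m show ?thesis by (simp add: ext_def)
  qed
  ultimately show ?thesis unfolding is_inductive_def by blast
qed

lemma ext_omega: "ext omega = {n. \<forall>z. is_inductive z \<longrightarrow> n \<in> ext z}"
proof -
  obtain w where w: "is_inductive w" using is_inductive_exists by blast
  have "Dfn (\<lambda>v. \<forall>z. is_inductive z \<longrightarrow> v 0 \<in> ext z)"
    unfolding is_inductive_def by (intro dfn)
  from coded_bounded[OF this, of w] w show ?thesis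
    unfolding omega_def by (intro ext_setof) blast
qed

lemma omega_emp[simp]: "emp \<in> ext omega"
  unfolding ext_omega is_inductive_def by blast

lemma omega_succ[simp]: "n \<in> ext omega \<Longrightarrow> succ n \<in> ext omega"
  unfolding ext_omega is_inductive_def by blast

text \<open>The integers of the model may be nonstandard, so induction over them is legitimate only
  for predicates that cut out a set.\<close>

lemma omega_induct[consumes 2, case_names zero Suc]:
  assumes P: "Dfn (\<lambda>v. P (v 0))" and n: "n \<in> ext omega"
    and "P emp" "\<And>n. n \<in> ext omega \<Longrightarrow> P n \<Longrightarrow> P (succ n)"
  shows "P n"
proof -
  have E: "ext (setof {n \<in> ext omega. P n}) = {n \<in> ext omega. P n}"
    by (intro ext_setof coded_sep P)
  have "is_inductive (setof {n \<in> ext omega. P n})"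
    unfolding is_inductive_def E using assms by auto
  then show ?thesis using n E unfolding ext_omega by blast
qed

lemma Dfn_transitive_set[dfn]: "Tm s \<Longrightarrow> Dfn (\<lambda>v. transitive_set (s v))"
  by (rule Dfn1[of transitive_set]) (unfold transitive_set_def, intro dfn)

lemma Dfn_ordinal[dfn]: "Tm s \<Longrightarrow> Dfn (\<lambda>v. ordinal (s v))"
  by (rule Dfn1[of ordinal]) (unfold ordinal_def, intro dfn)

lemma ord_elem: "ordinal a \<Longrightarrow> x \<in> ext a \<Longrightarrow> ordinal x"
  unfolding ordinal_def transitive_set_def by blast

lemma ord_trans: "ordinal a \<Longrightarrow> x \<in> ext a \<Longrightarrow> y \<in> ext x \<Longrightarrow> y \<in> ext a"
  unfolding ordinal_def transitive_set_def by blast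

lemma ord_emp[simp]: "ordinal emp"
  unfolding ordinal_def transitive_set_def by simp

lemma ord_succ[simp]: "ordinal a \<Longrightarrow> ordinal (succ a)"
  unfolding ordinal_def transitive_set_def by auto

lemma ord_least:
  assumes P: "Dfn (\<lambda>v. P (v 0))" and a: "ordinal a" "P a"
  obtains b where "ordinal b" "P b" "\<And>x. x \<in> ext b \<Longrightarrow> \<not> P x" "b \<in> ext (succ a)"
proof -
  have E: "ext (setof {x \<in> ext (succ a). P x}) = {x \<in> ext (succ a). P x}"
    by (intro ext_setof coded_sep P)
  \<comment> \<open>Searching in \<open>succ a\<close> includes a itself. As \<open>succ a\<close>
    is transitive, a minimal element found there has no smaller competitor elsewhere.\<close>
  have "a \<in> ext (setof {x \<in> ext (succ a). P x})" unfolding E using a by simp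
  from is_min[OF this, unfolded E] obtain b where b: "b \<in> ext (succ a)" "P b"
    "\<And>y. y \<in> ext b \<Longrightarrow> y \<in> ext (succ a) \<Longrightarrow> \<not> P y" by blast
  have "ordinal b" using b(1) a(1) ord_elem[of a] by auto
  moreover have "\<not> P y" if "y \<in> ext b" for y
    using b that ord_trans[OF ord_succ[OF a(1)] b(1)] by blast
  ultimately show ?thesis using that b by blast
qed

lemma ord_induct[consumes 2, case_names step]:
  assumes P: "Dfn (\<lambda>v. P (v 0))" and a: "ordinal a"
    and step: "\<And>a. ordinal a \<Longrightarrow> (\<And>x. x \<in> ext a \<Longrightarrow> P x) \<Longrightarrow> P a"
  shows "P a"
proof (rule ccontr)
  assume "\<not> P a"
  from ord_least[OF Dfn_not[OF P] a this] step show False by metis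
qed

text \<open>Induction on a and, inside it, on b: if a and b are incomparable, the two hypotheses
  make each a subset of the other.\<close>

lemma ord_linear:
  assumes "ordinal a" "ordinal b" shows "a \<in> ext b \<or> a = b \<or> b \<in> ext a"
proof -
  let ?P = "\<lambda>a b. a \<in> ext b \<or> a = b \<or> b \<in> ext a"
  have "\<forall>b. ordinal b \<longrightarrow> ?P a b"
  proof (rule ord_induct[of "\<lambda>a. \<forall>b. ordinal b \<longrightarrow> ?P a b", OF _ assms(1)], intro dfn, intro allI impI)
    fix a b assume a: "ordinal a" and IHa: "\<And>x. x \<in> ext a \<Longrightarrow> \<forall>b. ordinal b \<longrightarrow> ?P x b"
      and "ordinal b"
    have "Dfn (\<lambda>v. ?P a (v 0))" by (intro dfn)
    from this \<open>ordinal b\<close> show "?P a b"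
    proof (induction rule: ord_induct)
      case (step b)
      show ?case
      proof (rule ccontr)
        assume n: "\<not> ?P a b"
        have "x \<in> ext b" if "x \<in> ext a" for x
          using IHa[OF that] step(1) n that ord_trans[OF a that] by blast
        moreover have "y \<in> ext a" if "y \<in> ext b" for y
          using step(2)[OF that] n that ord_trans[OF step(1) that] by blast
        ultimately have "a = b" by (intro set_eqI) blast
        with n show False by blast
      qed
    qed
  qed
  with assms(2) show ?thesis by blast
qed

lemma ord_subset: "ordinal a \<Longrightarrow> ordinal b \<Longrightarrow> ext a \<subseteq> ext b \<longleftrightarrow> a \<in> ext b \<or> a = b"
  using ord_linear ord_trans mem_irrefl by blast

lemma ord_omega_elem: "n \<in> ext omega \<Longrightarrow> ordinal n"
  by (rule omega_induct[of ordinal]) (auto intro: dfn)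

lemma omega_transitive: "n \<in> ext omega \<Longrightarrow> ext n \<subseteq> ext omega"
  by (rule omega_induct[of "\<lambda>n. ext n \<subseteq> ext omega"]) (auto intro: dfn)

lemma ord_omega[simp]: "ordinal omega"
  unfolding ordinal_def transitive_set_def
  using ord_omega_elem omega_transitive unfolding ordinal_def transitive_set_def by blast

lemma ord_Un: "ordinal a \<Longrightarrow> ordinal b \<Longrightarrow> ordinal (setof (ext a \<union> ext b))"
  unfolding ordinal_def transitive_set_def by (simp add: ext_setof) blast

lemma omega_cases: "n \<in> ext omega \<Longrightarrow> n = emp \<or> (\<exists>m \<in> ext omega. n = succ m)"
  by (rule omega_induct[of "\<lambda>n. n = emp \<or> (\<exists>m \<in> ext omega. n = succ m)"]) (intro dfn, auto)

end

section \<open>Functions and transfinite enumeration\<close>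

context ZFL_model
begin

lemma is_fun_iff: "is_fun f a b \<longleftrightarrow> (\<forall>p \<in> ext f. \<exists>x \<in> ext a. \<exists>y \<in> ext b. p = opair x y) \<and>
    (\<forall>x \<in> ext a. \<exists>!y. opair x y \<in> ext f)"
  unfolding is_fun_def by auto

lemma Dfn_is_fun[dfn]: "Tm f \<Longrightarrow> Tm a \<Longrightarrow> Tm b \<Longrightarrow> Dfn (\<lambda>v. is_fun (f v) (a v) (b v))"
  by (rule Dfn3[of is_fun]) (unfold is_fun_iff, intro dfn)

lemma fun_in: "is_fun f a b \<Longrightarrow> opair x y \<in> ext f \<Longrightarrow> x \<in> ext a \<and> y \<in> ext b"
  unfolding is_fun_iff by force

lemma fun_val: "is_fun f a b \<Longrightarrow> x \<in> ext a \<Longrightarrow> opair x y \<in> ext f \<longleftrightarrow> y = val f x"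
  unfolding is_fun_iff val_def by (metis (mono_tags, lifting) the_equality)

lemma val_in: "is_fun f a b \<Longrightarrow> x \<in> ext a \<Longrightarrow> val f x \<in> ext b"
  using fun_val fun_in by blast

lemma fun_unique: "is_fun f a b \<Longrightarrow> opair x y \<in> ext f \<Longrightarrow> opair x y' \<in> ext f \<Longrightarrow> y = y'"
  using fun_in unfolding is_fun_iff by blast

lemma fun_total: "is_fun f a b \<Longrightarrow> x \<in> ext a \<Longrightarrow> \<exists>y. opair x y \<in> ext f"
  unfolding is_fun_iff by blast

lemma coded_graph:
  assumes "Dfn (\<lambda>v. R (v 0) (v 1))"
  shows "coded {opair x y | x y. x \<in> ext a \<and> y \<in> ext b \<and> R x y}"
  by (rule coded_bounded[where a = "cart a b"]) (intro dfn Dfn2[OF assms], auto)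

lemma graph_exists:
  assumes "Dfn (\<lambda>v. R (v 0) (v 1))"
  obtains f where "ext f = {opair x y | x y. x \<in> ext a \<and> y \<in> ext b \<and> R x y}"
  using ext_setof[OF coded_graph[OF assms]] by blast

lemma fun_exists:
  assumes "Dfn (\<lambda>v. R (v 0) (v 1))" "\<And>x. x \<in> ext a \<Longrightarrow> \<exists>!y. R x y"
    "\<And>x y. x \<in> ext a \<Longrightarrow> R x y \<Longrightarrow> y \<in> ext b"
  obtains f where "is_fun f a b" "\<And>x y. x \<in> ext a \<Longrightarrow> opair x y \<in> ext f \<longleftrightarrow> R x y"
proof -
  obtain f where f: "ext f = {opair x y | x y. x \<in> ext a \<and> y \<in> ext b \<and> R x y}"
    using graph_exists[OF assms(1)] by blast
  show ?thesis
  proof (rule that)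
    show "is_fun f a b"
      unfolding is_fun_iff
    proof (intro conjI ballI)
      fix x assume x: "x \<in> ext a"
      show "\<exists>!y. opair x y \<in> ext f"
        unfolding f using x assms(2)[OF x] assms(3)[OF x] by simp metis
    qed (auto simp: f)
    show "\<And>x y. x \<in> ext a \<Longrightarrow> opair x y \<in> ext f \<longleftrightarrow> R x y" unfolding f using assms(3) by auto
  qed
qed

text \<open>Rephrases the bijection by pairs in f, which makes equipotence definable.\<close>

lemma equipotent_iff: "equipotent a b \<longleftrightarrow>
    (\<exists>f. is_fun f a b \<and> (\<forall>y \<in> ext b. \<exists>!x. opair x y \<in> ext f))"
proof -
  have "bij_betw (val f) (ext a) (ext b) \<longleftrightarrow> (\<forall>y \<in> ext b. \<exists>!x. opair x y \<in> ext f)" (is "?L \<longleftrightarrow> ?R")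
    if f: "is_fun f a b" for f
  proof
    assume ?L
    then show ?R
      unfolding bij_betw_def inj_on_def image_def
      using fun_val[OF f] fun_in[OF f] by (auto simp: set_eq_iff) metis+
  next
    assume ?R
    then show ?L
      unfolding bij_betw_def inj_on_def image_def
      using fun_val[OF f] fun_in[OF f] val_in[OF f] by (auto simp: set_eq_iff) metis+
  qed
  then show ?thesis unfolding equipotent_def by blast
qed

lemma Dfn_equipotent[dfn]: "Tm a \<Longrightarrow> Tm b \<Longrightarrow> Dfn (\<lambda>v. equipotent (a v) (b v))"
  by (rule Dfn2[of equipotent]) (unfold equipotent_iff, intro dfn)

lemma equipotentI:
  assumes R: "Dfn (\<lambda>v. R (v 0) (v 1))"
    and "\<And>x. x \<in> ext a \<Longrightarrow> \<exists>y \<in> ext b. R x y"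
    and "\<And>y. y \<in> ext b \<Longrightarrow> \<exists>x \<in> ext a. R x y"
    and "\<And>x y y'. x \<in> ext a \<Longrightarrow> y \<in> ext b \<Longrightarrow> y' \<in> ext b \<Longrightarrow> R x y \<Longrightarrow> R x y' \<Longrightarrow> y = y'"
    and "\<And>x x' y. x \<in> ext a \<Longrightarrow> x' \<in> ext a \<Longrightarrow> y \<in> ext b \<Longrightarrow> R x y \<Longrightarrow> R x' y \<Longrightarrow> x = x'"
  shows "equipotent a b"
proof -
  obtain f where f: "ext f = {opair x y | x y. x \<in> ext a \<and> y \<in> ext b \<and> R x y}"
    using graph_exists[OF assms(1)] by blast
  have "is_fun f a b"
    unfolding is_fun_iff
  proof (intro conjI ballI)
    fix x assume x: "x \<in> ext a"
    show "\<exists>!y. opair x y \<in> ext f"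
      unfolding f using x assms(2)[OF x] assms(4)[OF x] by simp metis
  qed (auto simp: f)
  moreover have "\<forall>y \<in> ext b. \<exists>!x. opair x y \<in> ext f"
    unfolding f using assms(3,5) by simp metis
  ultimately show ?thesis unfolding equipotent_iff by blast
qed

lemma equipotent_sym: assumes "equipotent a b" shows "equipotent b a"
proof -
  obtain f where f: "is_fun f a b" "\<forall>y \<in> ext b. \<exists>!x. opair x y \<in> ext f"
    using assms unfolding equipotent_iff by blast
  have "Dfn (\<lambda>v. opair (v 1) (v 0) \<in> ext f)" by (intro dfn)
  then show ?thesis
  proof (rule equipotentI[where R = "\<lambda>y x. opair x y \<in> ext f"])
    show "\<exists>y \<in> ext a. opair y x \<in> ext f" if "x \<in> ext b" for x
      using that f(2) fun_in[OF f(1)] by metis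
    show "\<exists>x \<in> ext b. opair y x \<in> ext f" if "y \<in> ext a" for y
      using that fun_total[OF f(1)] fun_in[OF f(1)] by metis
    show "y = y'" if "x \<in> ext b" "opair y x \<in> ext f" "opair y' x \<in> ext f" for x y y'
      using that f(2) by metis
    show "x = x'" if "opair y x \<in> ext f" "opair y x' \<in> ext f" for x x' y
      using that fun_unique[OF f(1)] by metis
  qed
qed

lemma equipotent_trans: assumes "equipotent a b" "equipotent b c" shows "equipotent a c"
proof -
  obtain f where f: "is_fun f a b" "\<forall>y \<in> ext b. \<exists>!x. opair x y \<in> ext f"
    using assms unfolding equipotent_iff by blast
  obtain g where g: "is_fun g b c" "\<forall>y \<in> ext c. \<exists>!x. opair x y \<in> ext g"
    using assms unfolding equipotent_iff by blast
  have "Dfn (\<lambda>v. \<exists>z. opair (v 0) z \<in> ext f \<and> opair z (v 1) \<in> ext g)" by (intro dfn)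
  then show ?thesis
  proof (rule equipotentI[where R = "\<lambda>x y. \<exists>z. opair x z \<in> ext f \<and> opair z y \<in> ext g"])
    show "\<exists>y \<in> ext c. \<exists>z. opair x z \<in> ext f \<and> opair z y \<in> ext g" if "x \<in> ext a" for x
      using fun_total[OF f(1) that] fun_in[OF f(1)] fun_total[OF g(1)] fun_in[OF g(1)] by metis
    show "\<exists>x \<in> ext a. \<exists>z. opair x z \<in> ext f \<and> opair z y \<in> ext g" if "y \<in> ext c" for y
      using f(2) g(2) that fun_in[OF f(1)] fun_in[OF g(1)] by metis
    show "y = y'" if "\<exists>z. opair x z \<in> ext f \<and> opair z y \<in> ext g"
      "\<exists>z. opair x z \<in> ext f \<and> opair z y' \<in> ext g" for x y y'
      using that fun_unique[OF f(1)] fun_unique[OF g(1)] by metis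
    show "x = x'" if "\<exists>z. opair x z \<in> ext f \<and> opair z y \<in> ext g"
      "\<exists>z. opair x' z \<in> ext f \<and> opair z y \<in> ext g" for x x' y
      using that f(2) g(2) fun_in[OF f(1)] fun_in[OF g(1)] by metis
  qed
qed

section \<open>Enumerations along the ordinals\<close>

definition restr :: "'a \<Rightarrow> 'a \<Rightarrow> 'a" where
  "restr g \<gamma> = setof {p. p \<in> ext g \<and> (\<exists>\<xi> \<in> ext \<gamma>. \<exists>z. p = opair \<xi> z)}"

lemma coded_restr: "coded {p. p \<in> ext g \<and> (\<exists>\<xi> \<in> ext \<gamma>. \<exists>z. p = opair \<xi> z)}"
  by (rule coded_bounded[where a = g]) (intro dfn, blast)

lemma ext_restr: "ext (restr g \<gamma>) = {p. p \<in> ext g \<and> (\<exists>\<xi> \<in> ext \<gamma>. \<exists>z. p = opair \<xi> z)}"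
  unfolding restr_def by (rule ext_setof[OF coded_restr])

lemma opair_in_restr: "opair \<xi> z \<in> ext (restr g \<gamma>) \<longleftrightarrow> opair \<xi> z \<in> ext g \<and> \<xi> \<in> ext \<gamma>"
  unfolding ext_restr by auto

lemma Tm_restr[dfn]: "Tm s \<Longrightarrow> Tm t \<Longrightarrow> Tm (\<lambda>v. restr (s v) (t v))"
  by (rule Tm2[of restr]) (unfold restr_def, intro Tm_setof coded_restr dfn)

lemma restr_eqI:
  assumes "\<And>\<xi> z. \<xi> \<in> ext \<gamma> \<Longrightarrow> opair \<xi> z \<in> ext g \<longleftrightarrow> opair \<xi> z \<in> ext h"
  shows "restr g \<gamma> = restr h \<gamma>"
  by (rule set_eqI) (use assms in \<open>auto simp: ext_restr\<close>)

text \<open>The iteration of \<open>N\<close> cannot go on through all ordinals, since the replacement axiom, applied to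
  the inverse of an injective enumeration, makes its length a set.\<close>

lemma transfinite_enumeration:
  assumes N: "Dfn (\<lambda>v. N (v 0) (v 1))"
    and fn: "\<And>g z z'. N g z \<Longrightarrow> N g z' \<Longrightarrow> z = z'"
    and new: "\<And>g z. N g z \<Longrightarrow> z \<in> ext C \<and> (\<forall>\<xi>. opair \<xi> z \<notin> ext g)"
    and ex: "\<And>\<beta> g. ordinal \<beta> \<Longrightarrow> is_fun g \<beta> C \<Longrightarrow> \<exists>c \<in> ext C. \<forall>\<xi>. opair \<xi> c \<notin> ext g \<Longrightarrow> \<exists>z. N g z"
  shows "\<exists>\<mu>. ordinal \<mu> \<and> equipotent \<mu> C"
proof -
  define good where "good \<beta> g \<longleftrightarrow> ordinal \<beta> \<and> is_fun g \<beta> C \<and>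
    (\<forall>\<gamma> z. opair \<gamma> z \<in> ext g \<longrightarrow> N (restr g \<gamma>) z)" for \<beta> g
  have D_good: "Tm s \<Longrightarrow> Tm t \<Longrightarrow> Dfn (\<lambda>v. good (s v) (t v))" for s t
    by (rule Dfn2[of good]) (unfold good_def, intro dfn Dfn2[OF N])
  have agree: "z = z'"
    if g: "good \<beta> g" "opair \<gamma> z \<in> ext g" and g': "good \<beta>' g'" "opair \<gamma> z' \<in> ext g'" for \<beta> g \<beta>' g' \<gamma> z z'
  proof -
    have f: "is_fun g \<beta> C" "is_fun g' \<beta>' C" "ordinal \<beta>" "ordinal \<beta>'" using g g' unfolding good_def by auto
    have \<gamma>: "\<gamma> \<in> ext \<beta>" "\<gamma> \<in> ext \<beta>'" using fun_in f g g' by blast+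
    have "ordinal \<gamma>" using ord_elem \<gamma> f by blast
    have "Dfn (\<lambda>v. \<forall>z z'. opair (v 0) z \<in> ext g \<longrightarrow> opair (v 0) z' \<in> ext g' \<longrightarrow> z = z')"
      by (intro dfn)
    then have "\<forall>z z'. opair \<gamma> z \<in> ext g \<longrightarrow> opair \<gamma> z' \<in> ext g' \<longrightarrow> z = z'"
      using \<open>ordinal \<gamma>\<close>
    proof (induction rule: ord_induct)
      case (step \<gamma>)
      show ?case
      proof (intro allI impI)
        fix z z' assume z: "opair \<gamma> z \<in> ext g" "opair \<gamma> z' \<in> ext g'"
        have "restr g \<gamma> = restr g' \<gamma>"
        proof (rule restr_eqI)
          fix \<xi> y assume \<xi>: "\<xi> \<in> ext \<gamma>"
          have "\<xi> \<in> ext \<beta>" "\<xi> \<in> ext \<beta>'"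
            using fun_in[OF f(1) z(1)] fun_in[OF f(2) z(2)] ord_trans f \<xi> by blast+
          then show "opair \<xi> y \<in> ext g \<longleftrightarrow> opair \<xi> y \<in> ext g'"
            using step(2)[OF \<xi>] fun_total[OF f(1)] fun_total[OF f(2)] by blast
        qed
        moreover have "N (restr g \<gamma>) z" "N (restr g' \<gamma>) z'"
          using g(1) g'(1) z unfolding good_def by blast+
        ultimately show "z = z'" using fn by simp
      qed
    qed
    then show ?thesis using g g' by blast
  qed
  \<comment> \<open>A repetition at \<gamma> \<in> \<gamma>' would mean that N chose at \<gamma>' a
    value listed before.\<close>
  have inj: "\<gamma> = \<gamma>'" if g: "good \<beta> g" "opair \<gamma> z \<in> ext g" "opair \<gamma>' z \<in> ext g" for \<beta> g \<gamma> \<gamma>' z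
  proof -
    have "\<gamma> \<notin> ext \<gamma>'" if "opair \<gamma> z \<in> ext g" "opair \<gamma>' z \<in> ext g" for \<gamma> \<gamma>'
    proof
      assume "\<gamma> \<in> ext \<gamma>'"
      then have "opair \<gamma> z \<in> ext (restr g \<gamma>')" using that by (simp add: opair_in_restr)
      moreover have "N (restr g \<gamma>') z" using that g(1) unfolding good_def by blast
      ultimately show False using new by blast
    qed
    moreover have "ordinal \<gamma>" "ordinal \<gamma>'"
      using g fun_in ord_elem unfolding good_def by blast+
    ultimately show ?thesis using ord_linear g by blast
  qed
  define H where "H z \<gamma> \<longleftrightarrow> (\<exists>\<beta> g. good \<beta> g \<and> opair \<gamma> z \<in> ext g)" for z \<gamma>
  have D_H: "Dfn (\<lambda>v. H (v 0) (v 1))" unfolding H_def by (intro dfn D_good)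
  have H_ord: "ordinal \<gamma>" if "H z \<gamma>" for z \<gamma>
    using that fun_in ord_elem unfolding H_def good_def by blast
  have H_inj: "\<gamma> = \<gamma>'" if H: "H z \<gamma>" "H z \<gamma>'" for z \<gamma> \<gamma>'
  proof -
    have "\<gamma> \<notin> ext \<gamma>'" if H: "H z \<gamma>" "H z \<gamma>'" for \<gamma> \<gamma>'
    proof
      assume \<gamma>: "\<gamma> \<in> ext \<gamma>'"
      obtain \<beta> g \<beta>' g' where g: "good \<beta> g" "opair \<gamma> z \<in> ext g" "good \<beta>' g'" "opair \<gamma>' z \<in> ext g'"
        using H unfolding H_def by blast
      have g': "is_fun g' \<beta>' C" "ordinal \<beta>'" using g unfolding good_def by auto
      have "\<gamma> \<in> ext \<beta>'" using fun_in[OF g'(1) g(4)] ord_trans[OF g'(2)] \<gamma> by blast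
      then obtain y where "opair \<gamma> y \<in> ext g'" using fun_total[OF g'(1)] by blast
      then have "opair \<gamma> z \<in> ext g'" using agree g by blast
      then have "\<gamma> = \<gamma>'" using inj g by blast
      with \<gamma> show False by simp
    qed
    then show ?thesis using ord_linear H H_ord by metis
  qed
  define \<mu> where "\<mu> = setof {\<gamma>. \<exists>z \<in> ext C. H z \<gamma>}"
  have ext_\<mu>: "ext \<mu> = {\<gamma>. \<exists>z \<in> ext C. H z \<gamma>}"
    unfolding \<mu>_def by (intro ext_setof coded_image D_H) (use H_inj in blast)
  have ord_\<mu>: "ordinal \<mu>"
  proof -
    have "\<xi> \<in> ext \<mu>" if "\<gamma> \<in> ext \<mu>" "\<xi> \<in> ext \<gamma>" for \<gamma> \<xi>
    proof -
      obtain z \<beta> g where g: "z \<in> ext C" "good \<beta> g" "opair \<gamma> z \<in> ext g"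
        using \<open>\<gamma> \<in> ext \<mu>\<close> unfolding ext_\<mu> H_def by blast
      have g': "is_fun g \<beta> C" "ordinal \<beta>" using g unfolding good_def by auto
      have "\<xi> \<in> ext \<beta>" using fun_in[OF g'(1) g(3)] ord_trans[OF g'(2)] \<open>\<xi> \<in> ext \<gamma>\<close> by blast
      then obtain y where "opair \<xi> y \<in> ext g" using fun_total[OF g'(1)] by blast
      then show ?thesis unfolding ext_\<mu> H_def using g fun_in[OF g'(1)] by blast
    qed
    moreover have "ordinal \<gamma>" if "\<gamma> \<in> ext \<mu>" for \<gamma> using that H_ord unfolding ext_\<mu> by blast
    ultimately show ?thesis unfolding ordinal_def transitive_set_def by blast
  qed
  have "Dfn (\<lambda>v. H (v 1) (v 0))" unfolding H_def by (intro dfn D_good)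
  then obtain G where G: "is_fun G \<mu> C" "\<And>\<gamma> z. \<gamma> \<in> ext \<mu> \<Longrightarrow> opair \<gamma> z \<in> ext G \<longleftrightarrow> H z \<gamma>"
  proof (rule fun_exists)
    fix \<gamma> assume "\<gamma> \<in> ext \<mu>"
    then show "\<exists>!z. H z \<gamma>" unfolding ext_\<mu> H_def using agree by blast
  next
    fix \<gamma> z assume "H z \<gamma>"
    then show "z \<in> ext C" unfolding H_def good_def using fun_in by blast
  qed (rule that)
  have sub: "opair \<gamma> z \<in> ext G \<longleftrightarrow> opair \<gamma> z \<in> ext g" if gd: "good \<beta> g" "\<gamma> \<in> ext \<beta>" for \<beta> g \<gamma> z
  proof -
    have g: "is_fun g \<beta> C" using gd unfolding good_def by auto
    obtain y where y: "opair \<gamma> y \<in> ext g" using fun_total[OF g gd(2)] by blast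
    then have "\<gamma> \<in> ext \<mu>" unfolding ext_\<mu> H_def using gd fun_in[OF g] by blast
    then show ?thesis using y G(2)[of \<gamma> z] agree[OF _ _ gd(1) y] agree[OF gd(1) _ gd(1) y] gd(1) unfolding H_def by metis
  qed
  have good_G: "good \<mu> G"
    unfolding good_def
  proof (intro conjI allI impI ord_\<mu> G(1))
    fix \<gamma> z assume z: "opair \<gamma> z \<in> ext G"
    then obtain \<beta> g where g: "good \<beta> g" "opair \<gamma> z \<in> ext g"
      using G(2) fun_in[OF G(1)] unfolding H_def by blast
    have g': "is_fun g \<beta> C" "ordinal \<beta>" using g unfolding good_def by auto
    have "restr G \<gamma> = restr g \<gamma>"
      by (rule restr_eqI) (use sub[OF g(1)] fun_in[OF g'(1) g(2)] ord_trans[OF g'(2)] in blast)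
    then show "N (restr G \<gamma>) z" using g unfolding good_def by simp
  qed
  \<comment> \<open>If G missed a point of C, then N would extend G by a value at index \<mu>, and
    the extended run would put \<mu> into itself.\<close>
  have "\<exists>\<gamma>. opair \<gamma> c \<in> ext G" if c: "c \<in> ext C" for c
  proof (rule ccontr)
    assume "\<not> ?thesis"
    with c have "\<exists>c \<in> ext C. \<forall>\<xi>. opair \<xi> c \<notin> ext G" by blast
    from ex[OF ord_\<mu> G(1) this] obtain z where z: "N G z" ..
    define G' where "G' = setof (insert (opair \<mu> z) (ext G))"
    have ext_G': "ext G' = insert (opair \<mu> z) (ext G)" unfolding G'_def by (simp add: ext_setof)
    have "good (succ \<mu>) G'"
      unfolding good_def
    proof (intro conjI allI impI)
      show "ordinal (succ \<mu>)" by (simp add: ord_\<mu>)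
      show "is_fun G' (succ \<mu>) C"
        unfolding is_fun_iff
      proof (intro conjI ballI)
        fix p assume "p \<in> ext G'"
        then show "\<exists>x \<in> ext (succ \<mu>). \<exists>y \<in> ext C. p = opair x y"
          using new[OF z] G(1) unfolding ext_G' is_fun_iff by auto
      next
        fix x assume "x \<in> ext (succ \<mu>)"
        then consider "x = \<mu>" | "x \<in> ext \<mu>" by auto
        then show "\<exists>!y. opair x y \<in> ext G'"
        proof cases
          case 1
          then show ?thesis unfolding ext_G' using fun_in[OF G(1), of \<mu>] by auto
        next
          case 2
          then have "x \<noteq> \<mu>" by auto
          with 2 show ?thesis unfolding ext_G' using G(1) unfolding is_fun_iff by auto
        qed
      qed
      fix \<gamma> y assume y: "opair \<gamma> y \<in> ext G'"
      show "N (restr G' \<gamma>) y"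
      proof (cases "\<gamma> = \<mu>")
        case True
        have "restr G' \<mu> = G"
        proof (rule set_eqI)
          fix p show "p \<in> ext (restr G' \<mu>) \<longleftrightarrow> p \<in> ext G"
            using G(1) mem_irrefl unfolding ext_restr ext_G' is_fun_iff by auto
        qed
        moreover have "y = z" using y True fun_in[OF G(1), of \<mu> y] unfolding ext_G' by auto
        ultimately show ?thesis using z True by simp
      next
        case False
        then have "opair \<gamma> y \<in> ext G" using y unfolding ext_G' by simp
        moreover have "restr G' \<gamma> = restr G \<gamma>"
          by (rule restr_eqI) (use fun_in[OF G(1) \<open>opair \<gamma> y \<in> ext G\<close>] mem_asym[of \<mu> \<gamma>]
              in \<open>auto simp: ext_G'\<close>)
        ultimately show ?thesis using good_G unfolding good_def by simp
      qed
    qed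
    then have "H z \<mu>" unfolding H_def ext_G' by (metis ext_G' insertI1)
    then have "\<mu> \<in> ext \<mu>" using new[OF z] unfolding ext_\<mu> by blast
    then show False by simp
  qed
  then have "equipotent \<mu> C"
    unfolding equipotent_iff using G(1) inj[OF good_G] by blast
  with ord_\<mu> show ?thesis by blast
qed

end

section \<open>Well-ordering the constructible universe\<close>

context ZFL_model
begin

text \<open>An enumeration of the closure of an ordinal under a ternary operation always proceeds to the
  value at the least triple of earlier indices that yields something new.\<close>

lemma closure_well_orderable:
  assumes \<delta>: "ordinal \<delta>" "ext \<delta> \<subseteq> ext U"
    and G: "Dfn (\<lambda>v. G (v 0) (v 1) (v 2) (v 3))"
    and fn: "\<And>w x y z z'. G w x y z \<Longrightarrow> G w x y z' \<Longrightarrow> z = z'"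
  shows "\<exists>C \<mu>. ordinal \<mu> \<and> equipotent \<mu> C \<and> ext \<delta> \<subseteq> ext C \<and>
    (\<forall>w \<in> ext C. \<forall>x \<in> ext C. \<forall>y \<in> ext C. \<forall>z \<in> ext U. G w x y z \<longrightarrow> z \<in> ext C)"
proof -
  define \<Phi> where "\<Phi> Y z \<longleftrightarrow> z \<in> ext \<delta> \<or> (\<exists>w \<in> ext Y. \<exists>x \<in> ext Y. \<exists>y \<in> ext Y. G w x y z)" for Y z
  have D\<Phi>: "Dfn (\<lambda>v. \<Phi> (v 0) (v 1))" unfolding \<Phi>_def by (intro dfn Dfn4[OF G])
  have mono: "\<forall>Y Y' x. ext Y \<subseteq> ext Y' \<longrightarrow> \<Phi> Y x \<longrightarrow> \<Phi> Y' x" unfolding \<Phi>_def by blast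
  define C where "C = lfix U \<Phi>"
  note C = lfix_unfold[where \<Phi> = \<Phi> and U = U, OF D\<Phi> mono, folded C_def]
    lfix_induct[where \<Phi> = \<Phi> and U = U, OF D\<Phi> mono, folded C_def]
  have \<delta>C: "ext \<delta> \<subseteq> ext C" using C(1) \<delta>(2) unfolding \<Phi>_def by blast
  have closed: "z \<in> ext C" if "w \<in> ext C" "x \<in> ext C" "y \<in> ext C" "G w x y z" "z \<in> ext U" for w x y z
    using C(1) that unfolding \<Phi>_def by blast
  define ran where "ran g z \<longleftrightarrow> (\<exists>\<xi>. opair \<xi> z \<in> ext g)" for g z
  have D_ran[dfn]: "Tm s \<Longrightarrow> Tm t \<Longrightarrow> Dfn (\<lambda>v. ran (s v) (t v))" for s t
    by (rule Dfn2[of ran]) (unfold ran_def, intro dfn)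
  define K where "K g a b c z \<longleftrightarrow> z \<in> ext U \<and> \<not> ran g z \<and> (\<exists>w \<in> ext C. \<exists>x \<in> ext C. \<exists>y \<in> ext C.
    opair a w \<in> ext g \<and> opair b x \<in> ext g \<and> opair c y \<in> ext g \<and> G w x y z)" for g a b c z
  define le where "le a b c a' b' c' \<longleftrightarrow>
    a \<in> ext a' \<or> a = a' \<and> (b \<in> ext b' \<or> b = b' \<and> (c \<in> ext c' \<or> c = c'))" for a b c a' b' c'
  \<comment> \<open>The enumeration has two phases: as long as \<delta> is not exhausted, its least
    missing element is listed; afterwards the least triple of indices decides.\<close>
  define N1 where "N1 g z \<longleftrightarrow> z \<in> ext \<delta> \<and> \<not> ran g z \<and> (\<forall>y \<in> ext z. ran g y)" for g z
  define N2 where "N2 g z \<longleftrightarrow> (\<forall>y \<in> ext \<delta>. ran g y) \<and> (\<exists>a b c. K g a b c z \<and>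
    (\<forall>a' b' c' z'. K g a' b' c' z' \<longrightarrow> le a b c a' b' c'))" for g z
  \<comment> \<open>\<open>transfinite_enumeration\<close> wants N single-valued at every individual
    g, not only at functions; without the clause on g the indices a, b, c would not determine the
    entries w, x, y.\<close>
  define N where "N g z \<longleftrightarrow> (\<forall>\<xi> y y'. opair \<xi> y \<in> ext g \<longrightarrow> opair \<xi> y' \<in> ext g \<longrightarrow> y = y') \<and>
    (N1 g z \<or> N2 g z)" for g z
  have DN: "Dfn (\<lambda>v. N (v 0) (v 1))"
    unfolding N_def N1_def N2_def K_def le_def by (intro dfn Dfn4[OF G])
  have le_antisym: "a = a' \<and> b = b' \<and> c = c'" if "le a b c a' b' c'" "le a' b' c' a b c" for a b c a' b' c'
    using that mem_asym mem_irrefl unfolding le_def by blast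
  have N_fn: "z = z'" if N: "N g z" "N g z'" for g z z'
  proof -
    consider "N1 g z" "N1 g z'" | "N2 g z" "N2 g z'" | "N1 g z" "N2 g z'" | "N2 g z" "N1 g z'"
      using N unfolding N_def by blast
    then show ?thesis
    proof cases
      case 1
      then have "z \<in> ext z' \<or> z = z' \<or> z' \<in> ext z"
        using ord_linear ord_elem[OF \<delta>(1)] unfolding N1_def by blast
      with 1 show ?thesis unfolding N1_def by blast
    next
      case 2
      then obtain a b c a' b' c' where K: "K g a b c z" "K g a' b' c' z'"
        "le a b c a' b' c'" "le a' b' c' a b c"
        unfolding N2_def by blast
      with le_antisym have "K g a b c z'" by blast
      then show ?thesis using K(1) N fn unfolding K_def N_def by metis
    qed (auto simp: N1_def N2_def)
  qed
  have N_new: "z \<in> ext C \<and> (\<forall>\<xi>. opair \<xi> z \<notin> ext g)" if N: "N g z" for g z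
  proof -
    have "N1 g z \<or> (\<exists>a b c. K g a b c z)" using N unfolding N_def N2_def by blast
    then have "z \<in> ext C \<and> \<not> ran g z"
    proof
      assume "N1 g z"
      then show ?thesis using \<delta>C unfolding N1_def by blast
    next
      assume "\<exists>a b c. K g a b c z"
      then show ?thesis using closed unfolding K_def by meson
    qed
    then show ?thesis unfolding ran_def by blast
  qed
  have N_ex: "\<exists>z. N g z"
    if \<beta>: "ordinal \<beta>" and g: "is_fun g \<beta> C" and c: "\<exists>c \<in> ext C. \<forall>\<xi>. opair \<xi> c \<notin> ext g" for \<beta> g
  proof (cases "\<forall>y \<in> ext \<delta>. ran g y")
    case False
    then obtain y where y: "y \<in> ext \<delta>" "\<not> ran g y" by blast
    have "Dfn (\<lambda>v. v 0 \<in> ext \<delta> \<and> \<not> ran g (v 0))" by (intro dfn)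
    then obtain z where "z \<in> ext \<delta> \<and> \<not> ran g z" "\<And>x. x \<in> ext z \<Longrightarrow> \<not> (x \<in> ext \<delta> \<and> \<not> ran g x)"
      by (rule ord_least[of _ y]) (use y ord_elem[OF \<delta>(1)] in auto)
    then have "N1 g z" using ord_trans[OF \<delta>(1)] unfolding N1_def by blast
    then show ?thesis using fun_unique[OF g] unfolding N_def by blast
  next
    case True
    have ord: "ordinal a" if "opair a w \<in> ext g" for a w
      using fun_in[OF g that] ord_elem[OF \<beta>] by blast
    \<comment> \<open>If no triple yields anything new, the range of g contains \<delta> and is
      closed under G within U, so by induction it is all of C, against the assumption on g.\<close>
    have "\<exists>a b c z. K g a b c z"
    proof (rule ccontr)
      assume noK: "\<not> ?thesis"
      have "ran g x" if x: "x \<in> ext C" for x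
      proof (rule C(2)[where Q = "ran g" and x = x, OF _ _ x])
        show "Dfn (\<lambda>v. ran g (v 0))" by (intro dfn)
        fix Y z assume Y: "z \<in> ext U" "ext Y \<subseteq> ext C" "\<And>y. y \<in> ext Y \<Longrightarrow> ran g y" "\<Phi> Y z"
        show "ran g z"
        proof (cases "z \<in> ext \<delta>")
          case False
          then obtain w x y where wxy: "w \<in> ext Y" "x \<in> ext Y" "y \<in> ext Y" "G w x y z"
            using Y(4) unfolding \<Phi>_def by blast
          with Y(3) obtain a b c where abc: "opair a w \<in> ext g" "opair b x \<in> ext g" "opair c y \<in> ext g"
            unfolding ran_def by metis
          from wxy Y(2) have C3: "w \<in> ext C" "x \<in> ext C" "y \<in> ext C" by auto
          show ?thesis
          proof (rule ccontr)
            assume "\<not> ran g z"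
            with C3 abc wxy(4) Y(1) have "K g a b c z" unfolding K_def by blast
            with noK show False by blast
          qed
        qed (use True in blast)
      qed
      with c show False unfolding ran_def by blast
    qed
    then obtain a0 b0 c0 z0 where K0: "K g a0 b0 c0 z0" by blast
    have K_ord: "ordinal a \<and> ordinal b \<and> ordinal c" if "K g a b c z" for a b c z
      using that ord unfolding K_def by blast
    have D: "Dfn (\<lambda>v. \<exists>b c z. K g (v 0) b c z)" "Dfn (\<lambda>v. \<exists>c z. K g a (v 0) c z)"
      "Dfn (\<lambda>v. \<exists>z. K g a b (v 0) z)" for a b
      unfolding K_def by (intro dfn Dfn4[OF G])+
    \<comment> \<open>Three successive minimizations produce the lexicographically least
      triple.\<close>
    obtain a where a: "\<exists>b c z. K g a b c z" "\<And>a'. a' \<in> ext a \<Longrightarrow> \<not> (\<exists>b c z. K g a' b c z)"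
      by (rule ord_least[OF D(1), of a0]) (use K0 K_ord in blast)+
    then obtain b1 c1 z1 where K1: "K g a b1 c1 z1" by blast
    obtain b where b: "\<exists>c z. K g a b c z" "\<And>b'. b' \<in> ext b \<Longrightarrow> \<not> (\<exists>c z. K g a b' c z)"
      by (rule ord_least[OF D(2), of b1]) (use K1 K_ord in blast)+
    then obtain c2 z2 where K2: "K g a b c2 z2" by blast
    obtain c where c: "\<exists>z. K g a b c z" "\<And>c'. c' \<in> ext c \<Longrightarrow> \<not> (\<exists>z. K g a b c' z)"
      by (rule ord_least[OF D(3), of c2]) (use K2 K_ord in blast)+
    then obtain z where K3: "K g a b c z" by blast
    have "le a b c a' b' c'" if K': "K g a' b' c' z'" for a' b' c' z'
    proof -
      have "a \<in> ext a' \<or> a = a'" using ord_linear K_ord[OF K'] K_ord[OF K3] a(2) K' by blast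
      moreover have "b \<in> ext b' \<or> b = b'" if "a = a'"
        using ord_linear K_ord[OF K'] K_ord[OF K3] b(2) K' that by blast
      moreover have "c \<in> ext c' \<or> c = c'" if "a = a'" "b = b'"
        using ord_linear K_ord[OF K'] K_ord[OF K3] c(2) K' that by blast
      ultimately show ?thesis unfolding le_def by blast
    qed
    then have "N2 g z" using K3 True unfolding N2_def by blast
    then show ?thesis using fun_unique[OF g] unfolding N_def by blast
  qed
  have "\<exists>\<mu>. ordinal \<mu> \<and> equipotent \<mu> C"
    by (rule transfinite_enumeration[where N = N and C = C]) (fact DN N_fn N_new N_ex)+
  then show ?thesis using \<delta>C closed by blast
qed

text \<open>The enumeration h of C is thinned out: the next entry is the unlisted element of Z whose
  index under h is least.\<close>

lemma subset_well_orderable: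
  assumes "ordinal \<mu>" "equipotent \<mu> C" "ext Z \<subseteq> ext C"
  shows "\<exists>\<nu>. ordinal \<nu> \<and> equipotent \<nu> Z"
proof -
  obtain h where h: "is_fun h \<mu> C" "\<forall>y \<in> ext C. \<exists>!x. opair x y \<in> ext h"
    using assms(2) unfolding equipotent_iff by blast
  define P where "P g z \<longleftrightarrow> z \<in> ext Z \<and> (\<forall>\<xi>. opair \<xi> z \<notin> ext g)" for g z
  have D_P[dfn]: "Tm s \<Longrightarrow> Tm t \<Longrightarrow> Dfn (\<lambda>v. P (s v) (t v))" for s t
    by (rule Dfn2[of P]) (unfold P_def, intro dfn)
  define N where "N g z \<longleftrightarrow> (\<exists>\<xi>. opair \<xi> z \<in> ext h \<and> P g z \<and>
    (\<forall>\<xi>' \<in> ext \<xi>. \<forall>z'. opair \<xi>' z' \<in> ext h \<longrightarrow> \<not> P g z'))" for g z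
  have ord: "ordinal \<xi>" if "opair \<xi> z \<in> ext h" for \<xi> z
    using fun_in[OF h(1) that] ord_elem[OF assms(1)] by blast
  have D: "Dfn (\<lambda>v. N (v 0) (v 1))" unfolding N_def by (intro dfn)
  have fn: "z = z'" if N: "N g z" "N g z'" for g z z'
  proof -
    obtain \<xi> \<xi>' where x: "opair \<xi> z \<in> ext h" "opair \<xi>' z' \<in> ext h" "P g z" "P g z'"
      "\<forall>\<eta> \<in> ext \<xi>. \<forall>z'. opair \<eta> z' \<in> ext h \<longrightarrow> \<not> P g z'"
      "\<forall>\<eta> \<in> ext \<xi>'. \<forall>z'. opair \<eta> z' \<in> ext h \<longrightarrow> \<not> P g z'"
      using N unfolding N_def by blast
    then have "\<xi> = \<xi>'" using ord_linear[OF ord[OF x(1)] ord[OF x(2)]] by blast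
    then show ?thesis using fun_unique[OF h(1)] x by blast
  qed
  have new: "z \<in> ext Z \<and> (\<forall>\<xi>. opair \<xi> z \<notin> ext g)" if "N g z" for g z
    using that unfolding N_def P_def by blast
  have ex: "\<exists>z. N g z"
    if "ordinal \<beta>" "is_fun g \<beta> Z" "\<exists>c \<in> ext Z. \<forall>\<xi>. opair \<xi> c \<notin> ext g" for \<beta> g
  proof -
    obtain c where c: "P g c" using \<open>\<exists>c \<in> ext Z. \<forall>\<xi>. opair \<xi> c \<notin> ext g\<close> unfolding P_def by blast
    then obtain \<xi>0 where x0: "opair \<xi>0 c \<in> ext h" using h(2) assms(3) unfolding P_def by blast
    have "Dfn (\<lambda>v. \<exists>z. opair (v 0) z \<in> ext h \<and> P g z)" by (intro dfn)
    then obtain \<xi> where x: "\<exists>z. opair \<xi> z \<in> ext h \<and> P g z"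
      "\<And>\<eta>. \<eta> \<in> ext \<xi> \<Longrightarrow> \<not> (\<exists>z. opair \<eta> z \<in> ext h \<and> P g z)"
      by (rule ord_least[of _ \<xi>0]) (use x0 c ord in blast)+
    then show ?thesis unfolding N_def by blast
  qed
  show ?thesis
    by (rule transfinite_enumeration[where N = N and C = Z]) (fact D fn new ex)+
qed

subsection \<open>Tuples\<close>

lemma ext_snoc: "ext (snoc s n x) = insert (opair n x) (ext s)"
  unfolding snoc_def by (simp add: ext_setof)

lemma Tm_snoc[dfn]: assumes "Tm s" "Tm n" "Tm x" shows "Tm (\<lambda>v. snoc (s v) (n v) (x v))"
proof (rule TmI)
  have e: "z = snoc s n x \<longleftrightarrow> (\<forall>p. p \<in> ext z \<longleftrightarrow> p = opair n x \<or> p \<in> ext s)" for z s n x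
    by (auto simp: ext_snoc set_eq_iff simp flip: ext_inject)
  have "Dfn (\<lambda>v. v 0 = snoc (v 1) (v 2) (v 3))" unfolding e by (intro dfn)
  then show "Dfn (\<lambda>v. v 0 = snoc (s (\<lambda>i. v (Suc i))) (n (\<lambda>i. v (Suc i))) (x (\<lambda>i. v (Suc i))))"
    by (rule Dfn4) (intro dfn assms[THEN Tm_shift])+
qed

lemma is_fun_emp_iff: "is_fun s emp A \<longleftrightarrow> s = emp"
proof
  assume "is_fun s emp A"
  then have "x \<notin> ext s" for x unfolding is_fun_iff by auto
  then show "s = emp" by (intro set_eqI) auto
qed (auto simp: is_fun_iff)

lemma is_fun_snoc:
  assumes "is_fun s n A" "x \<in> ext A" shows "is_fun (snoc s n x) (succ n) A"
  unfolding is_fun_iff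
proof (intro conjI ballI)
  fix p assume "p \<in> ext (snoc s n x)"
  then show "\<exists>x \<in> ext (succ n). \<exists>y \<in> ext A. p = opair x y"
    using assms unfolding ext_snoc is_fun_iff by auto
next
  fix i assume "i \<in> ext (succ n)"
  then consider "i = n" | "i \<in> ext n" "i \<noteq> n" by force
  then show "\<exists>!y. opair i y \<in> ext (snoc s n x)"
  proof cases
    case 1
    then show ?thesis unfolding ext_snoc using fun_in[OF assms(1), of n] by auto
  next
    case 2
    then show ?thesis unfolding ext_snoc using assms(1) unfolding is_fun_iff by auto
  qed
qed

lemma is_fun_succ_cases:
  assumes "is_fun t (succ n) A"
  obtains s x where "is_fun s n A" "x \<in> ext A" "t = snoc s n x"
proof -
  obtain x where x: "opair n x \<in> ext t" using fun_total[OF assms, of n] by auto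
  have xA: "x \<in> ext A" using fun_in[OF assms x] by blast
  have "is_fun (restr t n) n A"
    unfolding is_fun_iff
  proof (intro conjI ballI)
    fix p assume "p \<in> ext (restr t n)"
    then show "\<exists>x \<in> ext n. \<exists>y \<in> ext A. p = opair x y"
      unfolding ext_restr using fun_in[OF assms] by blast
  next
    fix i assume "i \<in> ext n"
    then show "\<exists>!y. opair i y \<in> ext (restr t n)"
      using assms unfolding opair_in_restr is_fun_iff by auto
  qed
  moreover have "t = snoc (restr t n) n x"
  proof (rule set_eqI)
    fix p show "p \<in> ext t \<longleftrightarrow> p \<in> ext (snoc (restr t n) n x)"
    proof
      assume p: "p \<in> ext t"
      then obtain i y where "p = opair i y" "i \<in> ext (succ n)" using assms unfolding is_fun_iff by blast
      then show "p \<in> ext (snoc (restr t n) n x)"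
        using p fun_unique[OF assms x] by (auto simp: ext_snoc opair_in_restr)
    qed (use x in \<open>auto simp: ext_snoc ext_restr\<close>)
  qed
  ultimately show ?thesis using that xA by blast
qed

lemma val_snoc:
  assumes "is_fun s n A" "x \<in> ext A"
  shows "val (snoc s n x) n = x" "i \<in> ext n \<Longrightarrow> val (snoc s n x) i = val s i"
proof -
  note f = is_fun_snoc[OF assms]
  show "val (snoc s n x) n = x"
    using fun_val[OF f, of n x] by (simp add: ext_snoc)
  show "val (snoc s n x) i = val s i" if "i \<in> ext n"
    using fun_val[OF f, of i "val s i"] fun_val[OF assms(1) that, of "val s i"] that by (simp add: ext_snoc)
qed

lemma coded_tuples:
  assumes "Dfn (\<lambda>v. P (v 0))" shows "coded {s \<in> tuples A n. P s}"
  unfolding tuples_def mem_Collect_eq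
proof (rule coded_bounded[where a = "pow (cart n A)"])
  show "Dfn (\<lambda>v. is_fun (v 0) n A \<and> P (v 0))" by (intro dfn assms)
  show "s \<in> ext (pow (cart n A))" if "is_fun s n A \<and> P s" for s
    using that unfolding is_fun_def by (auto simp: ext_cart)
qed

text \<open>Trades the definite description in \<open>val\<close> for pairs, which turns atomic
  conditions on tuples into definable ones.\<close>

lemma val_rel_iff:
  assumes "is_fun s n A" "i \<in> ext n" "j \<in> ext n"
  shows "R (val s i) (val s j) \<longleftrightarrow> (\<exists>a b. opair i a \<in> ext s \<and> opair j b \<in> ext s \<and> R a b)"
  using fun_val[OF assms(1)] assms by auto

lemma coded_val_rel:
  assumes R: "Dfn (\<lambda>v. R (v 0) (v 1))" and "i \<in> ext n" "j \<in> ext n"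
  shows "coded {s \<in> tuples A n. R (val s i) (val s j)}"
proof -
  have "{s \<in> tuples A n. R (val s i) (val s j)} =
      {s \<in> tuples A n. \<exists>a b. opair i a \<in> ext s \<and> opair j b \<in> ext s \<and> R a b}"
    using val_rel_iff[OF _ assms(2,3), where R = R] unfolding tuples_def by auto
  also have "coded \<dots>" by (rule coded_tuples) (intro dfn Dfn2[OF R])
  finally show ?thesis .
qed

lemma definable_subset_sub: "X \<in> definable_subsets A \<Longrightarrow> ext X \<subseteq> ext A"
  unfolding definable_subsets_def by auto

text \<open>x consists of the y in A with y \<in> x, so it is definable with itself as the only
  parameter; transitivity of A ensures that no element of x is lost.\<close>

lemma elem_definable:
  assumes A: "transitive_set A" and x: "x \<in> ext A" shows "x \<in> definable_subsets A"
proof -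
  \<comment> \<open>The parameter sits at coordinate 0 and the candidate element at coordinate 1, so
    the arity is 2.\<close>
  let ?one = "succ emp" and ?s = "snoc emp emp x"
  let ?R = "setof {s \<in> tuples A (succ ?one). mem (val s ?one) (val s emp)}"
  have R: "ext ?R = {s \<in> tuples A (succ ?one). mem (val s ?one) (val s emp)}"
    by (intro ext_setof coded_val_rel dfn) auto
  have "definable_rel A (succ ?one) ?R"
    unfolding definable_rel_def
  proof (intro allI impI)
    fix D assume "definability_closed A D"
    then show "opair (succ ?one) ?R \<in> ext D"
      unfolding definability_closed_def using omega_succ[OF omega_succ[OF omega_emp]] by auto
  qed
  moreover have s: "is_fun ?s ?one A"
    using is_fun_snoc[of emp emp A x] x by (simp add: is_fun_emp_iff)
  moreover have "ext x = {y \<in> ext A. snoc ?s ?one y \<in> ext ?R}"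
  proof -
    have "snoc ?s ?one y \<in> ext ?R \<longleftrightarrow> y \<in> ext x" if y: "y \<in> ext A" for y
    proof -
      have "val (snoc ?s ?one y) ?one = y" "val (snoc ?s ?one y) emp = val ?s emp"
        using val_snoc[OF s y] by auto
      moreover have "val ?s emp = x"
        using val_snoc(1)[of emp emp A x] x by (simp add: is_fun_emp_iff)
      ultimately show ?thesis
        using is_fun_snoc[OF s y] unfolding R unfolding tuples_def by (simp add: ext_def[of x])
    qed
    then show ?thesis using A x unfolding transitive_set_def by blast
  qed
  ultimately show ?thesis
    unfolding definable_subsets_def tuples_def using omega_succ[OF omega_emp] by blast
qed

text \<open>Standard integers, serving as the tags by which \<open>build\<close> packs several
  operations into a single one.\<close>

primrec num :: "nat \<Rightarrow> 'a" where
  "num 0 = emp"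
| "num (Suc k) = succ (num k)"

lemma num_omega[simp]: "num k \<in> ext omega"
  by (induction k) auto

lemma num_inject[simp]: "num i = num k \<longleftrightarrow> i = k"
proof (induction i arbitrary: k)
  case 0 show ?case by (cases k) auto
next
  case (Suc i) show ?case using Suc by (cases k) auto
qed

lemma transitive_pow: "transitive_set X \<Longrightarrow> transitive_set (pow X) \<and> ext X \<subseteq> ext (pow X)"
  unfolding transitive_set_def by auto

section \<open>Levels of the constructible hierarchy\<close>

context
  fixes \<alpha> f :: 'a
  assumes ord_\<alpha>: "ordinal \<alpha>" and hier: "constructible_hierarchy \<alpha> f"
begin

lemma hier_fun: "opair \<beta> A \<in> ext f \<longleftrightarrow> \<beta> \<in> ext (succ \<alpha>) \<and> A = val f \<beta>"
proof -
  obtain b where "is_fun f (succ \<alpha>) b" using hier unfolding constructible_hierarchy_def by blast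
  then show ?thesis using fun_val fun_in by blast
qed

lemma ext_level: "\<beta> \<in> ext (succ \<alpha>) \<Longrightarrow> ext (val f \<beta>) = (\<Union>\<gamma> \<in> ext \<beta>. definable_subsets (val f \<gamma>))"
  using hier unfolding constructible_hierarchy_def by blast

lemma level_trans: "\<gamma> \<in> ext \<beta> \<Longrightarrow> \<beta> \<in> ext (succ \<alpha>) \<Longrightarrow> \<gamma> \<in> ext (succ \<alpha>)"
  using ord_trans[OF ord_succ[OF ord_\<alpha>]] by blast

text \<open>An element of a level is a subset of an earlier level, whose elements are definable over
  it by the induction hypothesis. The induction speaks of pairs in f because these are
  definable.\<close>

lemma level_transitive:
  assumes "\<beta> \<in> ext (succ \<alpha>)" shows "transitive_set (val f \<beta>)"
proof -
  have "Dfn (\<lambda>v. \<forall>A. opair (v 0) A \<in> ext f \<longrightarrow> transitive_set A)" by (intro dfn)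
  moreover have "ordinal \<beta>" using ord_elem[OF ord_succ[OF ord_\<alpha>] assms] .
  ultimately have "\<forall>A. opair \<beta> A \<in> ext f \<longrightarrow> transitive_set A"
  proof (induction rule: ord_induct)
    case (step \<beta>)
    show ?case
      unfolding hier_fun
    proof (intro allI impI, elim conjE)
      fix A assume \<beta>: "\<beta> \<in> ext (succ \<alpha>)" and A: "A = val f \<beta>"
      have "z \<in> ext A" if yz: "y \<in> ext A" "z \<in> ext y" for y z
      proof -
        obtain \<gamma> where \<gamma>: "\<gamma> \<in> ext \<beta>" "y \<in> definable_subsets (val f \<gamma>)"
          using yz(1) A ext_level[OF \<beta>] by blast
        then have "z \<in> ext (val f \<gamma>)" using definable_subset_sub yz(2) by blast
        moreover have "transitive_set (val f \<gamma>)"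
          using step(2)[OF \<gamma>(1)] level_trans[OF \<gamma>(1) \<beta>] hier_fun by blast
        ultimately have "z \<in> definable_subsets (val f \<gamma>)" using elem_definable by blast
        then show ?thesis using A ext_level[OF \<beta>] \<gamma>(1) by blast
      qed
      then show "transitive_set A" unfolding transitive_set_def by blast
    qed
  qed
  then show ?thesis using hier_fun assms by blast
qed

lemma level_mono: "\<gamma> \<in> ext \<beta> \<Longrightarrow> \<beta> \<in> ext (succ \<alpha>) \<Longrightarrow> ext (val f \<gamma>) \<subseteq> ext (val f \<beta>)"
  using ext_level elem_definable[OF level_transitive[OF level_trans]] by blast

lemma level_le: "\<gamma> \<in> ext (succ \<alpha>) \<Longrightarrow> ext (val f \<gamma>) \<subseteq> ext (val f \<alpha>)"
  using level_mono[of \<gamma> \<alpha>] by auto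

text \<open>The object \<open>(\<gamma>, (n, R))\<close> stands for an \<open>n\<close>-ary relation on \<open>L\<^sub>\<gamma>\<close>, the object \<open>(n, s)\<close> for an
  \<open>n\<close>-tuple.\<close>

definition build :: "'a \<Rightarrow> 'a \<Rightarrow> 'a \<Rightarrow> 'a \<Rightarrow> bool" where
  "build w x y z \<longleftrightarrow>
    (w = num 0 \<and> z = opair x y) \<or>
    (w = num 1 \<and> (\<exists>\<gamma> A n i j R. opair \<gamma> A \<in> ext f \<and> x = opair \<gamma> n \<and> y = opair i j \<and> z = opair \<gamma> (opair n R) \<and>
      (\<forall>s. s \<in> ext R \<longleftrightarrow> is_fun s n A \<and> (\<exists>a b. opair i a \<in> ext s \<and> opair j b \<in> ext s \<and> mem a b)))) \<or>
    (w = num 2 \<and> (\<exists>\<gamma> A n i j R. opair \<gamma> A \<in> ext f \<and> x = opair \<gamma> n \<and> y = opair i j \<and> z = opair \<gamma> (opair n R) \<and>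
      (\<forall>s. s \<in> ext R \<longleftrightarrow> is_fun s n A \<and> (\<exists>a b. opair i a \<in> ext s \<and> opair j b \<in> ext s \<and> a = b)))) \<or>
    (w = num 3 \<and> (\<exists>\<gamma> A n R S Q. opair \<gamma> A \<in> ext f \<and> x = opair \<gamma> (opair n R) \<and> y = opair \<gamma> (opair n S) \<and>
      z = opair \<gamma> (opair n Q) \<and> (\<forall>s. s \<in> ext Q \<longleftrightarrow> is_fun s n A \<and> \<not> (s \<in> ext R \<and> s \<in> ext S)))) \<or>
    (w = num 4 \<and> (\<exists>\<gamma> A n R Q. opair \<gamma> A \<in> ext f \<and> x = opair \<gamma> (opair (succ n) R) \<and>
      z = opair \<gamma> (opair n Q) \<and> (\<forall>s. s \<in> ext Q \<longleftrightarrow> is_fun s n A \<and> (\<exists>a \<in> ext A. snoc s n a \<in> ext R)))) \<or>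
    (w = num 5 \<and> (\<exists>n s. x = opair n s \<and> z = opair (succ n) (snoc s n y))) \<or>
    (w = num 6 \<and> (\<exists>\<gamma> A n R s. opair \<gamma> A \<in> ext f \<and> x = opair \<gamma> (opair (succ n) R) \<and> y = opair n s \<and>
      (\<forall>a. a \<in> ext z \<longleftrightarrow> a \<in> ext A \<and> snoc s n a \<in> ext R)))"

lemma Dfn_build: "Dfn (\<lambda>v. build (v 0) (v 1) (v 2) (v 3))"
  unfolding build_def by (intro dfn)

text \<open>The tag singles out one clause. Where a set is formed, the arguments determine the level
  and the arity, hence the elements of the set.\<close>

lemma build_functional:
  assumes "build w x y z" "build w x y z'" shows "z = z'"
proof -
  from assms(1) obtain k where w: "w = num k" and "k \<in> {0, 1, 2, 3, 4, 5, 6}"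
    unfolding build_def by blast
  then consider "k = 0" | "k = 1" | "k = 2" | "k = 3" | "k = 4" | "k = 5" | "k = 6" by blast
  then show ?thesis
  proof cases
    case 1 show ?thesis using assms unfolding build_def w num_inject 1 by simp
  next
    case 2 show ?thesis using assms unfolding build_def w num_inject 2
      by (clarsimp simp: hier_fun) (rule set_eqI, simp)
  next
    case 3 show ?thesis using assms unfolding build_def w num_inject 3
      by (clarsimp simp: hier_fun) (rule set_eqI, simp)
  next
    case 4 show ?thesis using assms unfolding build_def w num_inject 4
      by (clarsimp simp: hier_fun) (rule set_eqI, simp)
  next
    case 5 show ?thesis using assms unfolding build_def w num_inject 5
      by (clarsimp simp: hier_fun) (rule set_eqI, simp)
  next
    case 6 show ?thesis using assms unfolding build_def w num_inject 6 by clarsimp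
  next
    case 7 show ?thesis using assms unfolding build_def w num_inject 7
      by (clarsimp simp: hier_fun) (rule set_eqI, simp)
  qed
qed

text \<open>Ordinals and integers generate everything: tags 0 to 4 build the definable relations
  over a level, tag 5 the tuples of parameters, and tag 6 evaluates a relation at a tuple. The
  parameters come from smaller levels, by induction.\<close>

lemma level_well_orderable:
  obtains C \<mu> where "ordinal \<mu>" "equipotent \<mu> C" "ext (val f \<alpha>) \<subseteq> ext C"
proof -
  define \<delta> where "\<delta> = setof (ext omega \<union> ext (succ \<alpha>))"
  have ext_\<delta>: "ext \<delta> = ext omega \<union> ext (succ \<alpha>)" unfolding \<delta>_def by (simp add: ext_setof)
  have ord_\<delta>: "ordinal \<delta>" unfolding \<delta>_def by (rule ord_Un) (simp_all add: ord_\<alpha>)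
  define X where "X = setof (ext (val f \<alpha>) \<union> ext \<delta>)"
  have ext_X: "ext X = ext (val f \<alpha>) \<union> ext \<delta>" unfolding X_def by (simp add: ext_setof)
  \<comment> \<open>Finitely many power sets over a transitive set provide the bound U that the
    fixed point construction requires.\<close>
  define V where "V k = (pow ^^ k) X" for k
  have V: "transitive_set (V k)" for k
  proof (induction k)
    case 0
    have "transitive_set (val f \<alpha>)" "transitive_set \<delta>"
      using level_transitive ord_\<delta> unfolding ordinal_def by simp_all
    then show ?case unfolding V_def transitive_set_def by (simp add: ext_X) blast
  qed (use transitive_pow in \<open>simp add: V_def\<close>)
  have V_Suc: "x \<in> ext (V (Suc k)) \<longleftrightarrow> ext x \<subseteq> ext (V k)" for x k unfolding V_def by simp
  have V_le: "ext (V i) \<subseteq> ext (V k)" if "i \<le> k" for i k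
    using that by (induction rule: dec_induct) (use V_Suc V transitive_set_def in blast)+
  have V_pair: "opair x y \<in> ext (V k)" if "x \<in> ext (V i)" "y \<in> ext (V i)" "Suc (Suc i) \<le> k" for x y i k
    using V_le[OF that(3)] that(1,2) by (auto simp: V_Suc ext_opair ext_setof)
  have L_V: "ext (val f \<gamma>) \<subseteq> ext (V 0)" if "\<gamma> \<in> ext (succ \<alpha>)" for \<gamma>
    using level_le[OF that] by (auto simp: V_def ext_X)
  have \<delta>_V: "ext \<delta> \<subseteq> ext (V 0)" by (auto simp: V_def ext_X)
  have tup_V: "s \<in> ext (V 3)" if s: "is_fun s n (val f \<gamma>)" "n \<in> ext omega" "\<gamma> \<in> ext (succ \<alpha>)" for s n \<gamma>
  proof -
    have "p \<in> ext (V 2)" if p: "p \<in> ext s" for p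
    proof -
      obtain i y where "p = opair i y" "i \<in> ext n" "y \<in> ext (val f \<gamma>)"
        using s(1) p unfolding is_fun_iff by meson
      moreover from this have "i \<in> ext (V 0)" using omega_transitive[OF s(2)] \<delta>_V ext_\<delta> by blast
      ultimately show ?thesis using L_V[OF s(3)] V_pair[of i 0 y 2] by auto
    qed
    then show ?thesis using V_Suc[of s 2] by (auto simp: numeral_eq_Suc)
  qed
  \<comment> \<open>A pair costs two power sets: tuples are sets of pairs from \<open>V 2\<close>
    and lie in \<open>V 3\<close>, relations in \<open>V 4\<close>, (n, R) in \<open>V 6\<close>,
    and (\<gamma>, (n, R)) in \<open>V 8\<close>.\<close>
  have rel_V: "opair \<gamma> (opair n R) \<in> ext (V 8)"
    if R: "\<And>s. s \<in> ext R \<Longrightarrow> is_fun s n (val f \<gamma>)" "n \<in> ext omega" "\<gamma> \<in> ext (succ \<alpha>)" for R n \<gamma>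
  proof -
    have "R \<in> ext (V 4)" using V_Suc[of R 3] tup_V[OF R(1) R(2,3)] by (auto simp: numeral_eq_Suc)
    moreover have "n \<in> ext (V 4)" "\<gamma> \<in> ext (V 6)"
      using R(2,3) \<delta>_V ext_\<delta> V_le[of 0 4] V_le[of 0 6] by auto
    ultimately show ?thesis by (intro V_pair[of _ 6] V_pair[of _ 4]) auto
  qed
  have \<delta>_V8: "ext \<delta> \<subseteq> ext (V 8)" using \<delta>_V V_le[of 0 8] by simp
  have "\<exists>C \<mu>. ordinal \<mu> \<and> equipotent \<mu> C \<and> ext \<delta> \<subseteq> ext C \<and> (\<forall>w \<in> ext C. \<forall>x \<in> ext C. \<forall>y \<in> ext C.
      \<forall>z \<in> ext (V 8). build w x y z \<longrightarrow> z \<in> ext C)"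
    by (rule closure_well_orderable) (fact ord_\<delta> \<delta>_V8 Dfn_build build_functional)+
  then obtain C \<mu> where C: "ordinal \<mu>" "equipotent \<mu> C" "ext \<delta> \<subseteq> ext C"
    "\<And>w x y z. w \<in> ext C \<Longrightarrow> x \<in> ext C \<Longrightarrow> y \<in> ext C \<Longrightarrow> build w x y z \<Longrightarrow> z \<in> ext (V 8) \<Longrightarrow> z \<in> ext C"
    by blast
  have num_C: "num k \<in> ext C" for k using C(3) ext_\<delta> by auto
  have pair_C: "opair x y \<in> ext C" if "x \<in> ext \<delta>" "y \<in> ext \<delta>" for x y
  proof (rule C(4)[of "num 0" x y])
    show "opair x y \<in> ext (V 8)" using that \<delta>_V by (intro V_pair[of _ 0]) auto
  qed (use that C(3) num_C[of 0] in \<open>auto simp: build_def\<close>)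
  have rel_C: "opair \<gamma> (opair n R) \<in> ext C"
    if \<gamma>: "\<gamma> \<in> ext (succ \<alpha>)" and n: "n \<in> ext omega" and R: "definable_rel (val f \<gamma>) n R" for \<gamma> n R
  proof -
    let ?A = "val f \<gamma>"
    \<comment> \<open>D collects the relations over the level whose codes belong to C. Once shown to
      be \<open>definability_closed\<close>, it contains every definable relation, since these lie
      in all closed families.\<close>
    define D where "D = setof {p \<in> ext (V 8). \<exists>n \<in> ext omega. \<exists>R. p = opair n R \<and> opair \<gamma> p \<in> ext C \<and>
      (\<forall>s \<in> ext R. is_fun s n ?A)}"
    have "ext D = {p \<in> ext (V 8). \<exists>n \<in> ext omega. \<exists>R. p = opair n R \<and> opair \<gamma> p \<in> ext C \<and>
      (\<forall>s \<in> ext R. is_fun s n ?A)}"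
      unfolding D_def by (intro ext_setof coded_sep dfn)
    moreover have "opair n R \<in> ext (V 8)" if "n \<in> ext omega" "\<forall>s \<in> ext R. is_fun s n ?A" for n R
    proof -
      have "setof {\<gamma>, opair n R} \<in> ext (opair \<gamma> (opair n R))" "opair n R \<in> ext (setof {\<gamma>, opair n R})"
        by (simp_all add: ext_opair ext_setof)
      then show ?thesis using rel_V[of R n \<gamma>] that \<gamma> V[of 8] unfolding transitive_set_def by blast
    qed
    ultimately have D: "opair n R \<in> ext D \<longleftrightarrow> n \<in> ext omega \<and> opair \<gamma> (opair n R) \<in> ext C \<and>
        (\<forall>s \<in> ext R. is_fun s n ?A)" for n R
      by auto
    have fA: "opair \<gamma> A \<in> ext f \<longleftrightarrow> A = ?A" for A using hier_fun \<gamma> by blast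
    have add: "opair n Q \<in> ext D"
      if "n \<in> ext omega" "x \<in> ext C" "y \<in> ext C" "build (num k) x y (opair \<gamma> (opair n Q))"
        "\<forall>s \<in> ext Q. is_fun s n ?A" for n x y k Q
      unfolding D using C(4)[OF num_C that(2,3,4)] rel_V[of Q n \<gamma>] that \<gamma> by blast
    have "definability_closed ?A D"
      unfolding definability_closed_def
    proof (intro ballI conjI allI impI)
      fix n i j assume n: "n \<in> ext omega" and ij: "i \<in> ext n" "j \<in> ext n"
      have c: "opair \<gamma> n \<in> ext C" "opair i j \<in> ext C"
        using pair_C n ij omega_transitive[OF n] \<gamma> ext_\<delta> by auto
      let ?R1 = "setof {s \<in> tuples ?A n. mem (val s i) (val s j)}"
      have R1: "ext ?R1 = {s \<in> tuples ?A n. mem (val s i) (val s j)}"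
        by (intro ext_setof coded_val_rel dfn ij)
      show "opair n ?R1 \<in> ext D"
      proof (rule add[OF n c, of 1])
        have "\<forall>s. s \<in> ext ?R1 \<longleftrightarrow> is_fun s n ?A \<and> (\<exists>a b. opair i a \<in> ext s \<and> opair j b \<in> ext s \<and> mem a b)"
          unfolding R1 unfolding tuples_def using val_rel_iff[OF _ ij, where R = mem] by blast
        then show "build (num 1) (opair \<gamma> n) (opair i j) (opair \<gamma> (opair n ?R1))"
          unfolding build_def num_inject by (simp add: fA)
      qed (unfold R1, unfold tuples_def, simp)
      let ?R2 = "setof {s \<in> tuples ?A n. val s i = val s j}"
      have R2: "ext ?R2 = {s \<in> tuples ?A n. val s i = val s j}"
        by (intro ext_setof coded_val_rel dfn ij)
      show "opair n ?R2 \<in> ext D"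
      proof (rule add[OF n c, of 2])
        have "\<forall>s. s \<in> ext ?R2 \<longleftrightarrow> is_fun s n ?A \<and> (\<exists>a b. opair i a \<in> ext s \<and> opair j b \<in> ext s \<and> a = b)"
          unfolding R2 unfolding tuples_def using val_rel_iff[OF _ ij, where R = "(=)"] by blast
        then show "build (num 2) (opair \<gamma> n) (opair i j) (opair \<gamma> (opair n ?R2))"
          unfolding build_def num_inject by (simp add: fA)
      qed (unfold R2, unfold tuples_def, simp)
    next
      \<comment> \<open>One operation replaces two: R nand R is the complement of R, and the
        complement of R nand S is the intersection.\<close>
      have nand: "opair n (setof {s \<in> tuples ?A n. \<not> (s \<in> ext R \<and> s \<in> ext S)}) \<in> ext D"
        if n: "n \<in> ext omega" and RS: "opair n R \<in> ext D" "opair n S \<in> ext D" for n R S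
      proof -
        let ?Q = "setof {s \<in> tuples ?A n. \<not> (s \<in> ext R \<and> s \<in> ext S)}"
        have "ext ?Q = {s \<in> tuples ?A n. \<not> (s \<in> ext R \<and> s \<in> ext S)}"
          by (intro ext_setof coded_tuples dfn)
        then have Q: "s \<in> ext ?Q \<longleftrightarrow> is_fun s n ?A \<and> \<not> (s \<in> ext R \<and> s \<in> ext S)" for s
          by (auto simp: tuples_def)
        show ?thesis
        proof (rule add[OF n, of "opair \<gamma> (opair n R)" "opair \<gamma> (opair n S)" 3])
          show "build (num 3) (opair \<gamma> (opair n R)) (opair \<gamma> (opair n S)) (opair \<gamma> (opair n ?Q))"
            using Q unfolding build_def num_inject by (simp add: fA)
        qed (use RS D Q in auto)
      qed
      {
        fix n R assume n: "n \<in> ext omega" and R: "opair n R \<in> ext D"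
        have "{s \<in> tuples ?A n. \<not> (s \<in> ext R \<and> s \<in> ext R)} = tuples ?A n - ext R" by auto
        with nand[OF n R R] show compl: "opair n (setof (tuples ?A n - ext R)) \<in> ext D" by simp
      }
      note compl = this
      fix n R S assume n: "n \<in> ext omega" and RS: "opair n R \<in> ext D" "opair n S \<in> ext D"
      have "ext (setof {s \<in> tuples ?A n. \<not> (s \<in> ext R \<and> s \<in> ext S)}) =
          {s \<in> tuples ?A n. \<not> (s \<in> ext R \<and> s \<in> ext S)}"
        by (intro ext_setof coded_tuples dfn)
      moreover have "tuples ?A n - {s \<in> tuples ?A n. \<not> (s \<in> ext R \<and> s \<in> ext S)} = ext R \<inter> ext S"
        using RS(1) D unfolding tuples_def by auto
      ultimately show "opair n (setof (ext R \<inter> ext S)) \<in> ext D"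
        using compl[OF n nand[OF n RS]] by simp
    next
      fix n R assume n: "n \<in> ext omega" and R: "opair (succ n) R \<in> ext D"
      let ?Q = "setof {s \<in> tuples ?A n. \<exists>x \<in> ext ?A. snoc s n x \<in> ext R}"
      have "ext ?Q = {s \<in> tuples ?A n. \<exists>x \<in> ext ?A. snoc s n x \<in> ext R}"
        by (intro ext_setof coded_tuples dfn)
      then have Q: "s \<in> ext ?Q \<longleftrightarrow> is_fun s n ?A \<and> (\<exists>x \<in> ext ?A. snoc s n x \<in> ext R)" for s
        by (auto simp: tuples_def)
      show "opair n ?Q \<in> ext D"
      proof (rule add[OF n, of "opair \<gamma> (opair (succ n) R)" emp 4])
        show "build (num 4) (opair \<gamma> (opair (succ n) R)) emp (opair \<gamma> (opair n ?Q))"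
          using Q unfolding build_def num_inject by (simp add: fA)
      qed (use R D Q num_C[of 0] in auto)
    qed
    then show ?thesis using R D unfolding definable_rel_def by blast
  qed
  have level_C: "ext (val f \<beta>) \<subseteq> ext C" if "\<beta> \<in> ext (succ \<alpha>)" for \<beta>
  proof -
    have "Dfn (\<lambda>v. \<forall>A. opair (v 0) A \<in> ext f \<longrightarrow> ext A \<subseteq> ext C)" by (intro dfn)
    moreover have "ordinal \<beta>" using ord_elem[OF ord_succ[OF ord_\<alpha>] that] .
    ultimately have "\<forall>A. opair \<beta> A \<in> ext f \<longrightarrow> ext A \<subseteq> ext C"
    proof (induction rule: ord_induct)
      case (step \<beta>)
      show ?case
        unfolding hier_fun
      proof (intro allI impI subsetI, elim conjE)
        fix A x assume \<beta>: "\<beta> \<in> ext (succ \<alpha>)" and A: "x \<in> ext A" "A = val f \<beta>"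
        then obtain \<gamma> where \<gamma>: "\<gamma> \<in> ext \<beta>" "x \<in> definable_subsets (val f \<gamma>)"
          using ext_level[OF \<beta>] by blast
        have \<gamma>\<alpha>: "\<gamma> \<in> ext (succ \<alpha>)" using level_trans[OF \<gamma>(1) \<beta>] .
        let ?B = "val f \<gamma>"
        have B: "ext ?B \<subseteq> ext C" using step(2)[OF \<gamma>(1)] \<gamma>\<alpha> hier_fun by blast
        obtain n s R where n: "n \<in> ext omega" and s: "is_fun s n ?B"
          and R: "definable_rel ?B (succ n) R" "ext x = {y \<in> ext ?B. snoc s n y \<in> ext R}"
          using \<gamma>(2) unfolding definable_subsets_def tuples_def by blast
        \<comment> \<open>Tuples enter C one coordinate at a time. Their length may be nonstandard,
          so the induction is internal.\<close>
        have "Dfn (\<lambda>v. \<forall>s. is_fun s (v 0) ?B \<longrightarrow> opair (v 0) s \<in> ext C)" by (intro dfn)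
        from this n have "\<forall>s. is_fun s n ?B \<longrightarrow> opair n s \<in> ext C"
        proof (induction rule: omega_induct)
          case zero
          show ?case using pair_C[of emp emp] ext_\<delta> by (simp add: is_fun_emp_iff)
        next
          case (Suc n)
          show ?case
          proof (intro allI impI)
            fix t assume t: "is_fun t (succ n) ?B"
            then obtain s y where s: "is_fun s n ?B" "y \<in> ext ?B" "t = snoc s n y"
              by (rule is_fun_succ_cases)
            show "opair (succ n) t \<in> ext C"
            proof (rule C(4)[of "num 5" "opair n s" y])
              show "build (num 5) (opair n s) y (opair (succ n) t)" unfolding build_def num_inject s(3) by simp
              have "t \<in> ext (V 3)" using tup_V[OF t _ \<gamma>\<alpha>] Suc by simp
              moreover have "succ n \<in> ext (V 3)" using omega_succ[OF Suc(1)] \<delta>_V ext_\<delta> V_le[OF le0, of 3] by blast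
              ultimately show "opair (succ n) t \<in> ext (V 8)" by (intro V_pair[of _ 3]) auto
            qed (use num_C Suc s B in auto)
          qed
        qed
        with s have "opair n s \<in> ext C" by blast
        show "x \<in> ext C"
        proof (rule C(4)[of "num 6" "opair \<gamma> (opair (succ n) R)" "opair n s"])
          show "build (num 6) (opair \<gamma> (opair (succ n) R)) (opair n s) x"
            unfolding build_def num_inject using hier_fun \<gamma>\<alpha> R(2) by auto
          have "x \<in> ext (V 0)" using A L_V[OF \<beta>] by blast
          then show "x \<in> ext (V 8)" using V_le[of 0 8] by auto
        qed (use num_C rel_C[OF \<gamma>\<alpha> omega_succ[OF n] R(1)] \<open>opair n s \<in> ext C\<close> in auto)
      qed
    qed
    then show ?thesis using hier_fun that by blast
  qed
  show ?thesis using that[OF C(1,2) level_C] by simp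
qed

end

text \<open>By V = L some level contains x; it takes the place of a transitive closure built by
  recursion along \<omega>.\<close>

lemma transitive_superset: "\<exists>T. transitive_set T \<and> x \<in> ext T"
proof -
  obtain \<alpha> f where "ordinal \<alpha>" "constructible_hierarchy \<alpha> f" "x \<in> ext (val f \<alpha>)"
    using V_eq_L[of x] unfolding constructible_def by blast
  then show ?thesis using level_transitive by (metis ext_succ insertI1)
qed

lemma eps_induct:
  assumes P: "Dfn (\<lambda>v. P (v 0))" and step: "\<And>x. (\<And>y. y \<in> ext x \<Longrightarrow> P y) \<Longrightarrow> P x"
  shows "P x"
proof (rule ccontr)
  assume x: "\<not> P x"
  obtain T where T: "transitive_set T" "x \<in> ext T" using transitive_superset by blast
  have E: "ext (setof {x \<in> ext T. \<not> P x}) = {x \<in> ext T. \<not> P x}"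
    by (intro ext_setof coded_sep dfn P)
  have "x \<in> ext (setof {x \<in> ext T. \<not> P x})" unfolding E using T x by simp
  from is_min[OF this, unfolded E] show False using step T(1) unfolding transitive_set_def by blast
qed

theorem well_orderable: "\<exists>\<mu>. ordinal \<mu> \<and> equipotent \<mu> Z"
proof -
  obtain \<alpha> f where h: "ordinal \<alpha>" "constructible_hierarchy \<alpha> f" and Z: "Z \<in> ext (val f \<alpha>)"
    using V_eq_L[of Z] unfolding constructible_def by blast
  obtain C \<mu> where C: "ordinal \<mu>" "equipotent \<mu> C" "ext (val f \<alpha>) \<subseteq> ext C"
    using level_well_orderable[OF h] by blast
  have "transitive_set (val f \<alpha>)" using level_transitive[OF h] by simp
  with Z C(3) have "ext Z \<subseteq> ext C" unfolding transitive_set_def by blast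
  then show ?thesis using subset_well_orderable[OF C(1,2)] by blast
qed

end

section \<open>Infinite cardinals\<close>

context ZFL_model
begin

lemma cardinality_props:
  shows "ordinal (cardinality a)" "equipotent (cardinality a) a"
    "b \<in> ext (cardinality a) \<Longrightarrow> \<not> equipotent b a"
proof -
  let ?P = "\<lambda>k. ordinal k \<and> equipotent k a \<and> (\<forall>b \<in> ext k. \<not> equipotent b a)"
  obtain \<mu> where \<mu>: "ordinal \<mu>" "equipotent \<mu> a" using well_orderable by blast
  have "Dfn (\<lambda>v. equipotent (v 0) a)" by (intro dfn)
  then obtain k where "ordinal k" "equipotent k a" "\<And>b. b \<in> ext k \<Longrightarrow> \<not> equipotent b a"
    by (rule ord_least[of _ \<mu>]) (use \<mu> in blast)+
  then have k: "?P k" by blast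
  have "k' = k" if k': "?P k'" for k'
  proof -
    consider "k \<in> ext k'" | "k = k'" | "k' \<in> ext k" using ord_linear[of k k'] k k' by argo
    then show ?thesis using k k' by cases blast+
  qed
  with k have "?P (cardinality a)" unfolding cardinality_def by (rule theI)
  then show "ordinal (cardinality a)" "equipotent (cardinality a) a"
    "b \<in> ext (cardinality a) \<Longrightarrow> \<not> equipotent b a" by blast+
qed

lemma no_injection_omega:
  assumes "n \<in> ext omega" "is_fun h omega n"
    "\<And>x x' y. opair x y \<in> ext h \<Longrightarrow> opair x' y \<in> ext h \<Longrightarrow> x = x'"
  shows False
proof -
  let ?Q = "\<lambda>h n. is_fun h omega n \<and> (\<forall>x x' y. opair x y \<in> ext h \<longrightarrow> opair x' y \<in> ext h \<longrightarrow> x = x')"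
  have "Dfn (\<lambda>v. \<forall>h. \<not> ?Q h (v 0))" by (intro dfn)
  from this assms(1) have "\<forall>h. \<not> ?Q h n"
  proof (induction rule: omega_induct)
    case zero
    show ?case
    proof (intro allI notI, elim conjE)
      fix h assume h: "is_fun h omega emp"
      show False using fun_total[OF h omega_emp] fun_in[OF h] by fastforce
    qed
  next
    case (Suc n)
    show ?case
    proof (intro allI notI, elim conjE)
      fix h assume h: "is_fun h omega (succ n)"
        and inj: "\<forall>x x' y. opair x y \<in> ext h \<longrightarrow> opair x' y \<in> ext h \<longrightarrow> x = x'"
      \<comment> \<open>The smaller map drops the argument 0: k goes to h(k + 1), except that the
        argument sent to n takes over the freed value h(0).\<close>
      define R where "R k y \<longleftrightarrow> y \<noteq> n \<and> opair (succ k) y \<in> ext h \<or>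
        opair (succ k) n \<in> ext h \<and> opair emp y \<in> ext h" for k y
      have h0: "opair (succ k) y \<notin> ext h" if "opair emp y \<in> ext h" for k y
        using inj that succ_ne_emp by metis
      obtain g where g: "is_fun g omega n" "\<And>x y. x \<in> ext omega \<Longrightarrow> opair x y \<in> ext g \<longleftrightarrow> R x y"
      proof (rule fun_exists[where R = R and a = omega and b = n])
        show "Dfn (\<lambda>v. R (v 0) (v 1))" unfolding R_def by (intro dfn)
        fix k assume k: "k \<in> ext omega"
        obtain y where y: "opair (succ k) y \<in> ext h" using fun_total[OF h omega_succ[OF k]] by blast
        obtain y0 where y0: "opair emp y0 \<in> ext h" using fun_total[OF h omega_emp] by blast
        show "\<exists>!y. R k y"
        proof (cases "y = n")
          case True
          show ?thesis
            by (rule ex1I[of _ y0]) (use True y y0 fun_unique[OF h] in \<open>unfold R_def, metis+\<close>)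
        next
          case False
          show ?thesis
            by (rule ex1I[of _ y]) (use False y y0 fun_unique[OF h] in \<open>unfold R_def, metis+\<close>)
        qed
        fix y assume "R k y"
        then show "y \<in> ext n"
          using fun_in[OF h, of _ y] h0[of y k] unfolding R_def by auto
      qed (rule that)
      have "k = k'" if "opair k y \<in> ext g" "opair k' y \<in> ext g" for k k' y
      proof -
        have "R k y" "R k' y" using that fun_in[OF g(1)] g(2) by blast+
        then show ?thesis using inj h0 succ_inject unfolding R_def by metis
      qed
      then show False using Suc g(1) by blast
    qed
  qed
  then show False using assms by blast
qed

section \<open>Arithmetic of an infinite initial ordinal\<close>

context
  fixes \<kappa> Z :: 'a
  assumes ord_\<kappa>: "ordinal \<kappa>" and eq_\<kappa>: "equipotent \<kappa> Z"
    and init_\<kappa>: "\<forall>b \<in> ext \<kappa>. \<not> equipotent b Z" and inf_\<kappa>: "ext omega \<subseteq> ext Z"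
begin

text \<open>If \<kappa> were an integer, the inverse of its bijection onto Z, restricted to
  \<omega>, would violate the pigeonhole principle.\<close>

lemma omega_subset_initial: "ext omega \<subseteq> ext \<kappa>"
proof -
  have "\<kappa> \<notin> ext omega"
  proof
    assume \<kappa>: "\<kappa> \<in> ext omega"
    obtain f where f: "is_fun f \<kappa> Z" "\<forall>y \<in> ext Z. \<exists>!x. opair x y \<in> ext f"
      using eq_\<kappa> unfolding equipotent_iff by blast
    obtain h where h: "is_fun h omega \<kappa>" "\<And>x y. x \<in> ext omega \<Longrightarrow> opair x y \<in> ext h \<longleftrightarrow> opair y x \<in> ext f"
    proof (rule fun_exists[where R = "\<lambda>x y. opair y x \<in> ext f" and a = omega and b = \<kappa>])
      show "Dfn (\<lambda>v. opair (v 1) (v 0) \<in> ext f)" by (intro dfn)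
      show "\<exists>!y. opair y x \<in> ext f" if "x \<in> ext omega" for x using f(2) inf_\<kappa> that by blast
      show "y \<in> ext \<kappa>" if "opair y x \<in> ext f" for x y using fun_in[OF f(1) that] by blast
    qed (rule that)
    show False
    proof (rule no_injection_omega[OF \<kappa> h(1)])
      fix x x' y assume xy: "opair x y \<in> ext h" "opair x' y \<in> ext h"
      then have "opair y x \<in> ext f" "opair y x' \<in> ext f" using h(2) fun_in[OF h(1)] by blast+
      then show "x = x'" using fun_unique[OF f(1)] by blast
    qed
  qed
  then show ?thesis using ord_subset[OF ord_omega ord_\<kappa>] ord_linear[OF ord_omega ord_\<kappa>] by blast
qed

lemma initial_limit: assumes x: "x \<in> ext \<kappa>" shows "succ x \<in> ext \<kappa>"
proof (rule ccontr)
  assume "succ x \<notin> ext \<kappa>"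
  then have \<kappa>: "\<kappa> = succ x"
    using ord_linear[OF ord_succ[OF ord_elem[OF ord_\<kappa> x]] ord_\<kappa>] x mem_asym mem_irrefl by auto
  have sub: "ext omega \<subseteq> ext x"
  proof
    fix n assume "n \<in> ext omega"
    then have "succ n \<in> ext \<kappa>" using omega_subset_initial by auto
    then have "succ n = x \<or> succ n \<in> ext x" unfolding \<kappa> by simp
    then show "n \<in> ext x" using ord_trans[OF ord_elem[OF ord_\<kappa> x], of "succ n" n] by auto
  qed
  then have "x \<notin> ext omega" by auto
  \<comment> \<open>Hilbert's hotel: x goes to 0, the integers move up by one and all else stays,
    which maps x + 1 bijectively onto x.\<close>
  define R where "R u y \<longleftrightarrow> u = x \<and> y = emp \<or> u \<in> ext omega \<and> y = succ u \<or>
    u \<notin> ext omega \<and> u \<noteq> x \<and> y = u" for u y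
  have "equipotent \<kappa> x"
  proof (rule equipotentI[of R])
    show "Dfn (\<lambda>v. R (v 0) (v 1))" unfolding R_def by (intro dfn)
    show "\<exists>y \<in> ext x. R u y" if u: "u \<in> ext \<kappa>" for u
    proof -
      consider "u = x" | "u \<in> ext omega" | "u \<in> ext x" "u \<notin> ext omega" using u unfolding \<kappa> by auto
      then show ?thesis
      proof cases
        case 1 then show ?thesis using sub omega_emp unfolding R_def by blast
      next
        case 2 then show ?thesis using sub omega_succ unfolding R_def by blast
      next
        case 3 then show ?thesis unfolding R_def using mem_irrefl by blast
      qed
    qed
    show "\<exists>u \<in> ext \<kappa>. R u y" if y: "y \<in> ext x" for y
    proof (cases "y \<in> ext omega")
      case True
      then consider "y = emp" | m where "m \<in> ext omega" "y = succ m" using omega_cases by blast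
      then show ?thesis
      proof cases
        case 1 then show ?thesis unfolding R_def \<kappa> by auto
      next
        case 2 then show ?thesis using sub unfolding R_def \<kappa> by auto
      qed
    next
      case False
      then have "R y y" "y \<in> ext \<kappa>" using y unfolding R_def \<kappa> by auto
      then show ?thesis by blast
    qed
    show "y = y'" if "R u y" "R u y'" for u y y'
      using that \<open>x \<notin> ext omega\<close> unfolding R_def by auto
    show "u = u'" if "R u y" "R u' y" for u u' y
      using that \<open>x \<notin> ext omega\<close> omega_succ omega_emp unfolding R_def by auto
  qed
  then show False using init_\<kappa> x eq_\<kappa> equipotent_trans equipotent_sym by blast
qed

text \<open>Writing ordinals as \<open>\<lambda> + n\<close> with \<open>\<lambda>\<close> limit or zero, \<open>dbl\<close> is the graph of
  \<open>\<lambda> + n \<mapsto> \<lambda> + 2n\<close>.\<close>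

definition is_succ :: "'a \<Rightarrow> bool" where
  "is_succ b \<longleftrightarrow> (\<exists>u. b = succ u)"

definition dbl_step :: "'a \<Rightarrow> 'a \<Rightarrow> bool" where
  "dbl_step Y p \<longleftrightarrow> (\<exists>b c. p = opair b c \<and> (b = c \<and> \<not> is_succ b \<or>
    (\<exists>b' c'. b = succ b' \<and> c = succ (succ c') \<and> opair b' c' \<in> ext Y)))"

definition dbl :: "'a \<Rightarrow> 'a \<Rightarrow> bool" where
  "dbl b c \<longleftrightarrow> opair b c \<in> ext (lfix (cart \<kappa> \<kappa>) dbl_step)"

lemma Dfn_dbl[dfn]: "Tm s \<Longrightarrow> Tm t \<Longrightarrow> Dfn (\<lambda>v. dbl (s v) (t v))"
  by (rule Dfn2[of dbl]) (unfold dbl_def, intro dfn)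

lemma dbl_iff: "dbl b c \<longleftrightarrow> b \<in> ext \<kappa> \<and> c \<in> ext \<kappa> \<and> (b = c \<and> \<not> is_succ b \<or>
    (\<exists>b' c'. b = succ b' \<and> c = succ (succ c') \<and> dbl b' c'))"
proof -
  have D: "Dfn (\<lambda>v. dbl_step (v 0) (v 1))" unfolding dbl_step_def is_succ_def by (intro dfn)
  have "\<forall>Y Y' x. ext Y \<subseteq> ext Y' \<longrightarrow> dbl_step Y x \<longrightarrow> dbl_step Y' x"
    unfolding dbl_step_def by blast
  from lfix_unfold[OF D this, of "opair b c" "cart \<kappa> \<kappa>"]
  have "dbl b c \<longleftrightarrow> b \<in> ext \<kappa> \<and> c \<in> ext \<kappa> \<and> dbl_step (lfix (cart \<kappa> \<kappa>) dbl_step) (opair b c)"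
    unfolding dbl_def by simp
  then show ?thesis unfolding dbl_step_def dbl_def[symmetric] opair_inject by blast
qed

text \<open>The recursion never leaves \<kappa> because an infinite initial ordinal is closed under
  successor.\<close>

lemma dbl_total: "b \<in> ext \<kappa> \<Longrightarrow> \<exists>c. dbl b c"
proof -
  assume b: "b \<in> ext \<kappa>"
  have "Dfn (\<lambda>v. v 0 \<in> ext \<kappa> \<longrightarrow> (\<exists>c. dbl (v 0) c))" by (intro dfn)
  moreover have "ordinal b" using ord_elem[OF ord_\<kappa> b] .
  ultimately have "b \<in> ext \<kappa> \<longrightarrow> (\<exists>c. dbl b c)"
  proof (induction rule: ord_induct)
    case (step b)
    show ?case
    proof
      assume b: "b \<in> ext \<kappa>"
      show "\<exists>c. dbl b c"
      proof (cases "is_succ b")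
        case True
        then obtain u where u: "b = succ u" unfolding is_succ_def by blast
        then have "u \<in> ext \<kappa>" using ord_trans[OF ord_\<kappa> b] by simp
        then obtain c where c: "dbl u c" using step(2)[of u] u by auto
        then have "succ (succ c) \<in> ext \<kappa>" using initial_limit dbl_iff[of u c] by blast
        then show ?thesis using dbl_iff[of b "succ (succ c)"] b u c by blast
      next
        case False
        then show ?thesis using dbl_iff[of b b] b by blast
      qed
    qed
  qed
  with b show ?thesis by blast
qed

lemma dbl_ordinal: "dbl b c \<Longrightarrow> ordinal b \<and> ordinal c"
  using dbl_iff ord_elem[OF ord_\<kappa>] by blast

text \<open>The values are even ordinals: if c = c' + 1 for two values, then c = c1 + 2 for a value
  c1, so c' = c1 + 1 is a smaller counterexample.\<close>

lemma dbl_odd: assumes "dbl b c" "dbl b' c'" shows "c \<noteq> succ c'"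
proof -
  have "Dfn (\<lambda>v. \<forall>b b' c'. dbl b (v 0) \<longrightarrow> dbl b' c' \<longrightarrow> v 0 \<noteq> succ c')" by (intro dfn)
  moreover have "ordinal c" using dbl_ordinal assms by blast
  ultimately have "\<forall>b b' c'. dbl b c \<longrightarrow> dbl b' c' \<longrightarrow> c \<noteq> succ c'"
  proof (induction rule: ord_induct)
    case (step c)
    show ?case
    proof (intro allI impI notI)
      fix b b' c' assume d: "dbl b c" "dbl b' c'" and c: "c = succ c'"
      then have "is_succ c" unfolding is_succ_def by blast
      with d(1) obtain b1 c1 where "c = succ (succ c1)" "dbl b1 c1"
        using dbl_iff[of b c] by metis
      then show False using step(2)[of c'] c d(2) by auto
    qed
  qed
  then show ?thesis using assms by blast
qed

lemma dbl_inject: assumes "dbl b c" "dbl b' c" shows "b = b'"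
proof -
  have "Dfn (\<lambda>v. \<forall>b b'. dbl b (v 0) \<longrightarrow> dbl b' (v 0) \<longrightarrow> b = b')" by (intro dfn)
  moreover have "ordinal c" using dbl_ordinal assms by blast
  ultimately have "\<forall>b b'. dbl b c \<longrightarrow> dbl b' c \<longrightarrow> b = b'"
  proof (induction rule: ord_induct)
    case (step c)
    show ?case
    proof (intro allI impI)
      fix b b' assume d: "dbl b c" "dbl b' c"
      show "b = b'"
      proof (cases "is_succ c")
        case True
        then have s: "\<exists>u v. b = succ u \<and> c = succ (succ v) \<and> dbl u v" if "dbl b c" for b
          using that dbl_iff[of b c] by metis
        obtain b1 c1 where 1: "b = succ b1" "c = succ (succ c1)" "dbl b1 c1" using s[OF d(1)] by blast
        obtain b2 c2 where 2: "b' = succ b2" "c = succ (succ c2)" "dbl b2 c2" using s[OF d(2)] by blast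
        have "c1 = c2" using 1 2 by simp
        then show ?thesis using step(2)[of c1] 1 2 by auto
      next
        case False
        then have "b = c" "b' = c"
          using d dbl_iff[of b c] dbl_iff[of b' c] unfolding is_succ_def by blast+
        then show ?thesis by simp
      qed
    qed
  qed
  then show ?thesis using assms by blast
qed

text \<open>The graph of the characteristic function of \<open>X\<close>, coded by \<open>(b, 1) \<mapsto> dbl b\<close> and
  \<open>(b, 0) \<mapsto> dbl b + 1\<close>.\<close>

definition chi :: "'a \<Rightarrow> 'a \<Rightarrow> bool" where
  "chi X z \<longleftrightarrow> (\<exists>b c. dbl b c \<and> (b \<in> ext X \<and> z = c \<or> b \<notin> ext X \<and> z = succ c))"

lemma Dfn_chi: "Dfn (\<lambda>v. chi (v 0) (v 1))"
  unfolding chi_def by (intro dfn)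

lemma chi_in: "chi X z \<Longrightarrow> z \<in> ext \<kappa>"
  unfolding chi_def using dbl_iff initial_limit by blast

text \<open>If X and Y differ at b, the code of b with its value under X is missing from the graph
  for Y, because \<open>dbl\<close> is injective and never takes two consecutive values.\<close>

lemma chi_antichain:
  assumes "ext X \<subseteq> ext \<kappa>" "ext Y \<subseteq> ext \<kappa>" shows "\<exists>z. chi X z \<and> (chi Y z \<longrightarrow> X = Y)"
proof (cases "X = Y")
  case True
  \<comment> \<open>For X = Y only the nonemptiness of the graph is at stake.\<close>
  have "emp \<in> ext \<kappa>" using omega_subset_initial omega_emp by blast
  then obtain c where "dbl emp c" using dbl_total by blast
  then have "chi X c \<or> chi X (succ c)" unfolding chi_def by blast
  then show ?thesis using True by blast
next
  case False
  then obtain b where b: "b \<in> ext \<kappa>" "b \<in> ext X \<longleftrightarrow> b \<notin> ext Y"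
    using set_eqI[of X Y] assms by blast
  then obtain c where c: "dbl b c" using dbl_total by blast
  let ?z = "if b \<in> ext X then c else succ c"
  have "chi X ?z" using c unfolding chi_def by auto
  moreover have "\<not> chi Y ?z"
  proof
    assume "chi Y ?z"
    then obtain b' c' where d: "dbl b' c'" "b' \<in> ext Y \<and> ?z = c' \<or> b' \<notin> ext Y \<and> ?z = succ c'"
      unfolding chi_def by blast
    show False
      using d b c dbl_inject[OF c, of b'] dbl_odd[OF c d(1)] dbl_odd[OF d(1) c]
      by (auto split: if_splits)
  qed
  ultimately show ?thesis by blast
qed

end

text \<open>Hides the particular coding: the realizability part relies on these three properties of
  H alone.\<close>

lemma antichain_exists:
  assumes "ordinal \<kappa>" "equipotent \<kappa> Z" "\<forall>b \<in> ext \<kappa>. \<not> equipotent b Z" "ext omega \<subseteq> ext Z"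
  shows "\<exists>H. Dfn (\<lambda>v. H (v 0) (v 1)) \<and> (\<forall>X z. H X z \<longrightarrow> z \<in> ext \<kappa>) \<and>
    (\<forall>X Y. ext X \<subseteq> ext \<kappa> \<longrightarrow> ext Y \<subseteq> ext \<kappa> \<longrightarrow> (\<exists>z. H X z \<and> (H Y z \<longrightarrow> X = Y)))"
  using Dfn_chi[OF assms] chi_in[OF assms] chi_antichain[OF assms]
  by (intro exI[of _ "chi \<kappa>"]) simp

end

section \<open>Typed combinatory terms\<close>

datatype comb = CB | CC | CI | CK | CW | CCc

datatype trm = Var nat | Cst comb | App trm trm (infixl "\<cdot>" 70)

text \<open>Krivine's abstraction: if \<open>h\<close> maps \<open>\<xi> \<cdot> \<pi>\<close> to \<open>s[\<xi>] \<star> \<pi>\<close>, then \<open>absarg x h t\<close> maps it to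
  \<open>s[\<xi>] \<star> t[\<xi>] \<cdot> \<pi>\<close>. In contrast to the usual abstraction by means of \<open>S\<close>, the argument is
  literally \<open>t[\<xi>]\<close>.\<close>

primrec absarg :: "nat \<Rightarrow> trm \<Rightarrow> trm \<Rightarrow> trm" where
  "absarg x h (Var y) = (if y = x then Cst CW \<cdot> h else Cst CC \<cdot> h \<cdot> Var y)"
| "absarg x h (Cst c) = Cst CC \<cdot> h \<cdot> Cst c"
| "absarg x h (s \<cdot> t) = absarg x (absarg x (Cst CB \<cdot> Cst CB \<cdot> h) s) t"

text \<open>Only arguments go through \<open>absarg\<close>; the head of the body is handled by
  \<open>I\<close> or \<open>K\<close>.\<close>

primrec abs :: "nat \<Rightarrow> trm \<Rightarrow> trm" where
  "abs x (Var y) = (if y = x then Cst CI else Cst CK \<cdot> Var y)"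
| "abs x (Cst c) = Cst CK \<cdot> Cst c"
| "abs x (s \<cdot> t) = absarg x (abs x s) t"

primrec fv :: "trm \<Rightarrow> nat set" where
  "fv (Var x) = {x}"
| "fv (Cst c) = {}"
| "fv (s \<cdot> t) = fv s \<union> fv t"

lemma fv_absarg: "fv (absarg x h t) = fv h \<union> (fv t - {x})"
  by (induction t arbitrary: h) auto

lemma fv_abs[simp]: "fv (abs x t) = fv t - {x}"
  by (induction t) (auto simp: fv_absarg)

declare abs.simps[simp del]

section \<open>Execution of abstractions\<close>

context realizability_algebra
begin

lemma app_in[simp]: "\<xi> \<in> ext Lam \<Longrightarrow> \<eta> \<in> ext Lam \<Longrightarrow> app \<xi> \<eta> \<in> ext Lam"
  using app unfolding internal_op2_def by blast

lemma push_in[simp]: "\<xi> \<in> ext Lam \<Longrightarrow> \<pi> \<in> ext Pi \<Longrightarrow> push \<xi> \<pi> \<in> ext Pi"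
  using push unfolding internal_op2_def by blast

lemma proc_in[simp]: "\<xi> \<in> ext Lam \<Longrightarrow> \<pi> \<in> ext Pi \<Longrightarrow> \<xi> \<star> \<pi> \<in> ext Proc"
  using proc unfolding internal_op2_def by blast

lemma cont_in[simp]: "\<pi> \<in> ext Pi \<Longrightarrow> cont \<pi> \<in> ext Lam"
  using cont unfolding internal_op_def by blast

lemma QP_Lam: "\<xi> \<in> ext QP \<Longrightarrow> \<xi> \<in> ext Lam"
  using QP_subset by blast

lemma comb_in[simp]: "cB \<in> ext Lam" "cC \<in> ext Lam" "cI \<in> ext Lam" "cK \<in> ext Lam" "cW \<in> ext Lam" "cc \<in> ext Lam"
  using QP_combinators QP_Lam by auto

lemma pole_step:
  assumes "step p q" "p \<in> ext Proc" "q \<in> ext Proc" "q \<in> ext pole" shows "p \<in> ext pole"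
  by (rule pole_anti_exec[of p q]) (use assms in \<open>auto simp: exec_def\<close>)

primrec cst :: "comb \<Rightarrow> 'm" where
  "cst CB = cB" | "cst CC = cC" | "cst CI = cI" | "cst CK = cK" | "cst CW = cW" | "cst CCc = cc"

primrec ev :: "(nat \<Rightarrow> 'm) \<Rightarrow> trm \<Rightarrow> 'm" where
  "ev e (Var x) = e x"
| "ev e (Cst c) = cst c"
| "ev e (s \<cdot> t) = app (ev e s) (ev e t)"

text \<open>\<open>hp e t \<pi>\<close>: the process reached from \<open>t \<star> \<pi>\<close> once the applications of its head are
  unwound is in the pole.\<close>

primrec hp :: "(nat \<Rightarrow> 'm) \<Rightarrow> trm \<Rightarrow> 'm \<Rightarrow> bool" where
  "hp e (Var x) \<pi> \<longleftrightarrow> e x \<star> \<pi> \<in> ext pole"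
| "hp e (Cst c) \<pi> \<longleftrightarrow> cst c \<star> \<pi> \<in> ext pole"
| "hp e (s \<cdot> t) \<pi> \<longleftrightarrow> hp e s (push (ev e t) \<pi>)"

lemma cst_in[simp]: "cst c \<in> ext Lam" "cst c \<in> ext QP"
  using QP_combinators by (cases c; simp)+

lemma ev_in[simp]: "(\<And>i. e i \<in> ext Lam) \<Longrightarrow> ev e t \<in> ext Lam"
  by (induction t) auto

lemma ev_closed: "fv t = {} \<Longrightarrow> ev e t \<in> ext QP"
  by (induction t) (auto intro: QP_app)

lemma hp_ev:
  assumes "\<And>i. e i \<in> ext Lam" "\<pi> \<in> ext Pi" "hp e t \<pi>" shows "ev e t \<star> \<pi> \<in> ext pole"
  using assms(2,3)
proof (induction t arbitrary: \<pi>)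
  case (App s t)
  then have "ev e s \<star> push (ev e t) \<pi> \<in> ext pole" using assms(1) by simp
  then show ?case
    using pole_step[OF step_app[of "ev e s" "ev e t" \<pi>]] App(3) assms(1) by simp
qed auto

lemma hp_absarg:
  assumes e: "\<And>i. e i \<in> ext Lam" and \<xi>: "\<xi> \<in> ext Lam" and \<pi>: "\<pi> \<in> ext Pi"
    and e': "e' x = \<xi>" "\<And>y. y \<noteq> x \<Longrightarrow> e' y = e y"
    and h: "hp e h (push \<xi> (push (ev e' t) \<pi>))"
  shows "hp e (absarg x h t) (push \<xi> \<pi>)"
proof -
  have e'_in: "e' i \<in> ext Lam" for i using e \<xi> e' by (cases "i = x") auto
  show ?thesis
    using h \<pi>
  proof (induction t arbitrary: h \<pi>)
    case (Var y)
    have H: "ev e h \<star> push \<xi> (push (if y = x then \<xi> else e y) \<pi>) \<in> ext pole"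
      by (rule hp_ev) (use Var e \<xi> e' in auto)
    show ?case
    proof (cases "y = x")
      case True
      then show ?thesis
        using pole_step[OF step_W[of "ev e h" \<xi> \<pi>]] H e \<xi> e' Var by simp
    next
      case False
      then show ?thesis
        using pole_step[OF step_C[of "ev e h" "e y" \<xi> \<pi>]] H e \<xi> e' Var by simp
    qed
  next
    case (Cst c)
    have "ev e h \<star> push \<xi> (push (cst c) \<pi>) \<in> ext pole"
      by (rule hp_ev) (use Cst e \<xi> in auto)
    then show ?case
      using pole_step[OF step_C[of "ev e h" "cst c" \<xi> \<pi>]] e \<xi> Cst by simp
  next
    case (App s t)
    let ?s = "ev e' s" and ?t = "ev e' t"
    have st: "?s \<in> ext Lam" "?t \<in> ext Lam" using e'_in by auto
    \<comment> \<open>The execution is traced backwards from h: the handle \<open>B B h\<close>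
      takes s and t separately and reassembles them into one argument behind \<xi>.\<close>
    have "ev e h \<star> push \<xi> (push (app ?s ?t) \<pi>) \<in> ext pole"
      by (rule hp_ev) (use App e \<xi> st in auto)
    then have "app (ev e h) \<xi> \<star> push (app ?s ?t) \<pi> \<in> ext pole"
      using pole_step[OF step_app[of "ev e h" \<xi> "push (app ?s ?t) \<pi>"]] App e \<xi> st by simp
    then have "cB \<star> push (app (ev e h) \<xi>) (push ?s (push ?t \<pi>)) \<in> ext pole"
      using pole_step[OF step_B[of "app (ev e h) \<xi>" ?s ?t \<pi>]] App e \<xi> st by simp
    then have "cB \<star> push cB (push (ev e h) (push \<xi> (push ?s (push ?t \<pi>)))) \<in> ext pole"
      using pole_step[OF step_B[of cB "ev e h" \<xi> "push ?s (push ?t \<pi>)"]] App e \<xi> st by simp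
    then have "hp e (Cst CB \<cdot> Cst CB \<cdot> h) (push \<xi> (push ?s (push ?t \<pi>)))" by simp
    then have "hp e (absarg x (Cst CB \<cdot> Cst CB \<cdot> h) s) (push \<xi> (push ?t \<pi>))"
      using App(1) App(4) st by simp
    then show ?case using App(2) App(4) by simp
  qed

qed

text \<open>The beta rule in the direction that anti-execution allows; the induction descends along
  the head of the body.\<close>

lemma hp_abs:
  assumes e: "\<And>i. e i \<in> ext Lam" and \<xi>: "\<xi> \<in> ext Lam" and \<pi>: "\<pi> \<in> ext Pi"
    and e': "e' x = \<xi>" "\<And>y. y \<noteq> x \<Longrightarrow> e' y = e y"
    and h: "hp e' t \<pi>"
  shows "hp e (abs x t) (push \<xi> \<pi>)"
proof -
  have e'_in: "e' i \<in> ext Lam" for i using e \<xi> e' by (cases "i = x") auto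
  show ?thesis
    using h \<pi>
  proof (induction t arbitrary: \<pi>)
    case (Var y)
    then show ?case
      using pole_step[OF step_I[of \<xi> \<pi>]] pole_step[OF step_K[of "e y" \<xi> \<pi>]] e \<xi> e' by (auto simp: abs.simps)
  next
    case (Cst c)
    then show ?case
      using pole_step[OF step_K[of "cst c" \<xi> \<pi>]] e \<xi> by (simp add: abs.simps)
  next
    case (App s t)
    have "ev e' t \<in> ext Lam" using e'_in by simp
    then have "hp e (abs x s) (push \<xi> (push (ev e' t) \<pi>))"
      using App(1)[OF App(3)[unfolded hp.simps]] App(4) by simp
    then show ?case
      unfolding abs.simps by (intro hp_absarg[where e' = e']) (use e \<xi> App(4) e' in auto)
  qed

qed

section \<open>Truth values of membership\<close>

text \<open>The graph of \<open>push\<close> is coded only over terms and stacks, so the arguments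
  are confined to these sets to obtain a definable relation.\<close>

definition Ppush :: "'m \<Rightarrow> 'm \<Rightarrow> 'm \<Rightarrow> bool" where
  "Ppush \<xi> \<pi> \<rho> \<longleftrightarrow> \<xi> \<in> ext Lam \<and> \<pi> \<in> ext Pi \<and> \<rho> = push \<xi> \<pi>"

definition Ppole :: "'m \<Rightarrow> 'm \<Rightarrow> bool" where
  "Ppole \<xi> \<pi> \<longleftrightarrow> \<xi> \<in> ext Lam \<and> \<pi> \<in> ext Pi \<and> \<xi> \<star> \<pi> \<in> ext pole"

lemma Dfn_Ppush[dfn]:
  assumes "Tm s" "Tm t" "Tm u" shows "Dfn (\<lambda>v. Ppush (s v) (t v) (u v))"
proof -
  obtain g where g: "ext g = {opair (opair x y) (push x y) | x y. x \<in> ext Lam \<and> y \<in> ext Pi}"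
    using push unfolding internal_op2_def coded_def by blast
  have "Ppush x y z \<longleftrightarrow> opair (opair x y) z \<in> ext g" for x y z unfolding Ppush_def g by auto
  then show ?thesis by simp (intro dfn assms)
qed

lemma Dfn_Ppole[dfn]:
  assumes "Tm s" "Tm t" shows "Dfn (\<lambda>v. Ppole (s v) (t v))"
proof -
  obtain g where g: "ext g = {opair (opair x y) (x \<star> y) | x y. x \<in> ext Lam \<and> y \<in> ext Pi}"
    using proc unfolding internal_op2_def coded_def by blast
  have "Ppole x y \<longleftrightarrow> (\<exists>z \<in> ext pole. opair (opair x y) z \<in> ext g)" for x y
    unfolding Ppole_def g by auto
  moreover have "Dfn (\<lambda>v. \<exists>z \<in> ext pole. opair (opair (v 0) (v 1)) z \<in> ext g)" by (intro dfn)
  ultimately show ?thesis using Dfn2[of Ppole] assms by simp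
qed

lemma forces_iff: "X \<subseteq> ext Pi \<Longrightarrow> \<xi> \<tturnstile> X \<longleftrightarrow> \<xi> \<in> ext Lam \<and> (\<forall>\<pi>. \<pi> \<in> X \<longrightarrow> Ppole \<xi> \<pi>)"
  unfolding forces_def Ppole_def by blast

lemma slice_Pi: "slice S a b \<subseteq> ext Pi"
  unfolding slice_def by blast

lemma Dfn_slice[dfn]:
  "Tm r \<Longrightarrow> Tm s \<Longrightarrow> Tm t \<Longrightarrow> Tm u \<Longrightarrow> Dfn (\<lambda>v. r v \<in> slice (s v) (t v) (u v))"
  by (rule Dfn4[of "\<lambda>r s t u. r \<in> slice s t u"]) (unfold slice_def mem_Collect_eq, intro dfn)

lemma Dfn_forces_slice[dfn]:
  "Tm r \<Longrightarrow> Tm s \<Longrightarrow> Tm t \<Longrightarrow> Tm u \<Longrightarrow> Dfn (\<lambda>v. r v \<tturnstile> slice (s v) (t v) (u v))"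
  by (rule Dfn4[of "\<lambda>r s t u. r \<tturnstile> slice s t u"]) (unfold forces_iff[OF slice_Pi], intro dfn)

section \<open>The recursive clauses for inclusion and membership\<close>

definition next_Sub :: "('m \<Rightarrow> 'm \<Rightarrow> 'm set) \<Rightarrow> 'm \<Rightarrow> 'm \<Rightarrow> 'm set" where
  "next_Sub N a b = {push \<xi> \<pi> | c \<xi> \<pi>. \<pi> \<in> ext Pi \<and> opair c \<pi> \<in> ext a \<and> \<xi> \<tturnstile> N c b}"

definition next_NotIn :: "('m \<Rightarrow> 'm \<Rightarrow> 'm set) \<Rightarrow> 'm \<Rightarrow> 'm \<Rightarrow> 'm set" where
  "next_NotIn S a b = {push \<xi> (push \<xi>' \<pi>) | c \<xi> \<xi>' \<pi>. \<pi> \<in> ext Pi \<and> opair c \<pi> \<in> ext b \<and>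
     \<xi> \<tturnstile> S a c \<and> \<xi>' \<tturnstile> S c a}"

lemma approximation_iff: "approximation T S N \<longleftrightarrow>
    (\<forall>b \<in> ext T. \<forall>c. \<forall>\<pi> \<in> ext Pi. opair c \<pi> \<in> ext b \<longrightarrow> c \<in> ext T) \<and>
    (\<forall>a \<in> ext T. \<forall>b \<in> ext T. slice S a b = next_Sub (slice N) a b \<and> slice N a b = next_NotIn (slice S) a b)"
  unfolding approximation_def next_Sub_def next_NotIn_def ..

lemma forces_Lam: "\<xi> \<tturnstile> X \<Longrightarrow> \<xi> \<in> ext Lam"
  unfolding forces_def by blast

lemma in_next_Sub: "\<rho> \<in> next_Sub N a b \<longleftrightarrow>
    (\<exists>c \<xi> \<pi>. Ppush \<xi> \<pi> \<rho> \<and> opair c \<pi> \<in> ext a \<and> \<xi> \<tturnstile> N c b)"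
  unfolding next_Sub_def Ppush_def mem_Collect_eq using forces_Lam by blast

lemma in_next_NotIn: "\<tau> \<in> next_NotIn S a b \<longleftrightarrow>
    (\<exists>c \<xi> \<xi>' \<pi> \<sigma>. Ppush \<xi>' \<pi> \<sigma> \<and> Ppush \<xi> \<sigma> \<tau> \<and> opair c \<pi> \<in> ext b \<and> \<xi> \<tturnstile> S a c \<and> \<xi>' \<tturnstile> S c a)"
  unfolding next_NotIn_def Ppush_def mem_Collect_eq using forces_Lam push_in by blast

lemma next_Sub_Pi: "next_Sub N a b \<subseteq> ext Pi"
  unfolding next_Sub_def by (auto dest: forces_Lam)

lemma next_NotIn_Pi: "next_NotIn S a b \<subseteq> ext Pi"
  unfolding next_NotIn_def by clarsimp (meson forces_Lam push_in)

lemma Dfn_next_Sub[dfn]: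
  "Tm r \<Longrightarrow> Tm s \<Longrightarrow> Tm t \<Longrightarrow> Tm u \<Longrightarrow> Dfn (\<lambda>v. r v \<in> next_Sub (slice (s v)) (t v) (u v))"
  by (rule Dfn4[of "\<lambda>r s t u. r \<in> next_Sub (slice s) t u"]) (unfold in_next_Sub, intro dfn)

lemma Dfn_next_NotIn[dfn]:
  "Tm r \<Longrightarrow> Tm s \<Longrightarrow> Tm t \<Longrightarrow> Tm u \<Longrightarrow> Dfn (\<lambda>v. r v \<in> next_NotIn (slice (s v)) (t v) (u v))"
  by (rule Dfn4[of "\<lambda>r s t u. r \<in> next_NotIn (slice s) t u"]) (unfold in_next_NotIn, intro dfn)

lemma Dfn_approximation[dfn]:
  "Tm s \<Longrightarrow> Tm t \<Longrightarrow> Tm u \<Longrightarrow> Dfn (\<lambda>v. approximation (s v) (t v) (u v))"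
  by (rule Dfn3[of approximation]) (unfold approximation_iff set_eq_iff, intro dfn)

lemma Dfn_tv_Sub[dfn]: "Tm r \<Longrightarrow> Tm s \<Longrightarrow> Tm t \<Longrightarrow> Dfn (\<lambda>v. r v \<in> tv_Sub (s v) (t v))"
  by (rule Dfn3[of "\<lambda>r s t. r \<in> tv_Sub s t"]) (unfold tv_Sub_def mem_Collect_eq, intro dfn)

lemma tv_Sub_Pi: "tv_Sub a b \<subseteq> ext Pi" and tv_NotIn_Pi: "tv_NotIn a b \<subseteq> ext Pi"
  unfolding tv_Sub_def tv_NotIn_def slice_def by auto

text \<open>The names occurring in \<open>a\<close> lie three levels below \<open>a\<close> for the membership of the ground model.\<close>

lemma name_induct:
  assumes P: "Dfn (\<lambda>v. P (v 0))" and step: "\<And>a. (\<And>c \<pi>. opair c \<pi> \<in> ext a \<Longrightarrow> P c) \<Longrightarrow> P a"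
  shows "P a"
proof -
  let ?Q = "\<lambda>x. P x \<and> (\<forall>y \<in> ext x. P y) \<and> (\<forall>y \<in> ext x. \<forall>z \<in> ext y. P z)"
  have "Dfn (\<lambda>v. ?Q (v 0))" by (intro dfn Dfn1[OF P])
  then have "?Q a"
  proof (rule eps_induct)
    fix x assume IH: "\<And>y. y \<in> ext x \<Longrightarrow> ?Q y"
    have "P c" if c: "opair c \<pi> \<in> ext x" for c \<pi>
    proof -
      have "setof {c} \<in> ext (opair c \<pi>)" "c \<in> ext (setof {c})" by (simp_all add: ext_opair ext_setof)
      with IH[OF c] show ?thesis by blast
    qed
    then have "P x" by (rule step)
    with IH show "?Q x" by blast
  qed
  then show ?thesis by blast
qed

text \<open>Two unfoldings lead from the pair (a, b) to pairs formed of a name c in a and a name d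
  in b. Induction on a alone therefore suffices if both orders of the arguments are carried
  along.\<close>

lemma approximation_unique:
  assumes A: "approximation T S N" "approximation T' S' N'"
    and ab: "a \<in> ext T" "a \<in> ext T'" "b \<in> ext T" "b \<in> ext T'"
  shows "slice S a b = slice S' a b" "slice N a b = slice N' a b"
proof -
  note A1 = A(1)[unfolded approximation_iff] and A2 = A(2)[unfolded approximation_iff]
  have NI: "next_NotIn (slice S) a b = next_NotIn (slice S') a b"
    if "\<And>c \<pi>. \<pi> \<in> ext Pi \<Longrightarrow> opair c \<pi> \<in> ext b \<Longrightarrow> slice S a c = slice S' a c \<and> slice S c a = slice S' c a" for a b
    unfolding next_NotIn_def using that by (intro Collect_cong) (metis (lifting))
  have SU: "next_Sub (slice N) a b = next_Sub (slice N') a b"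
    if "\<And>c \<pi>. \<pi> \<in> ext Pi \<Longrightarrow> opair c \<pi> \<in> ext a \<Longrightarrow> slice N c b = slice N' c b" for a b
    unfolding next_Sub_def using that by (intro Collect_cong) (metis (lifting))
  let ?P = "\<lambda>a. \<forall>b. a \<in> ext T \<and> a \<in> ext T' \<and> b \<in> ext T \<and> b \<in> ext T' \<longrightarrow>
    (\<forall>\<rho>. \<rho> \<in> slice S a b \<longleftrightarrow> \<rho> \<in> slice S' a b) \<and> (\<forall>\<rho>. \<rho> \<in> slice S b a \<longleftrightarrow> \<rho> \<in> slice S' b a)"
  have "Dfn (\<lambda>v. ?P (v 0))" by (intro dfn)
  then have P: "?P a" for a
  proof (rule name_induct)
    fix a assume IH: "\<And>c \<pi>. opair c \<pi> \<in> ext a \<Longrightarrow> ?P c"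
    show "?P a"
    proof (intro allI impI, elim conjE)
      fix b assume ab: "a \<in> ext T" "a \<in> ext T'" "b \<in> ext T" "b \<in> ext T'"
      have cT: "c \<in> ext T \<and> c \<in> ext T'" if "\<pi> \<in> ext Pi" "opair c \<pi> \<in> ext a \<or> opair c \<pi> \<in> ext b" for c \<pi>
        using that A1 A2 ab by blast
      have S: "slice S c d = slice S' c d \<and> slice S d c = slice S' d c"
        if "\<pi> \<in> ext Pi" "opair c \<pi> \<in> ext a" "\<pi>' \<in> ext Pi" "opair d \<pi>' \<in> ext b" for c d \<pi> \<pi>'
        using IH[OF that(2)] cT[of \<pi> c] cT[of \<pi>' d] that unfolding set_eq_iff by blast
      have N: "slice N c b = slice N' c b" if "\<pi> \<in> ext Pi" "opair c \<pi> \<in> ext a" for c \<pi>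
        using A1 A2 ab cT[OF that(1)] that NI[of b c] S[OF that] by metis
      have N': "slice N d a = slice N' d a" if "\<pi> \<in> ext Pi" "opair d \<pi> \<in> ext b" for d \<pi>
        using A1 A2 ab cT[OF that(1)] that NI[of a d] S[OF _ _ that] by metis
      have "slice S a b = slice S' a b" using A1 A2 ab SU[of a b] N by metis
      moreover have "slice S b a = slice S' b a" using A1 A2 ab SU[of b a] N' by metis
      ultimately show "(\<forall>\<rho>. \<rho> \<in> slice S a b \<longleftrightarrow> \<rho> \<in> slice S' a b) \<and> (\<forall>\<rho>. \<rho> \<in> slice S b a \<longleftrightarrow> \<rho> \<in> slice S' b a)"
        by simp
    qed
  qed
  show "slice S a b = slice S' a b" using P[of a] ab by blast
  have "slice S a c = slice S' a c \<and> slice S c a = slice S' c a" if "\<pi> \<in> ext Pi" "opair c \<pi> \<in> ext b" for c \<pi>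
    using P[of a] ab that A1 A2 unfolding set_eq_iff by blast
  then show "slice N a b = slice N' a b" using A1 A2 ab NI[of b a] by metis
qed

text \<open>The truth value of \<open>\<subset>\<close> depends antitonically on that of \<open>\<notin>\<close> and vice versa, so the
  recursion can be solved by a least fixed point.\<close>

lemma approximation_exists: "\<exists>T S N. approximation T S N \<and> a \<in> ext T \<and> b \<in> ext T"
proof -
  obtain T where T: "transitive_set T" "setof {a, b} \<in> ext T" using transitive_superset by blast
  have "ext (setof {a, b}) \<subseteq> ext T" using T unfolding transitive_set_def by blast
  then have ab: "a \<in> ext T" "b \<in> ext T" by (simp_all add: ext_setof)
  have names: "c \<in> ext T" if "b \<in> ext T" "opair c \<pi> \<in> ext b" for b c \<pi>
  proof -
    have "setof {c} \<in> ext (opair c \<pi>)" "c \<in> ext (setof {c})" by (simp_all add: ext_opair ext_setof)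
    then show ?thesis using T(1) that unfolding transitive_set_def by blast
  qed
  define \<Phi> where "\<Phi> Y p \<longleftrightarrow> (\<exists>a b \<rho>. p = opair (opair a b) \<rho> \<and> (\<exists>c \<xi> \<pi>. Ppush \<xi> \<pi> \<rho> \<and> opair c \<pi> \<in> ext a \<and>
    (\<forall>\<tau>. \<tau> \<in> next_NotIn (slice Y) c b \<longrightarrow> Ppole \<xi> \<tau>)))" for Y p
  have D: "Dfn (\<lambda>v. \<Phi> (v 0) (v 1))" unfolding \<Phi>_def by (intro dfn)
  have forces_anti: "\<xi> \<tturnstile> slice Y a b" if "\<xi> \<tturnstile> slice Y' a b" "ext Y \<subseteq> ext Y'" for \<xi> Y Y' a b
    using that unfolding forces_def slice_def by blast
  have "next_NotIn (slice Y') c b \<subseteq> next_NotIn (slice Y) c b" if "ext Y \<subseteq> ext Y'" for Y Y' c b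
    unfolding next_NotIn_def using forces_anti[OF _ that] by blast
  then have mono: "\<forall>Y Y' x. ext Y \<subseteq> ext Y' \<longrightarrow> \<Phi> Y x \<longrightarrow> \<Phi> Y' x"
    unfolding \<Phi>_def by (intro allI impI) (elim exE conjE, intro exI conjI, assumption+, blast)
  define U where "U = cart (cart T T) Pi"
  define S where "S = lfix U \<Phi>"
  have S: "p \<in> ext S \<longleftrightarrow> p \<in> ext U \<and> \<Phi> S p" for p
    unfolding S_def by (rule lfix_unfold[OF D mono])
  \<comment> \<open>Only inclusion is solved for; the other truth value results from it by one
    unfolding.\<close>
  define N where "N = setof {p \<in> ext U. \<exists>a b \<tau>. p = opair (opair a b) \<tau> \<and> \<tau> \<in> next_NotIn (slice S) a b}"
  have N: "ext N = {p \<in> ext U. \<exists>a b \<tau>. p = opair (opair a b) \<tau> \<and> \<tau> \<in> next_NotIn (slice S) a b}"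
    unfolding N_def by (intro ext_setof coded_sep dfn)
  have slice_N: "slice N a b = next_NotIn (slice S) a b" if "a \<in> ext T" "b \<in> ext T" for a b
    unfolding slice_def[of N] N U_def using that next_NotIn_Pi[of "slice S" a b] by auto
  have slice_S: "slice S a b = next_Sub (slice N) a b" if "a \<in> ext T" "b \<in> ext T" for a b
  proof -
    have "\<rho> \<in> slice S a b \<longleftrightarrow> \<rho> \<in> ext Pi \<and> (\<exists>c \<xi> \<pi>. Ppush \<xi> \<pi> \<rho> \<and> opair c \<pi> \<in> ext a \<and>
        (\<forall>\<tau>. \<tau> \<in> next_NotIn (slice S) c b \<longrightarrow> Ppole \<xi> \<tau>))" for \<rho>
      using S[of "opair (opair a b) \<rho>"] that unfolding slice_def[of S a b]
      by (simp add: \<Phi>_def U_def)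
    also have "\<dots> \<rho> \<longleftrightarrow> \<rho> \<in> next_Sub (slice N) a b" for \<rho>
    proof -
      have "\<xi> \<tturnstile> slice N c b \<longleftrightarrow> (\<forall>\<tau>. \<tau> \<in> next_NotIn (slice S) c b \<longrightarrow> Ppole \<xi> \<tau>)"
        if "opair c \<pi> \<in> ext a" "Ppush \<xi> \<pi> \<rho>" for c \<pi> \<xi>
        using slice_N[OF names[OF \<open>a \<in> ext T\<close> that(1)] \<open>b \<in> ext T\<close>] forces_iff[OF slice_Pi, of \<xi> N c b] that(2)
        unfolding Ppush_def by simp
      then show ?thesis using next_Sub_Pi[of "slice N" a b] unfolding in_next_Sub by (metis Ppush_def push_in)
    qed
    finally show ?thesis by blast
  qed
  have "approximation T S N"
    unfolding approximation_iff using names slice_N slice_S by blast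
  with ab show ?thesis by blast
qed

lemma tv_approximation:
  assumes "approximation T S N" "a \<in> ext T" "b \<in> ext T"
  shows "tv_Sub a b = slice S a b" "tv_NotIn a b = slice N a b"
proof -
  show "tv_Sub a b = slice S a b"
    unfolding tv_Sub_def using approximation_unique(1)[OF assms(1)] assms by fast
  show "tv_NotIn a b = slice N a b"
    unfolding tv_NotIn_def using approximation_unique(2)[OF assms(1)] assms by fast
qed

text \<open>With the recursion solved, inclusion behaves like an ordinary quantified implication, to
  which typing rules apply.\<close>

lemma tv_Sub_eq: "tv (Sub a b) = tv (\<^bold>\<forall>c. NotIn c b \<^bold>\<rightarrow> NotEps c a)"
proof -
  obtain T S N where A: "approximation T S N" and ab: "a \<in> ext T" "b \<in> ext T"
    using approximation_exists by blast
  have c: "c \<in> ext T" if "opair c \<pi> \<in> ext a" "\<pi> \<in> ext Pi" for c \<pi>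
    using A that ab unfolding approximation_iff by blast
  have "tv_Sub a b = next_Sub (slice N) a b"
    using tv_approximation(1)[OF A ab] A ab unfolding approximation_iff by blast
  also have "\<dots> = next_Sub tv_NotIn a b"
    unfolding next_Sub_def using tv_approximation(2)[OF A c ab(2)] by (intro Collect_cong) metis
  also have "\<dots> = tv (\<^bold>\<forall>c. NotIn c b \<^bold>\<rightarrow> NotEps c a)"
    unfolding next_Sub_def by auto
  finally show ?thesis by simp
qed

lemma tv_NotIn_eq: "tv (NotIn a b) = tv (\<^bold>\<forall>c. Sub a c \<^bold>\<rightarrow> Sub c a \<^bold>\<rightarrow> NotEps c b)"
proof -
  obtain T S N where A: "approximation T S N" and ab: "a \<in> ext T" "b \<in> ext T"
    using approximation_exists by blast
  have c: "c \<in> ext T" if "opair c \<pi> \<in> ext b" "\<pi> \<in> ext Pi" for c \<pi>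
    using A that ab unfolding approximation_iff by blast
  have "tv_NotIn a b = next_NotIn (slice S) a b"
    using tv_approximation(2)[OF A ab] A ab unfolding approximation_iff by blast
  also have "\<dots> = next_NotIn tv_Sub a b"
    unfolding next_NotIn_def using tv_approximation(1)[OF A ab(1) c] tv_approximation(1)[OF A c ab(1)]
    by (intro Collect_cong) metis
  also have "\<dots> = tv (\<^bold>\<forall>c. Sub a c \<^bold>\<rightarrow> Sub c a \<^bold>\<rightarrow> NotEps c b)"
    unfolding next_NotIn_def by (simp add: set_eq_iff) blast
  finally show ?thesis by simp
qed

lemma tv_Pi: "tv F \<subseteq> ext Pi"
proof (induction F)
  case (Imp A B)
  then show ?case using forces_Lam push_in by auto
qed (use tv_Sub_Pi tv_NotIn_Pi in auto)

end

section \<open>Typing rules\<close>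

definition self :: trm where
  "self = Var 0 \<cdot> Var 0"

text \<open>With \<open>abs 0 rfl_body\<close> in variable 0, \<open>self\<close> denotes
  \<open>rfl\<close>. Variable 1 realizes c \<notin> a for a name c in a, and is fed with c
  \<subset> c twice by recursive calls.\<close>

definition rfl_body :: trm where
  "rfl_body = abs 1 (Var 1 \<cdot> self \<cdot> self)"

definition rfl :: trm where
  "rfl = abs 0 rfl_body \<cdot> abs 0 rfl_body"

text \<open>Variables 1, 2, 3 realize a \<subset> b, b \<subset> c and d \<notin> c. Variables 4, 5
  hold d \<subset> x and x \<subset> d with x in b, variables 6, 7 hold x \<subset> g and g
  \<subset> x with g in c; the recursive calls compose them to d \<subset> g and g \<subset>
  d.\<close>

definition trs_body :: trm where
  "trs_body = abs 1 (abs 2 (abs 3 (Var 1 \<cdot> abs 4 (abs 5 (Var 2 \<cdot> abs 6 (abs 7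
     (Var 3 \<cdot> (self \<cdot> Var 4 \<cdot> Var 6) \<cdot> (self \<cdot> Var 7 \<cdot> Var 5))))))))"

definition trs :: trm where
  "trs = abs 0 trs_body \<cdot> abs 0 trs_body"

lemma fv_rfl: "fv rfl = {}" and fv_trs: "fv trs = {}"
  unfolding rfl_def rfl_body_def trs_def trs_body_def self_def by auto

context realizability_algebra
begin

text \<open>The pole is closed under anti-execution only: the process of an application may be in it
  while the unwound process is not. Abstraction needs the unwound one, hence
  \<open>hp\<close>.\<close>

definition ty :: "(nat \<Rightarrow> 'm) \<Rightarrow> trm \<Rightarrow> 'm rfm \<Rightarrow> bool" where
  "ty e t F \<longleftrightarrow> (\<forall>i. e i \<in> ext Lam) \<longrightarrow> (\<forall>\<pi> \<in> tv F. hp e t \<pi>)"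

text \<open>The weaker judgement \<open>tyv\<close> suffices for terms in argument position.\<close>

definition tyv :: "(nat \<Rightarrow> 'm) \<Rightarrow> trm \<Rightarrow> 'm rfm \<Rightarrow> bool" where
  "tyv e t F \<longleftrightarrow> (\<forall>i. e i \<in> ext Lam) \<longrightarrow> ev e t \<tturnstile> tv F"

lemma tv_in_Pi: "\<pi> \<in> tv F \<Longrightarrow> \<pi> \<in> ext Pi"
  using tv_Pi by blast

lemma ty_tyv: "ty e t F \<Longrightarrow> tyv e t F"
  unfolding ty_def tyv_def forces_def using hp_ev[of e _ t] tv_in_Pi ev_in[of e t] by blast

lemma ty_var: "e x \<tturnstile> tv F \<Longrightarrow> ty e (Var x) F"
  unfolding ty_def forces_def by simp

lemma tyv_var: "e x \<tturnstile> tv F \<Longrightarrow> tyv e (Var x) F"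
  by (rule ty_tyv[OF ty_var])

lemma ty_app: "ty e s (A \<^bold>\<rightarrow> B) \<Longrightarrow> tyv e t A \<Longrightarrow> ty e (s \<cdot> t) B"
  unfolding ty_def tyv_def by auto

lemma forces_app:
  assumes "\<xi> \<tturnstile> tv (A \<^bold>\<rightarrow> B)" "\<eta> \<tturnstile> tv A" shows "app \<xi> \<eta> \<tturnstile> tv B"
proof -
  have L: "\<xi> \<in> ext Lam" "\<eta> \<in> ext Lam" using assms forces_Lam by auto
  have "app \<xi> \<eta> \<star> \<pi> \<in> ext pole" if "\<pi> \<in> tv B" for \<pi>
  proof (rule pole_step[OF step_app[OF L]])
    show "\<xi> \<star> push \<eta> \<pi> \<in> ext pole" using assms that unfolding forces_def[of \<xi>] by auto
  qed (use L tv_in_Pi[OF that] in auto)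
  then show ?thesis using L unfolding forces_def by auto
qed

lemma tyv_app: "tyv e s (A \<^bold>\<rightarrow> B) \<Longrightarrow> tyv e t A \<Longrightarrow> tyv e (s \<cdot> t) B"
  unfolding tyv_def using forces_app by auto

lemma ty_abs:
  assumes "\<And>\<xi>. \<xi> \<tturnstile> tv A \<Longrightarrow> ty (e(x := \<xi>)) t B" shows "ty e (abs x t) (A \<^bold>\<rightarrow> B)"
  unfolding ty_def
proof (intro impI ballI)
  fix \<rho> assume e: "\<forall>i. e i \<in> ext Lam" and "\<rho> \<in> tv (A \<^bold>\<rightarrow> B)"
  then obtain \<xi> \<pi> where \<rho>: "\<rho> = push \<xi> \<pi>" "\<xi> \<tturnstile> tv A" "\<pi> \<in> tv B" by auto
  have "\<xi> \<in> ext Lam" using \<rho>(2) forces_Lam by blast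
  moreover from this have "hp (e(x := \<xi>)) t \<pi>"
    using assms[OF \<rho>(2)] e \<rho>(3) unfolding ty_def by simp
  ultimately show "hp e (abs x t) \<rho>"
    unfolding \<rho>(1) using e tv_in_Pi[OF \<rho>(3)] by (intro hp_abs[where e' = "e(x := \<xi>)"]) auto
qed

lemma tyv_abs: "(\<And>\<xi>. \<xi> \<tturnstile> tv A \<Longrightarrow> ty (e(x := \<xi>)) t B) \<Longrightarrow> tyv e (abs x t) (A \<^bold>\<rightarrow> B)"
  by (rule ty_tyv[OF ty_abs])

lemma ty_all: "(\<And>a. ty e t (A a)) \<Longrightarrow> ty e t (All A)"
  unfolding ty_def by auto

lemma forces_mono: "\<xi> \<tturnstile> X \<Longrightarrow> Y \<subseteq> X \<Longrightarrow> \<xi> \<tturnstile> Y"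
  unfolding forces_def by blast

lemma forces_All: "\<xi> \<tturnstile> tv (All A) \<Longrightarrow> \<xi> \<tturnstile> tv (A a)"
  by (erule forces_mono) auto

lemma ty_mono: "ty e t A \<Longrightarrow> tv B \<subseteq> tv A \<Longrightarrow> ty e t B"
  unfolding ty_def by blast

lemma tyv_mono: "tyv e t A \<Longrightarrow> tv B \<subseteq> tv A \<Longrightarrow> tyv e t B"
  unfolding tyv_def using forces_mono by blast

section \<open>Classical logic and the encoded connectives\<close>

lemma tv_Bot: "tv F \<subseteq> tv Bot"
  using tv_Pi by simp

lemma ty_Bot: "ty e t Bot \<Longrightarrow> ty e t F"
  using ty_mono tv_Bot by blast

text \<open>Peirce's law: for a stack \<pi> in the truth value of A, the continuation of \<pi>
  realizes A \<rightarrow> B, since it passes any realizer of A to \<pi>.\<close>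

lemma ty_callcc: "ty e (Cst CCc) (((A \<^bold>\<rightarrow> B) \<^bold>\<rightarrow> A) \<^bold>\<rightarrow> A)"
  unfolding ty_def
proof (intro impI ballI)
  fix \<rho> assume "\<rho> \<in> tv (((A \<^bold>\<rightarrow> B) \<^bold>\<rightarrow> A) \<^bold>\<rightarrow> A)"
  then obtain \<xi> \<pi> where \<rho>: "\<rho> = push \<xi> \<pi>" "\<xi> \<tturnstile> tv ((A \<^bold>\<rightarrow> B) \<^bold>\<rightarrow> A)" "\<pi> \<in> tv A" by auto
  have L: "\<xi> \<in> ext Lam" "\<pi> \<in> ext Pi" using \<rho> forces_Lam tv_in_Pi by auto
  have "cont \<pi> \<star> push \<eta> \<sigma> \<in> ext pole" if "\<eta> \<tturnstile> tv A" "\<sigma> \<in> tv B" for \<eta> \<sigma>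
  proof -
    have "\<eta> \<star> \<pi> \<in> ext pole" "\<eta> \<in> ext Lam" "\<sigma> \<in> ext Pi"
      using that \<rho>(3) forces_Lam tv_in_Pi unfolding forces_def by auto
    then show ?thesis using pole_step[OF step_cont[of \<eta> \<pi> \<sigma>]] L by simp
  qed
  then have "cont \<pi> \<tturnstile> tv (A \<^bold>\<rightarrow> B)" using L unfolding forces_def[of "cont \<pi>"] by auto
  then have "\<xi> \<star> push (cont \<pi>) \<pi> \<in> ext pole" using \<rho> unfolding forces_def[of \<xi>] by auto
  then show "hp e (Cst CCc) \<rho>" using pole_step[OF step_cc[OF L]] L \<rho>(1) by simp
qed

text \<open>Peirce's law with B = \<open>Bot\<close>. Ex falso costs no term because the truth value
  of \<open>Bot\<close> contains all others.\<close>

lemma ty_by_contradiction: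
  assumes "\<And>\<xi>. \<xi> \<tturnstile> tv (Neg A) \<Longrightarrow> ty (e(x := \<xi>)) t Bot" shows "ty e (Cst CCc \<cdot> abs x t) A"
  by (rule ty_app[OF ty_callcc tyv_abs]) (rule ty_Bot, rule assms)

lemma ty_conjI:
  assumes "\<And>\<xi>. tyv (e(x := \<xi>)) s A" "\<And>\<xi>. tyv (e(x := \<xi>)) t B"
  shows "ty e (abs x (Var x \<cdot> s \<cdot> t)) (A \<^bold>\<and> B)"
  unfolding Conj_def by (rule ty_abs) (rule ty_app[OF ty_app], rule ty_var, simp, (rule assms)+)

text \<open>The encoded conjunction is a negation, so the goal has to be reduced to
  \<open>Bot\<close> before such a hypothesis can be opened; \<open>ty_exE\<close> is alike.\<close>

lemma ty_conjE:
  assumes "ty e s (A \<^bold>\<and> B)"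
    "\<And>\<xi> \<eta>. \<xi> \<tturnstile> tv A \<Longrightarrow> \<eta> \<tturnstile> tv B \<Longrightarrow> ty (e(x := \<xi>, y := \<eta>)) t Bot"
  shows "ty e (s \<cdot> abs x (abs y t)) Bot"
  by (rule ty_app[OF assms(1)[unfolded Conj_def]]) (rule tyv_abs, rule ty_abs, rule assms(2))

lemma ty_exE:
  assumes "ty e s (Ex A)" "\<And>a \<xi>. \<xi> \<tturnstile> tv (A a) \<Longrightarrow> ty (e(x := \<xi>)) t Bot"
  shows "ty e (s \<cdot> abs x t) Bot"
  by (rule ty_app[OF assms(1)[unfolded Ex_def]]) (rule ty_tyv, rule ty_all, rule ty_abs, rule assms(2))

lemma ty_SubI: "(\<And>c. ty e t (NotIn c b \<^bold>\<rightarrow> NotEps c a)) \<Longrightarrow> ty e t (Sub a b)"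
  by (rule ty_mono[OF ty_all[where A = "\<lambda>c. NotIn c b \<^bold>\<rightarrow> NotEps c a"]]) (auto simp only: tv_Sub_eq)

lemma ty_NotInI: "(\<And>c. ty e t (Sub a c \<^bold>\<rightarrow> Sub c a \<^bold>\<rightarrow> NotEps c b)) \<Longrightarrow> ty e t (NotIn a b)"
  by (rule ty_mono[OF ty_all[where A = "\<lambda>c. Sub a c \<^bold>\<rightarrow> Sub c a \<^bold>\<rightarrow> NotEps c b"]]) (auto simp only: tv_NotIn_eq)

lemma forces_SubD: "\<xi> \<tturnstile> tv (Sub a b) \<Longrightarrow> \<xi> \<tturnstile> tv (NotIn c b \<^bold>\<rightarrow> NotEps c a)"
  unfolding tv_Sub_eq by (rule forces_All)

lemma forces_NotInD: "\<xi> \<tturnstile> tv (NotIn a b) \<Longrightarrow> \<xi> \<tturnstile> tv (Sub a c \<^bold>\<rightarrow> Sub c a \<^bold>\<rightarrow> NotEps c b)"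
  unfolding tv_NotIn_eq by (rule forces_All)

subsection \<open>Inclusion is a preorder\<close>

text \<open>With the abstraction in variable 0, \<open>self\<close> evaluates to the very term being
  typed. What may be assumed of it is left to an induction on names.\<close>

lemma self_application:
  assumes "ty (e(0 := ev e (abs 0 t))) t F" shows "tyv e (abs 0 t \<cdot> abs 0 t) F"
proof (rule ty_tyv, unfold ty_def, intro impI ballI)
  fix \<pi> assume e: "\<forall>i. e i \<in> ext Lam" and \<pi>: "\<pi> \<in> tv F"
  then have "hp (e(0 := ev e (abs 0 t))) t \<pi>" using assms unfolding ty_def by simp
  then show "hp e (abs 0 t \<cdot> abs 0 t) \<pi>"
    using e tv_in_Pi[OF \<pi>] by (simp, intro hp_abs[where e' = "e(0 := ev e (abs 0 t))"]) auto
qed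

lemma tv_NotEps_name: "tv (NotEps c a) \<noteq> {} \<Longrightarrow> \<exists>\<pi>. opair c \<pi> \<in> ext a"
  by auto

lemma ty_empty: "tv F = {} \<Longrightarrow> ty e t F"
  unfolding ty_def by simp

lemma Dfn_forces_Sub:
  assumes "\<xi> \<in> ext Lam"
  shows "Tm s \<Longrightarrow> Tm t \<Longrightarrow> Dfn (\<lambda>v. \<xi> \<tturnstile> tv (Sub (s v) (t v)))"
  by (rule Dfn2[of "\<lambda>s t. \<xi> \<tturnstile> tv (Sub s t)"]) (unfold tv.simps forces_iff[OF tv_Sub_Pi], intro dfn)

lemma tyv_rfl: "tyv e rfl (Sub a a)"
proof (cases "\<forall>i. e i \<in> ext Lam")
  case True
  define \<theta> where "\<theta> = ev e rfl"
  have \<theta>: "\<theta> \<in> ext Lam" unfolding \<theta>_def using True by simp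
  have "Dfn (\<lambda>v. \<theta> \<tturnstile> tv (Sub (v 0) (v 0)))" by (intro dfn Dfn_forces_Sub \<theta>)
  then have "\<theta> \<tturnstile> tv (Sub a a)"
  proof (rule name_induct)
    fix a assume IH: "\<And>c \<pi>. opair c \<pi> \<in> ext a \<Longrightarrow> \<theta> \<tturnstile> tv (Sub c c)"
    have "tyv e rfl (Sub a a)"
      unfolding rfl_def
    proof (rule self_application)
      define e' where "e' = e(0 := ev e (abs 0 rfl_body))"
      have self: "tyv (e'(1 := \<xi>)) self F" if "\<theta> \<tturnstile> tv F" for \<xi> F
        using that unfolding tyv_def self_def \<theta>_def rfl_def e'_def by simp
      have "ty e' rfl_body (Sub a a)"
        unfolding rfl_body_def
      proof (rule ty_SubI, rule ty_abs)
        fix c \<xi> assume \<xi>: "\<xi> \<tturnstile> tv (NotIn c a)"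
        \<comment> \<open>Either the truth value is empty and any term realizes it, or c is a name
          in a and the induction hypothesis covers the recursive calls.\<close>
        show "ty (e'(1 := \<xi>)) (Var 1 \<cdot> self \<cdot> self) (NotEps c a)"
        proof (cases "tv (NotEps c a) = {}")
          case False
          then have c: "\<theta> \<tturnstile> tv (Sub c c)" using IH tv_NotEps_name by blast
          have "ty (e'(1 := \<xi>)) (Var 1) (Sub c c \<^bold>\<rightarrow> Sub c c \<^bold>\<rightarrow> NotEps c a)"
            by (rule ty_var) (use forces_NotInD[OF \<xi>] in simp)
          then show ?thesis using ty_app self[OF c] by blast
        qed (rule ty_empty)
      qed
      then show "ty (e(0 := ev e (abs 0 rfl_body))) rfl_body (Sub a a)" unfolding e'_def .
    qed
    then show "\<theta> \<tturnstile> tv (Sub a a)" unfolding tyv_def \<theta>_def using True by blast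
  qed
  then show ?thesis unfolding tyv_def \<theta>_def by blast
qed (auto simp: tyv_def)

lemma tyv_trs: "tyv e trs (Sub a b \<^bold>\<rightarrow> Sub b c \<^bold>\<rightarrow> Sub a c)"
proof (cases "\<forall>i. e i \<in> ext Lam")
  case True
  define \<theta> where "\<theta> = ev e trs"
  have \<theta>: "\<theta> \<in> ext Lam" unfolding \<theta>_def using True by simp
  define R where "R a b c \<longleftrightarrow> \<theta> \<tturnstile> tv (Sub a b \<^bold>\<rightarrow> Sub b c \<^bold>\<rightarrow> Sub a c)" for a b c
  \<comment> \<open>Expressed by \<open>Ppole\<close> and \<open>Ppush\<close>, the relation is
    visibly definable.\<close>
  have R_iff: "R a b c \<longleftrightarrow> (\<forall>\<xi> \<eta> \<pi> \<rho> \<sigma>. \<xi> \<in> ext Lam \<and> (\<forall>\<tau>. \<tau> \<in> tv_Sub a b \<longrightarrow> Ppole \<xi> \<tau>) \<and>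
      \<eta> \<in> ext Lam \<and> (\<forall>\<tau>. \<tau> \<in> tv_Sub b c \<longrightarrow> Ppole \<eta> \<tau>) \<and> \<pi> \<in> tv_Sub a c \<and> Ppush \<eta> \<pi> \<rho> \<and> Ppush \<xi> \<rho> \<sigma> \<longrightarrow>
      Ppole \<theta> \<sigma>)" for a b c
  proof -
    have "R a b c \<longleftrightarrow> (\<forall>\<xi> \<eta> \<pi>. \<xi> \<tturnstile> tv_Sub a b \<longrightarrow> \<eta> \<tturnstile> tv_Sub b c \<longrightarrow> \<pi> \<in> tv_Sub a c \<longrightarrow>
        \<theta> \<star> push \<xi> (push \<eta> \<pi>) \<in> ext pole)"
      unfolding R_def forces_def[of \<theta>] using \<theta> by (simp, blast)
    also have "\<dots> \<longleftrightarrow> (\<forall>\<xi> \<eta> \<pi>. \<xi> \<tturnstile> tv_Sub a b \<longrightarrow> \<eta> \<tturnstile> tv_Sub b c \<longrightarrow> \<pi> \<in> tv_Sub a c \<longrightarrow>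
        Ppole \<theta> (push \<xi> (push \<eta> \<pi>)))"
      unfolding Ppole_def using \<theta> tv_Sub_Pi forces_Lam push_in by (meson subsetD)
    also have "\<dots> \<longleftrightarrow> (\<forall>\<xi> \<eta> \<pi> \<rho> \<sigma>. \<xi> \<tturnstile> tv_Sub a b \<and> \<eta> \<tturnstile> tv_Sub b c \<and> \<pi> \<in> tv_Sub a c \<and>
        Ppush \<eta> \<pi> \<rho> \<and> Ppush \<xi> \<rho> \<sigma> \<longrightarrow> Ppole \<theta> \<sigma>)" (is "?L \<longleftrightarrow> ?R")
    proof
      assume ?L then show ?R by (auto simp: Ppush_def)
    next
      assume R: ?R
      show ?L
      proof (intro allI impI)
        fix \<xi> \<eta> \<pi> assume h: "\<xi> \<tturnstile> tv_Sub a b" "\<eta> \<tturnstile> tv_Sub b c" "\<pi> \<in> tv_Sub a c"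
        then have "Ppush \<eta> \<pi> (push \<eta> \<pi>)" "Ppush \<xi> (push \<eta> \<pi>) (push \<xi> (push \<eta> \<pi>))"
          using forces_Lam tv_Sub_Pi[of a c] unfolding Ppush_def by auto
        with R h show "Ppole \<theta> (push \<xi> (push \<eta> \<pi>))" by blast
      qed
    qed
    finally show ?thesis unfolding forces_iff[OF tv_Sub_Pi] by simp
  qed
  have D_R: "Tm s \<Longrightarrow> Tm t \<Longrightarrow> Tm u \<Longrightarrow> Dfn (\<lambda>v. R (s v) (t v) (u v))" for s t u
    by (rule Dfn3[of R]) (unfold R_iff, intro dfn)
  \<comment> \<open>The recursive calls concern (d, x, g) and (g, x, d) with d in a and g in c, the
    middle name x being arbitrary. With both orders in the statement, induction on one outer name
    suffices.\<close>
  have "Dfn (\<lambda>v. \<forall>b c. R (v 0) b c \<and> R c b (v 0))" by (intro dfn D_R)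
  then have "\<forall>b c. R a b c \<and> R c b a"
  proof (rule name_induct)
    fix a assume IH: "\<And>d \<pi>. opair d \<pi> \<in> ext a \<Longrightarrow> \<forall>b c. R d b c \<and> R c b d"
    have main: "R a b c"
      if IH: "\<And>d g x \<pi> \<rho>. opair d \<pi> \<in> ext a \<Longrightarrow> opair g \<rho> \<in> ext c \<Longrightarrow> R d x g \<and> R g x d" for a b c
    proof -
      have "tyv e trs (Sub a b \<^bold>\<rightarrow> Sub b c \<^bold>\<rightarrow> Sub a c)"
        unfolding trs_def
      proof (rule self_application)
        define e' where "e' = e(0 := ev e (abs 0 trs_body))"
        have "ty e' trs_body (Sub a b \<^bold>\<rightarrow> Sub b c \<^bold>\<rightarrow> Sub a c)"
          unfolding trs_body_def
        proof (rule ty_abs, rule ty_abs, rule ty_SubI, rule ty_abs)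
          fix d \<xi>1 \<xi>2 \<xi>3
          assume \<xi>: "\<xi>1 \<tturnstile> tv (Sub a b)" "\<xi>2 \<tturnstile> tv (Sub b c)" "\<xi>3 \<tturnstile> tv (NotIn d c)"
          let ?e3 = "e'(1 := \<xi>1, 2 := \<xi>2, 3 := \<xi>3)"
          show "ty ?e3 (Var 1 \<cdot> abs 4 (abs 5 (Var 2 \<cdot> abs 6 (abs 7
             (Var 3 \<cdot> (self \<cdot> Var 4 \<cdot> Var 6) \<cdot> (self \<cdot> Var 7 \<cdot> Var 5)))))) (NotEps d a)"
          proof (cases "tv (NotEps d a) = {}")
            case False
            then obtain \<pi> where d: "opair d \<pi> \<in> ext a" using tv_NotEps_name by blast
            show ?thesis
            proof (rule ty_app[of _ _ "NotIn d b"], rule ty_var)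
              show "?e3 1 \<tturnstile> tv (NotIn d b \<^bold>\<rightarrow> NotEps d a)" using forces_SubD[OF \<xi>(1)] by simp
              show "tyv ?e3 (abs 4 (abs 5 (Var 2 \<cdot> abs 6 (abs 7
                (Var 3 \<cdot> (self \<cdot> Var 4 \<cdot> Var 6) \<cdot> (self \<cdot> Var 7 \<cdot> Var 5)))))) (NotIn d b)"
              proof (rule ty_tyv, rule ty_NotInI, rule ty_abs, rule ty_abs)
                fix x \<xi>4 \<xi>5 assume \<xi>45: "\<xi>4 \<tturnstile> tv (Sub d x)" "\<xi>5 \<tturnstile> tv (Sub x d)"
                let ?e5 = "?e3(4 := \<xi>4, 5 := \<xi>5)"
                show "ty ?e5 (Var 2 \<cdot> abs 6 (abs 7
                  (Var 3 \<cdot> (self \<cdot> Var 4 \<cdot> Var 6) \<cdot> (self \<cdot> Var 7 \<cdot> Var 5)))) (NotEps x b)"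
                proof (rule ty_app[of _ _ "NotIn x c"], rule ty_var)
                  show "?e5 2 \<tturnstile> tv (NotIn x c \<^bold>\<rightarrow> NotEps x b)" using forces_SubD[OF \<xi>(2)] by simp
                  show "tyv ?e5 (abs 6 (abs 7
                    (Var 3 \<cdot> (self \<cdot> Var 4 \<cdot> Var 6) \<cdot> (self \<cdot> Var 7 \<cdot> Var 5)))) (NotIn x c)"
                  proof (rule ty_tyv, rule ty_NotInI, rule ty_abs, rule ty_abs)
                    fix g \<xi>6 \<xi>7 assume \<xi>67: "\<xi>6 \<tturnstile> tv (Sub x g)" "\<xi>7 \<tturnstile> tv (Sub g x)"
                    let ?e7 = "?e5(6 := \<xi>6, 7 := \<xi>7)"
                    have self: "tyv ?e7 self F" if "\<theta> \<tturnstile> tv F" for F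
                      using that unfolding tyv_def self_def \<theta>_def trs_def e'_def by simp
                    show "ty ?e7 (Var 3 \<cdot> (self \<cdot> Var 4 \<cdot> Var 6) \<cdot> (self \<cdot> Var 7 \<cdot> Var 5)) (NotEps g c)"
                    proof (cases "tv (NotEps g c) = {}")
                      case False
                      then obtain \<rho> where g: "opair g \<rho> \<in> ext c" using tv_NotEps_name by blast
                      have R: "\<theta> \<tturnstile> tv (Sub d x \<^bold>\<rightarrow> Sub x g \<^bold>\<rightarrow> Sub d g)" "\<theta> \<tturnstile> tv (Sub g x \<^bold>\<rightarrow> Sub x d \<^bold>\<rightarrow> Sub g d)"
                        using IH[OF d g] unfolding R_def by blast+
                      show ?thesis
                      proof (rule ty_app[OF ty_app], rule ty_var)
                        show "?e7 3 \<tturnstile> tv (Sub d g \<^bold>\<rightarrow> Sub g d \<^bold>\<rightarrow> NotEps g c)"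
                          using forces_NotInD[OF \<xi>(3)] by simp
                        show "tyv ?e7 (self \<cdot> Var 4 \<cdot> Var 6) (Sub d g)"
                          by (rule tyv_app[OF tyv_app[OF self[OF R(1)]]]; rule tyv_var) (use \<xi>45 \<xi>67 in simp_all)
                        show "tyv ?e7 (self \<cdot> Var 7 \<cdot> Var 5) (Sub g d)"
                          by (rule tyv_app[OF tyv_app[OF self[OF R(2)]]]; rule tyv_var) (use \<xi>45 \<xi>67 in simp_all)
                      qed
                    qed (rule ty_empty)
                  qed
                qed
              qed
            qed
          qed (rule ty_empty)
        qed
        then show "ty (e(0 := ev e (abs 0 trs_body))) trs_body (Sub a b \<^bold>\<rightarrow> Sub b c \<^bold>\<rightarrow> Sub a c)"
          unfolding e'_def .
      qed
      then show "R a b c" unfolding R_def tyv_def \<theta>_def using True by blast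
    qed
    show "\<forall>b c. R a b c \<and> R c b a" using main[of a] main[of _ a] IH by blast
  qed
  then show ?thesis unfolding tyv_def R_def \<theta>_def by blast
qed (auto simp: tyv_def)

end

section \<open>The injection into the reals\<close>

text \<open>The variables 3, 5 and 6 stand for realizers of the totality, single-valuedness and injectivity of
  the given injection of \<open>\<gimel>\<kappa>\<close> into \<open>\<omega>\<close>.\<close>

definition value_in :: "nat \<Rightarrow> nat \<Rightarrow> nat \<Rightarrow> trm \<Rightarrow> trm" where
  "value_in x y w t = Var 3 \<cdot> Cst CI \<cdot> abs x (Var x \<cdot> abs y (abs w t))"

text \<open>Turns n \<notin> z (variable 15) into k \<notin> z by composing n \<simeq> m (16, 17)
  with m \<simeq> k (22, 23).\<close>

definition subst_t :: trm where
  "subst_t = abs 24 (abs 25 (Var 15 \<cdot> (trs \<cdot> (trs \<cdot> Var 16 \<cdot> Var 22) \<cdot> Var 24) \<cdot>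
     (trs \<cdot> Var 25 \<cdot> (trs \<cdot> Var 23 \<cdot> Var 17))))"

text \<open>Totality only says that some value k of f at x is an integer. For a given value m,
  single-valuedness yields m \<simeq> k, and this carries over to n \<simeq> m.\<close>

definition real_t :: trm where
  "real_t = abs 13 (abs 14 (abs 15 (Var 13 \<cdot> abs 16 (abs 17 (Cst CCc \<cdot> abs 18
     (value_in 19 20 21 (Var 5 \<cdot> Cst CI \<cdot> Var 18 \<cdot> Var 20 \<cdot> abs 22 (abs 23 (Var 21 \<cdot> Var 14 \<cdot> subst_t)))))))))"

definition total_t :: trm where
  "total_t = abs 10 (abs 11 (Var 10 \<cdot> (Var 11 \<cdot> abs 12 (Var 12 \<cdot> Cst CI \<cdot> real_t))))"

definition functional_t :: trm where
  "functional_t = abs 30 (abs 31 (abs 32 (abs 33 (Var 31 \<cdot> (Var 32 \<cdot> (Var 33 \<cdot> rfl \<cdot> rfl))))))"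

text \<open>Variable 46 is the inclusion of the first real in the second, 49 and 53 place (z, n) and
  (z', m) in f, and 51, 52 make up n \<simeq> m.\<close>

definition inj_t :: trm where
  "inj_t = abs 40 (abs 41 (abs 42 (abs 43 (abs 44 (Cst CCc \<cdot> abs 45 (Var 42 \<cdot> (Var 43 \<cdot>
     (Var 44 \<cdot> abs 46 (abs 47 (value_in 48 49 50 (Var 49 \<cdot> (Var 46 \<cdot> abs 51 (abs 52 (Cst CCc \<cdot> abs 53
       (Var 45 \<cdot> (Var 6 \<cdot> Cst CI \<cdot> Cst CI \<cdot> Var 49 \<cdot> Var 53 \<cdot> abs 54 (Var 54 \<cdot> Var 51 \<cdot> Var 52)))))))))))))))))"

definition main_t :: trm where
  "main_t = abs 0 (abs 1 (Var 0 \<cdot> abs 2 (Var 2 \<cdot> abs 3 (abs 4 (Var 4 \<cdot> abs 5 (abs 6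
     (Var 1 \<cdot> abs 7 (Var 7 \<cdot> total_t \<cdot> abs 8 (Var 8 \<cdot> functional_t \<cdot> inj_t)))))))))"

lemma fv_main_t: "fv main_t = {}"
  unfolding main_t_def total_t_def functional_t_def inj_t_def real_t_def subst_t_def value_in_def
  by (simp add: fv_rfl fv_trs insert_Diff_if)

context realizability_algebra
begin

lemma kappa_antichain:
  "\<exists>H. Dfn (\<lambda>v. H (v 0) (v 1)) \<and> (\<forall>X z. H X z \<longrightarrow> z \<in> ext kappa) \<and>
    (\<forall>X Y. X \<in> ext kappa_plus \<longrightarrow> Y \<in> ext kappa_plus \<longrightarrow> (\<exists>z. H X z \<and> (H Y z \<longrightarrow> X = Y)))"
proof -
  define Z where "Z = setof (ext Lam \<union> ext Pi \<union> ext omega)"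
  have "ext omega \<subseteq> ext Z" unfolding Z_def by (auto simp: ext_setof)
  moreover have "kappa = cardinality Z" unfolding kappa_def Z_def ..
  moreover from this have "\<forall>b \<in> ext kappa. \<not> equipotent b Z"
    by (simp add: cardinality_props(3))
  ultimately show ?thesis
    using antichain_exists[of kappa Z] cardinality_props(1,2)[of Z]
    unfolding kappa_plus_def ext_pow mem_Collect_eq by argo
qed

section \<open>Restricted quantifiers and Leibniz equality\<close>

lemma opair_in_gimel: "opair x \<pi> \<in> ext (gimel X) \<longleftrightarrow> x \<in> ext X \<and> \<pi> \<in> ext Pi"
  unfolding gimel_def by simp

text \<open>For x in X, non-membership in \<open>gimel X\<close> has the truth value of
  \<open>Bot\<close>, so the guard amounts to \<open>Bot\<close> \<rightarrow>
  \<open>Bot\<close>.\<close>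

lemma tyv_guard: assumes "x \<in> ext X" shows "tyv e (Cst CI) (x \<^bold>\<epsilon> gimel X)"
proof (rule ty_tyv, unfold ty_def Eps_def, intro impI ballI)
  fix \<rho> assume "\<rho> \<in> tv (Neg (NotEps x (gimel X)))"
  then obtain \<xi> \<pi> where \<rho>: "\<rho> = push \<xi> \<pi>" "\<xi> \<tturnstile> tv (NotEps x (gimel X))" "\<pi> \<in> ext Pi" by auto
  have "tv (NotEps x (gimel X)) = ext Pi" using assms by (auto simp: opair_in_gimel)
  then have "\<xi> \<star> \<pi> \<in> ext pole" "\<xi> \<in> ext Lam" using \<rho> unfolding forces_def by auto
  then show "hp e (Cst CI) \<rho>" using pole_step[OF step_I[of \<xi> \<pi>]] \<rho> by simp
qed

text \<open>Turns a realized strong membership into a fact of the ground model: if the truth value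
  is empty, any t will do, so t has to be examined only when some pair with a is an element of
  b.\<close>

lemma ty_eps:
  assumes "e p \<tturnstile> tv (a \<^bold>\<epsilon> b)" "tv (NotEps a b) \<noteq> {} \<Longrightarrow> tyv e t Bot" shows "ty e (Var p \<cdot> t) Bot"
proof (rule ty_app)
  show "ty e (Var p) (NotEps a b \<^bold>\<rightarrow> Bot)" by (rule ty_var) (rule assms(1)[unfolded Eps_def])
  show "tyv e t (NotEps a b)"
  proof (cases "tv (NotEps a b) = {}")
    case True
    then show ?thesis unfolding tyv_def forces_def by (simp del: tv.simps)
  next
    case False
    then show ?thesis using assms(2) tyv_mono[OF _ tv_Bot] by blast
  qed
qed

text \<open>The truth value of a Leibniz equation depends only on whether it holds in the ground
  model, and it is larger when it fails. A realizer of one equation thus serves for another without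
  change.\<close>

lemma tv_LeibnizEq_mono:
  assumes "a = b \<longrightarrow> c = d" shows "tv (c \<^bold>= d) \<subseteq> tv (a \<^bold>= b)"
proof
  fix \<rho> assume "\<rho> \<in> tv (c \<^bold>= d)"
  then obtain w \<xi> \<pi> where \<rho>: "\<rho> = push \<xi> \<pi>" "\<xi> \<tturnstile> tv (NotEps d w)" "\<pi> \<in> tv (NotEps c w)"
    unfolding LeibnizEq_def by auto
  have \<pi>: "\<pi> \<in> ext Pi" "opair c \<pi> \<in> ext w" and \<xi>: "\<xi> \<in> ext Lam" using \<rho> forces_Lam by auto
  have "\<exists>w'. \<xi> \<tturnstile> tv (NotEps b w') \<and> \<pi> \<in> tv (NotEps a w')"
  proof (cases "a = b")
    case True
    have "Dfn (\<lambda>v. opair c (v 1) \<in> ext w)" by (intro dfn)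
    then obtain w' where "ext w' = {opair x y | x y. x \<in> ext (setof {a}) \<and> y \<in> ext Pi \<and> opair c y \<in> ext w}"
      by (rule graph_exists)
    then have "tv (NotEps a w') = tv (NotEps c w)" by (auto simp: ext_setof)
    then show ?thesis using \<rho> True assms by metis
  next
    case False
    \<comment> \<open>For a \<noteq> b, the set {a} \<times> \<Pi> admits every stack for a and
      makes the condition on b vacuous.\<close>
    have "tv (NotEps b (cart (setof {a}) Pi)) = {}" "\<pi> \<in> tv (NotEps a (cart (setof {a}) Pi))"
      using False \<pi> by (auto simp: ext_setof)
    then show ?thesis using \<xi> unfolding forces_def by (metis empty_iff)
  qed
  then show "\<rho> \<in> tv (a \<^bold>= b)" unfolding LeibnizEq_def \<rho>(1) by auto
qed

context
  fixes H :: "'m \<Rightarrow> 'm \<Rightarrow> bool"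
  assumes D_H: "Dfn (\<lambda>v. H (v 0) (v 1))" and H_kappa: "\<And>X z. H X z \<Longrightarrow> z \<in> ext kappa"
    and H_antichain: "\<And>X Y. X \<in> ext kappa_plus \<Longrightarrow> Y \<in> ext kappa_plus \<Longrightarrow> \<exists>z. H X z \<and> (H Y z \<longrightarrow> X = Y)"
begin

text \<open>\<open>img f X\<close> is a name of the image under \<open>f\<close> of the subset of \<open>\<gimel>\<kappa>\<close> that codes \<open>X\<close>.\<close>

definition in_img :: "'m \<Rightarrow> 'm \<Rightarrow> 'm \<Rightarrow> bool" where
  "in_img f X p \<longleftrightarrow> (\<exists>n \<pi> z. p = opair n \<pi> \<and> \<pi> \<in> ext Pi \<and> H X z \<and> opair (opair z n) \<pi> \<in> ext f)"

definition img :: "'m \<Rightarrow> 'm \<Rightarrow> 'm" where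
  "img f X = setof {p. in_img f X p}"

lemma coded_img: "coded {p. in_img f X p}"
proof -
  let ?R = "\<lambda>q p. \<exists>n \<pi> z. q = opair (opair z n) \<pi> \<and> p = opair n \<pi> \<and> \<pi> \<in> ext Pi \<and> H X z"
  have "Dfn (\<lambda>v. ?R (v 0) (v 1))" by (intro dfn Dfn2[OF D_H])
  then have "coded {p. \<exists>q \<in> ext f. ?R q p}" by (rule coded_image) auto
  moreover have "{p. in_img f X p} = {p. \<exists>q \<in> ext f. ?R q p}" unfolding in_img_def by blast
  ultimately show ?thesis by simp
qed

text \<open>The existential z in the name becomes a union, so a realizer has to work for all z in
  the code of X at once.\<close>

lemma tv_img: "tv (NotEps n (img f X)) = (\<Union>z \<in> {z. H X z}. tv (NotEps (opair z n) f))"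
  unfolding img_def by (auto simp: ext_setof[OF coded_img] in_img_def)

text \<open>Every pair carries all stacks, as in \<open>gimel\<close>, so membership in this name is
  settled in the ground model.\<close>

definition graph :: "'m \<Rightarrow> 'm" where
  "graph f = setof {p. \<exists>X \<pi>. X \<in> ext kappa_plus \<and> \<pi> \<in> ext Pi \<and> p = opair (opair X (img f X)) \<pi>}"

lemma coded_graph_img: "coded {p. \<exists>X \<pi>. X \<in> ext kappa_plus \<and> \<pi> \<in> ext Pi \<and> p = opair (opair X (img f X)) \<pi>}"
proof -
  let ?R = "\<lambda>q p. \<exists>X \<pi> Y. q = opair X \<pi> \<and> p = opair (opair X Y) \<pi> \<and> (\<forall>r. r \<in> ext Y \<longleftrightarrow> in_img f X r)"
  have Y: "(\<forall>r. r \<in> ext Y \<longleftrightarrow> in_img f X r) \<longleftrightarrow> Y = img f X" for X Y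
    unfolding img_def eq_setof_iff[OF coded_img] by simp
  have "Dfn (\<lambda>v. ?R (v 0) (v 1))" unfolding in_img_def by (intro dfn Dfn2[OF D_H])
  then have "coded {p. \<exists>q \<in> ext (cart kappa_plus Pi). ?R q p}"
    by (rule coded_image) (unfold Y, auto)
  moreover have "{p. \<exists>X \<pi>. X \<in> ext kappa_plus \<and> \<pi> \<in> ext Pi \<and> p = opair (opair X (img f X)) \<pi>}
      = {p. \<exists>q \<in> ext (cart kappa_plus Pi). ?R q p}"
    unfolding Y ext_cart by auto
  ultimately show ?thesis by simp
qed

lemma opair_in_graph: "opair (opair X Y) \<pi> \<in> ext (graph f) \<longleftrightarrow>
    X \<in> ext kappa_plus \<and> \<pi> \<in> ext Pi \<and> Y = img f X"
  unfolding graph_def ext_setof[OF coded_graph_img] by auto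

lemma graphD: "tv (NotEps (opair X Y) (graph f)) \<noteq> {} \<Longrightarrow> X \<in> ext kappa_plus \<and> Y = img f X"
  by (auto simp: opair_in_graph)

lemma tyv_graph: assumes "X \<in> ext kappa_plus" shows "tyv e (Cst CI) (opair X (img f X) \<^bold>\<epsilon> graph f)"
proof -
  have "tv (opair X (img f X) \<^bold>\<epsilon> graph f) = tv (X \<^bold>\<epsilon> gimel kappa_plus)"
    using assms unfolding Eps_def by (simp add: opair_in_graph opair_in_gimel)
  then show ?thesis using tyv_guard[OF assms] unfolding tyv_def by simp
qed

lemma ty_imgI: "(\<And>z. H X z \<Longrightarrow> ty e t (NotEps (opair z n) f)) \<Longrightarrow> ty e t (NotEps n (img f X))"
  unfolding ty_def tv_img by blast

definition total_fm :: "'m \<Rightarrow> 'm \<Rightarrow> ('m \<Rightarrow> 'm rfm) \<Rightarrow> 'm rfm" where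
  "total_fm X f P = (\<^bold>\<forall>x. x \<^bold>\<epsilon> X \<^bold>\<rightarrow> (\<^bold>\<exists>y. opair x y \<^bold>\<epsilon> f \<^bold>\<and> P y))"

definition functional_fm :: "'m \<Rightarrow> 'm \<Rightarrow> 'm rfm" where
  "functional_fm X f = (\<^bold>\<forall>x. \<^bold>\<forall>y. \<^bold>\<forall>y'. x \<^bold>\<epsilon> X \<^bold>\<rightarrow> opair x y \<^bold>\<epsilon> f \<^bold>\<rightarrow> opair x y' \<^bold>\<epsilon> f \<^bold>\<rightarrow> y \<^bold>\<simeq> y')"

definition injective_fm :: "'m \<Rightarrow> 'm \<Rightarrow> 'm rfm" where
  "injective_fm X f = (\<^bold>\<forall>x. \<^bold>\<forall>x'. \<^bold>\<forall>y. \<^bold>\<forall>y'. x \<^bold>\<epsilon> X \<^bold>\<rightarrow> x' \<^bold>\<epsilon> X \<^bold>\<rightarrow>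
        opair x y \<^bold>\<epsilon> f \<^bold>\<rightarrow> opair x' y' \<^bold>\<epsilon> f \<^bold>\<rightarrow> y \<^bold>\<simeq> y' \<^bold>\<rightarrow> x \<^bold>= x')"

lemma Injects_fm_eq: "Injects_fm X P = (\<^bold>\<exists>f. total_fm X f P \<^bold>\<and> functional_fm X f \<^bold>\<and> injective_fm X f)"
  unfolding Injects_fm_def total_fm_def functional_fm_def injective_fm_def ..

section \<open>The realizers of the three properties of the injection\<close>

context
  fixes f :: 'm and e :: "nat \<Rightarrow> 'm"
  assumes e3: "e 3 \<tturnstile> tv (total_fm (gimel kappa) f Nat_fm)"
    and e5: "e 5 \<tturnstile> tv (functional_fm (gimel kappa) f)"
    and e6: "e 6 \<tturnstile> tv (injective_fm (gimel kappa) f)"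
begin

lemma ty_value_in:
  assumes "e' 3 = e 3" "z \<in> ext kappa"
    and "\<And>n \<zeta> \<xi> \<eta>. \<xi> \<tturnstile> tv (opair z n \<^bold>\<epsilon> f) \<Longrightarrow> \<eta> \<tturnstile> tv (Nat_fm n) \<Longrightarrow> ty (e'(x := \<zeta>, y := \<xi>, w := \<eta>)) t Bot"
  shows "ty e' (value_in x y w t) Bot"
  unfolding value_in_def
proof (rule ty_exE)
  have "e' 3 \<tturnstile> tv (z \<^bold>\<epsilon> gimel kappa \<^bold>\<rightarrow> (\<^bold>\<exists>n. opair z n \<^bold>\<epsilon> f \<^bold>\<and> Nat_fm n))"
    unfolding assms(1) by (rule forces_All[OF e3[unfolded total_fm_def]])
  then show "ty e' (Var 3 \<cdot> Cst CI) (\<^bold>\<exists>n. opair z n \<^bold>\<epsilon> f \<^bold>\<and> Nat_fm n)"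
    by (rule ty_app[OF ty_var tyv_guard[OF assms(2)]])
  fix n \<zeta> assume "\<zeta> \<tturnstile> tv (opair z n \<^bold>\<epsilon> f \<^bold>\<and> Nat_fm n)"
  then show "ty (e'(x := \<zeta>)) (Var x \<cdot> abs y (abs w t)) Bot"
    by (intro ty_conjE[OF ty_var] assms(3)) auto
qed

lemma tyv_trs_app: "tyv e' s (Sub a b) \<Longrightarrow> tyv e' t (Sub b c) \<Longrightarrow> tyv e' (trs \<cdot> s \<cdot> t) (Sub a c)"
  by (rule tyv_app[OF tyv_app[OF tyv_trs]])

lemma ty_real_t:
  assumes "\<forall>i \<in> {3, 5}. e' i = e i" shows "ty e' real_t (Real_fm (img f X))"
  unfolding real_t_def Real_fm_def Nat_fm_def
proof (intro ty_all ty_abs, unfold In_def, rule ty_abs)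
  fix n z \<xi>13 \<xi>14 \<xi>15
  assume \<xi>: "\<xi>13 \<tturnstile> tv (Neg (NotIn n (img f X)))" "\<xi>14 \<tturnstile> tv (Inductive_fm z)" "\<xi>15 \<tturnstile> tv (NotIn n z)"
  let ?e15 = "e'(13 := \<xi>13, 14 := \<xi>14, 15 := \<xi>15)"
  let ?t = "Var 5 \<cdot> Cst CI \<cdot> Var 18 \<cdot> Var 20 \<cdot> abs 22 (abs 23 (Var 21 \<cdot> Var 14 \<cdot> subst_t))"
  show "ty ?e15 (Var 13 \<cdot> abs 16 (abs 17 (Cst CCc \<cdot> abs 18 (value_in 19 20 21 ?t)))) Bot"
  proof (rule ty_app[of _ _ "NotIn n (img f X)"], rule ty_var)
    show "?e15 13 \<tturnstile> tv (Neg (NotIn n (img f X)))" using \<xi>(1) by simp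
    \<comment> \<open>A name m in the image with m \<simeq> n stems from some x in the code of X;
      arguing by contradiction stores (x, m) \<epsilon> f in variable 18.\<close>
    show "tyv ?e15 (abs 16 (abs 17 (Cst CCc \<cdot> abs 18 (value_in 19 20 21 ?t)))) (NotIn n (img f X))"
    proof (rule ty_tyv, rule ty_NotInI, rule ty_abs, rule ty_abs, rule ty_imgI, rule ty_by_contradiction)
      fix m \<xi>16 \<xi>17 \<xi>18 x assume \<xi>2: "\<xi>16 \<tturnstile> tv (Sub n m)" "\<xi>17 \<tturnstile> tv (Sub m n)" and x: "H X x"
        and \<xi>18: "\<xi>18 \<tturnstile> tv (Neg (NotEps (opair x m) f))"
      let ?e18 = "?e15(16 := \<xi>16, 17 := \<xi>17, 18 := \<xi>18)"
      show "ty ?e18 (value_in 19 20 21 ?t) Bot"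
      proof (rule ty_value_in)
        show "?e18 3 = e 3" using assms by simp
        show "x \<in> ext kappa" using x by (rule H_kappa)
        fix k \<xi>19 \<xi>20 \<xi>21
        assume \<xi>3: "\<xi>20 \<tturnstile> tv (opair x k \<^bold>\<epsilon> f)" "\<xi>21 \<tturnstile> tv (Nat_fm k)"
        let ?e21 = "?e18(19 := \<xi>19, 20 := \<xi>20, 21 := \<xi>21)"
        show "ty ?e21 ?t Bot"
        proof (rule ty_conjE)
          show "ty ?e21 (Var 5 \<cdot> Cst CI \<cdot> Var 18 \<cdot> Var 20) (Sub m k \<^bold>\<and> Sub k m)"
          proof (fold ExtEq_def, rule ty_app[OF ty_app[OF ty_app]])
            have "e 5 \<tturnstile> tv (x \<^bold>\<epsilon> gimel kappa \<^bold>\<rightarrow> opair x m \<^bold>\<epsilon> f \<^bold>\<rightarrow> opair x k \<^bold>\<epsilon> f \<^bold>\<rightarrow> m \<^bold>\<simeq> k)"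
              using e5 unfolding functional_fm_def by (blast dest: forces_All)
            then show "ty ?e21 (Var 5) (x \<^bold>\<epsilon> gimel kappa \<^bold>\<rightarrow> opair x m \<^bold>\<epsilon> f \<^bold>\<rightarrow> opair x k \<^bold>\<epsilon> f \<^bold>\<rightarrow> m \<^bold>\<simeq> k)"
              using assms by (intro ty_var) simp
            show "tyv ?e21 (Cst CI) (x \<^bold>\<epsilon> gimel kappa)" using x by (intro tyv_guard H_kappa)
            show "tyv ?e21 (Var 18) (opair x m \<^bold>\<epsilon> f)" using \<xi>18 unfolding Eps_def by (intro tyv_var) simp
            show "tyv ?e21 (Var 20) (opair x k \<^bold>\<epsilon> f)" using \<xi>3 by (intro tyv_var) simp
          qed
          fix \<xi>22 \<xi>23 assume \<xi>4: "\<xi>22 \<tturnstile> tv (Sub m k)" "\<xi>23 \<tturnstile> tv (Sub k m)"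
          let ?e23 = "?e21(22 := \<xi>22, 23 := \<xi>23)"
          show "ty ?e23 (Var 21 \<cdot> Var 14 \<cdot> subst_t) Bot"
          proof (rule ty_app[OF ty_app])
            have "\<xi>21 \<tturnstile> tv (Inductive_fm z \<^bold>\<rightarrow> Neg (NotIn k z))"
              using \<xi>3(2) unfolding Nat_fm_def In_def by (rule forces_All)
            then show "ty ?e23 (Var 21) (Inductive_fm z \<^bold>\<rightarrow> Neg (NotIn k z))" by (intro ty_var) simp
            show "tyv ?e23 (Var 14) (Inductive_fm z)" using \<xi>(2) by (intro tyv_var) simp
            show "tyv ?e23 subst_t (NotIn k z)"
              unfolding subst_t_def
            proof (rule ty_tyv, rule ty_NotInI, rule ty_abs, rule ty_abs)
              fix d \<xi>24 \<xi>25 assume \<xi>5: "\<xi>24 \<tturnstile> tv (Sub k d)" "\<xi>25 \<tturnstile> tv (Sub d k)"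
              let ?e25 = "?e23(24 := \<xi>24, 25 := \<xi>25)"
              show "ty ?e25 (Var 15 \<cdot> (trs \<cdot> (trs \<cdot> Var 16 \<cdot> Var 22) \<cdot> Var 24) \<cdot>
                (trs \<cdot> Var 25 \<cdot> (trs \<cdot> Var 23 \<cdot> Var 17))) (NotEps d z)"
              proof (rule ty_app[OF ty_app], rule ty_var)
                show "?e25 15 \<tturnstile> tv (Sub n d \<^bold>\<rightarrow> Sub d n \<^bold>\<rightarrow> NotEps d z)"
                  using forces_NotInD[OF \<xi>(3)] by simp
                show "tyv ?e25 (trs \<cdot> (trs \<cdot> Var 16 \<cdot> Var 22) \<cdot> Var 24) (Sub n d)"
                  by (rule tyv_trs_app[OF tyv_trs_app]; rule tyv_var) (use \<xi>2 \<xi>4 \<xi>5 in simp_all)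
                show "tyv ?e25 (trs \<cdot> Var 25 \<cdot> (trs \<cdot> Var 23 \<cdot> Var 17)) (Sub d n)"
                  by (rule tyv_trs_app[OF _ tyv_trs_app]; rule tyv_var) (use \<xi>2 \<xi>4 \<xi>5 in simp_all)
              qed
            qed
          qed
        qed
      qed
    qed
  qed
qed

lemma ty_total_t:
  assumes "\<forall>i \<in> {3, 5}. e' i = e i" shows "ty e' total_t (total_fm (gimel kappa_plus) (graph f) Real_fm)"
  unfolding total_t_def total_fm_def
proof (rule ty_all, rule ty_abs, unfold Ex_def, rule ty_abs)
  fix X \<xi>10 \<xi>11 assume \<xi>: "\<xi>10 \<tturnstile> tv (X \<^bold>\<epsilon> gimel kappa_plus)"
    "\<xi>11 \<tturnstile> tv (\<^bold>\<forall>y. Neg (opair X y \<^bold>\<epsilon> graph f \<^bold>\<and> Real_fm y))"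
  let ?e = "e'(10 := \<xi>10, 11 := \<xi>11)"
  show "ty ?e (Var 10 \<cdot> (Var 11 \<cdot> abs 12 (Var 12 \<cdot> Cst CI \<cdot> real_t))) Bot"
  proof (rule ty_eps)
    show "?e 10 \<tturnstile> tv (X \<^bold>\<epsilon> gimel kappa_plus)" using \<xi> by simp
    \<comment> \<open>X is now an element of \<open>kappa_plus\<close> in the ground model, so
      \<open>img f X\<close> can be the witness.\<close>
    assume "tv (NotEps X (gimel kappa_plus)) \<noteq> {}"
    then have X: "X \<in> ext kappa_plus" by (auto simp: opair_in_gimel)
    have "?e 11 \<tturnstile> tv (Neg (opair X (img f X) \<^bold>\<epsilon> graph f \<^bold>\<and> Real_fm (img f X)))"
      using forces_All[OF \<xi>(2)] by simp
    then show "tyv ?e (Var 11 \<cdot> abs 12 (Var 12 \<cdot> Cst CI \<cdot> real_t)) Bot"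
      by (rule ty_tyv[OF ty_app[OF ty_var]])
        (rule ty_tyv, rule ty_conjI, rule tyv_graph[OF X], rule ty_tyv, rule ty_real_t, use assms in simp)
  qed
qed

lemma ty_functional_t: "ty e' functional_t (functional_fm (gimel kappa_plus) (graph f))"
  unfolding functional_t_def functional_fm_def
proof (intro ty_all, rule ty_abs, rule ty_abs, rule ty_abs, unfold ExtEq_def Conj_def, rule ty_abs)
  fix X Y Y' \<xi>30 \<xi>31 \<xi>32 \<xi>33
  assume \<xi>: "\<xi>31 \<tturnstile> tv (opair X Y \<^bold>\<epsilon> graph f)" "\<xi>32 \<tturnstile> tv (opair X Y' \<^bold>\<epsilon> graph f)"
    "\<xi>33 \<tturnstile> tv (Sub Y Y' \<^bold>\<rightarrow> Sub Y' Y \<^bold>\<rightarrow> Bot)"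
  let ?e = "e'(30 := \<xi>30, 31 := \<xi>31, 32 := \<xi>32, 33 := \<xi>33)"
  show "ty ?e (Var 31 \<cdot> (Var 32 \<cdot> (Var 33 \<cdot> rfl \<cdot> rfl))) Bot"
  proof (rule ty_eps)
    show "?e 31 \<tturnstile> tv (opair X Y \<^bold>\<epsilon> graph f)" using \<xi> by simp
    assume 1: "tv (NotEps (opair X Y) (graph f)) \<noteq> {}"
    show "tyv ?e (Var 32 \<cdot> (Var 33 \<cdot> rfl \<cdot> rfl)) Bot"
    proof (rule ty_tyv, rule ty_eps)
      show "?e 32 \<tturnstile> tv (opair X Y' \<^bold>\<epsilon> graph f)" using \<xi> by simp
      assume 2: "tv (NotEps (opair X Y') (graph f)) \<noteq> {}"
      \<comment> \<open>The two values are the same individual, so reflexivity of inclusion is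
        enough.\<close>
      have "Y' = Y" using graphD[OF 1] graphD[OF 2] by simp
      then have "?e 33 \<tturnstile> tv (Sub Y Y \<^bold>\<rightarrow> Sub Y Y \<^bold>\<rightarrow> Bot)" using \<xi>(3) by simp
      then show "tyv ?e (Var 33 \<cdot> rfl \<cdot> rfl) Bot"
        by - (rule ty_tyv, rule ty_app, rule ty_app, rule ty_var, assumption, rule tyv_rfl, rule tyv_rfl)
    qed
  qed
qed

lemma ty_inj_t:
  assumes "\<forall>i \<in> {3, 6}. e' i = e i" shows "ty e' inj_t (injective_fm (gimel kappa_plus) (graph f))"
  unfolding inj_t_def injective_fm_def
proof (intro ty_all, rule ty_abs, rule ty_abs, rule ty_abs, rule ty_abs, rule ty_abs, rule ty_by_contradiction)
  fix X X' Y Y' \<xi>40 \<xi>41 \<xi>42 \<xi>43 \<xi>44 \<xi>45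
  assume \<xi>: "\<xi>42 \<tturnstile> tv (opair X Y \<^bold>\<epsilon> graph f)" "\<xi>43 \<tturnstile> tv (opair X' Y' \<^bold>\<epsilon> graph f)"
    "\<xi>44 \<tturnstile> tv (Y \<^bold>\<simeq> Y')" "\<xi>45 \<tturnstile> tv (Neg (X \<^bold>= X'))"
  let ?e = "e'(40 := \<xi>40, 41 := \<xi>41, 42 := \<xi>42, 43 := \<xi>43, 44 := \<xi>44, 45 := \<xi>45)"
  let ?v = "Var 45 \<cdot> (Var 6 \<cdot> Cst CI \<cdot> Cst CI \<cdot> Var 49 \<cdot> Var 53 \<cdot> abs 54 (Var 54 \<cdot> Var 51 \<cdot> Var 52))"
  let ?u = "Var 49 \<cdot> (Var 46 \<cdot> abs 51 (abs 52 (Cst CCc \<cdot> abs 53 ?v)))"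
  let ?t = "Var 44 \<cdot> abs 46 (abs 47 (value_in 48 49 50 ?u))"
  have "tyv ?e ?t Bot" if XY: "X \<in> ext kappa_plus" "X' \<in> ext kappa_plus" "Y = img f X" "Y' = img f X'"
  proof -
    obtain z where z: "H X z" "H X' z \<longrightarrow> X = X'" using H_antichain XY(1,2) by blast
    show ?thesis
    proof (rule ty_tyv, rule ty_conjE)
      show "ty ?e (Var 44) (Sub Y Y' \<^bold>\<and> Sub Y' Y)" using \<xi>(3) unfolding ExtEq_def by (intro ty_var) simp
      fix \<xi>46 \<xi>47 assume \<xi>46: "\<xi>46 \<tturnstile> tv (Sub Y Y')"
      let ?e47 = "?e(46 := \<xi>46, 47 := \<xi>47)"
      show "ty ?e47 (value_in 48 49 50 ?u) Bot"
      proof (rule ty_value_in)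
        show "?e47 3 = e 3" using assms by simp
        show "z \<in> ext kappa" using z(1) by (rule H_kappa)
        fix n \<xi>48 \<xi>49 \<xi>50 assume \<xi>49: "\<xi>49 \<tturnstile> tv (opair z n \<^bold>\<epsilon> f)"
        let ?e50 = "?e47(48 := \<xi>48, 49 := \<xi>49, 50 := \<xi>50)"
        show "ty ?e50 ?u Bot"
        proof (rule ty_app[of _ _ "NotEps (opair z n) f"], rule ty_var)
          show "?e50 49 \<tturnstile> tv (Neg (NotEps (opair z n) f))" using \<xi>49 unfolding Eps_def by simp
          \<comment> \<open>Since z is in the code of X, the realizer for n and Y serves for (z, n)
            and f as it stands.\<close>
          have "tv (NotEps (opair z n) f) \<subseteq> tv (NotEps n Y)" unfolding XY(3) tv_img using z(1) by blast
          moreover have "tyv ?e50 (Var 46 \<cdot> abs 51 (abs 52 (Cst CCc \<cdot> abs 53 ?v))) (NotEps n Y)"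
          proof (rule ty_tyv, rule ty_app, rule ty_var)
            show "?e50 46 \<tturnstile> tv (NotIn n Y' \<^bold>\<rightarrow> NotEps n Y)" using forces_SubD[OF \<xi>46] by simp
            show "tyv ?e50 (abs 51 (abs 52 (Cst CCc \<cdot> abs 53 ?v))) (NotIn n Y')"
              unfolding XY(4)
            proof (rule ty_tyv, rule ty_NotInI, rule ty_abs, rule ty_abs, rule ty_imgI, rule ty_by_contradiction)
              fix m \<xi>51 \<xi>52 z' \<xi>53
              assume \<xi>5: "\<xi>51 \<tturnstile> tv (Sub n m)" "\<xi>52 \<tturnstile> tv (Sub m n)"
                "\<xi>53 \<tturnstile> tv (Neg (NotEps (opair z' m) f))" and z': "H X' z'"
              let ?e53 = "?e50(51 := \<xi>51, 52 := \<xi>52, 53 := \<xi>53)"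
              show "ty ?e53 ?v Bot"
              proof (rule ty_app, rule ty_var)
                show "?e53 45 \<tturnstile> tv (Neg (X \<^bold>= X'))" using \<xi>(4) by simp
                \<comment> \<open>A realizer of z = z' already realizes X = X': if z = z', then z
                  lies in the code of X', and the choice of z forces X = X'.\<close>
                show "tyv ?e53 (Var 6 \<cdot> Cst CI \<cdot> Cst CI \<cdot> Var 49 \<cdot> Var 53 \<cdot> abs 54 (Var 54 \<cdot> Var 51 \<cdot> Var 52)) (X \<^bold>= X')"
                proof (rule tyv_mono[OF ty_tyv tv_LeibnizEq_mono[of z z']],
                    rule ty_app[OF ty_app[OF ty_app[OF ty_app[OF ty_app]]]])
                  have "e 6 \<tturnstile> tv (z \<^bold>\<epsilon> gimel kappa \<^bold>\<rightarrow> z' \<^bold>\<epsilon> gimel kappa \<^bold>\<rightarrow>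
                      opair z n \<^bold>\<epsilon> f \<^bold>\<rightarrow> opair z' m \<^bold>\<epsilon> f \<^bold>\<rightarrow> n \<^bold>\<simeq> m \<^bold>\<rightarrow> z \<^bold>= z')"
                    using e6 unfolding injective_fm_def by (blast dest: forces_All)
                  then show "ty ?e53 (Var 6) (z \<^bold>\<epsilon> gimel kappa \<^bold>\<rightarrow> z' \<^bold>\<epsilon> gimel kappa \<^bold>\<rightarrow>
                      opair z n \<^bold>\<epsilon> f \<^bold>\<rightarrow> opair z' m \<^bold>\<epsilon> f \<^bold>\<rightarrow> n \<^bold>\<simeq> m \<^bold>\<rightarrow> z \<^bold>= z')"
                    using assms by (intro ty_var) simp
                  show "tyv ?e53 (Cst CI) (z \<^bold>\<epsilon> gimel kappa)" "tyv ?e53 (Cst CI) (z' \<^bold>\<epsilon> gimel kappa)"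
                    using z(1) z' by (auto intro: tyv_guard H_kappa)
                  show "tyv ?e53 (Var 49) (opair z n \<^bold>\<epsilon> f)" using \<xi>49 by (intro tyv_var) simp
                  show "tyv ?e53 (Var 53) (opair z' m \<^bold>\<epsilon> f)"
                    using \<xi>5(3) unfolding Eps_def by (intro tyv_var) simp
                  show "tyv ?e53 (abs 54 (Var 54 \<cdot> Var 51 \<cdot> Var 52)) (n \<^bold>\<simeq> m)"
                    unfolding ExtEq_def
                    by (rule ty_tyv, rule ty_conjI; rule tyv_var) (use \<xi>5 in simp_all)
                  show "z = z' \<longrightarrow> X = X'" using z(2) z' by blast
                qed
              qed
            qed
          qed
          ultimately show "tyv ?e50 (Var 46 \<cdot> abs 51 (abs 52 (Cst CCc \<cdot> abs 53 ?v))) (NotEps (opair z n) f)"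
            by (rule tyv_mono[rotated])
        qed
      qed
    qed
  qed
  note body = this
  show "ty ?e (Var 42 \<cdot> (Var 43 \<cdot> ?t)) Bot"
  proof (rule ty_eps)
    show "?e 42 \<tturnstile> tv (opair X Y \<^bold>\<epsilon> graph f)" using \<xi> by simp
    assume 1: "tv (NotEps (opair X Y) (graph f)) \<noteq> {}"
    show "tyv ?e (Var 43 \<cdot> ?t) Bot"
    proof (rule ty_tyv, rule ty_eps)
      show "?e 43 \<tturnstile> tv (opair X' Y' \<^bold>\<epsilon> graph f)" using \<xi> by simp
      assume 2: "tv (NotEps (opair X' Y') (graph f)) \<noteq> {}"
      show "tyv ?e ?t Bot" using body graphD[OF 1] graphD[OF 2] by blast
    qed
  qed
qed

end

lemma ty_main_t: "ty e main_t (Countable_fm (gimel kappa) \<^bold>\<rightarrow> Injects_into_reals_fm (gimel kappa_plus))"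
  unfolding main_t_def Countable_fm_def Injects_into_reals_fm_def Injects_fm_eq
proof (rule ty_abs, subst Ex_def, rule ty_abs)
  let ?G = "\<lambda>F. total_fm (gimel kappa_plus) F Real_fm \<^bold>\<and> functional_fm (gimel kappa_plus) F \<^bold>\<and>
      injective_fm (gimel kappa_plus) F"
  let ?p = "abs 7 (Var 7 \<cdot> total_t \<cdot> abs 8 (Var 8 \<cdot> functional_t \<cdot> inj_t))"
  fix \<xi>0 \<xi>1 assume \<xi>: "\<xi>0 \<tturnstile> tv (\<^bold>\<exists>f. total_fm (gimel kappa) f Nat_fm \<^bold>\<and> functional_fm (gimel kappa) f \<^bold>\<and>
      injective_fm (gimel kappa) f)" "\<xi>1 \<tturnstile> tv (\<^bold>\<forall>F. Neg (?G F))"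
  let ?e = "e(0 := \<xi>0, 1 := \<xi>1)"
  show "ty ?e (Var 0 \<cdot> abs 2 (Var 2 \<cdot> abs 3 (abs 4 (Var 4 \<cdot> abs 5 (abs 6 (Var 1 \<cdot> ?p)))))) Bot"
  proof (rule ty_exE[OF ty_var])
    show "?e 0 \<tturnstile> tv (\<^bold>\<exists>f. total_fm (gimel kappa) f Nat_fm \<^bold>\<and> functional_fm (gimel kappa) f \<^bold>\<and>
      injective_fm (gimel kappa) f)" using \<xi> by simp
    fix f \<xi>2 assume \<xi>2: "\<xi>2 \<tturnstile> tv (total_fm (gimel kappa) f Nat_fm \<^bold>\<and> functional_fm (gimel kappa) f \<^bold>\<and>
      injective_fm (gimel kappa) f)"
    show "ty (?e(2 := \<xi>2)) (Var 2 \<cdot> abs 3 (abs 4 (Var 4 \<cdot> abs 5 (abs 6 (Var 1 \<cdot> ?p))))) Bot"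
    proof (rule ty_conjE[OF ty_var])
      show "(?e(2 := \<xi>2)) 2 \<tturnstile> tv (total_fm (gimel kappa) f Nat_fm \<^bold>\<and> functional_fm (gimel kappa) f \<^bold>\<and>
        injective_fm (gimel kappa) f)" using \<xi>2 by simp
      fix \<xi>3 \<xi>4 assume \<xi>3: "\<xi>3 \<tturnstile> tv (total_fm (gimel kappa) f Nat_fm)"
        "\<xi>4 \<tturnstile> tv (functional_fm (gimel kappa) f \<^bold>\<and> injective_fm (gimel kappa) f)"
      let ?e4 = "?e(2 := \<xi>2, 3 := \<xi>3, 4 := \<xi>4)"
      show "ty ?e4 (Var 4 \<cdot> abs 5 (abs 6 (Var 1 \<cdot> ?p))) Bot"
      proof (rule ty_conjE[OF ty_var])
        show "?e4 4 \<tturnstile> tv (functional_fm (gimel kappa) f \<^bold>\<and> injective_fm (gimel kappa) f)" using \<xi>3 by simp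
        fix \<xi>5 \<xi>6 assume \<xi>5: "\<xi>5 \<tturnstile> tv (functional_fm (gimel kappa) f)"
          "\<xi>6 \<tturnstile> tv (injective_fm (gimel kappa) f)"
        let ?e6 = "?e4(5 := \<xi>5, 6 := \<xi>6)"
        have e6: "?e6 3 \<tturnstile> tv (total_fm (gimel kappa) f Nat_fm)"
          "?e6 5 \<tturnstile> tv (functional_fm (gimel kappa) f)" "?e6 6 \<tturnstile> tv (injective_fm (gimel kappa) f)"
          using \<xi>3 \<xi>5 by simp_all
        \<comment> \<open>The negated existential statement is instantiated at
          \<open>graph f\<close>; the instance leaves no trace in the term.\<close>
        have "?e6 1 \<tturnstile> tv (Neg (?G (graph f)))" using forces_All[OF \<xi>(2)] by simp
        moreover have "ty ?e6 ?p (?G (graph f))"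
          by (rule ty_conjI, rule ty_tyv, rule ty_total_t[OF e6], simp, rule ty_tyv, rule ty_conjI,
              rule ty_tyv, rule ty_functional_t[OF e6], rule ty_tyv, rule ty_inj_t[OF e6], simp)
        ultimately show "ty ?e6 (Var 1 \<cdot> ?p) Bot" by (intro ty_app[OF ty_var ty_tyv])
      qed
    qed
  qed
qed

end

theorem injection_into_reals_realized:
  "realized (Countable_fm (gimel kappa) \<^bold>\<rightarrow> Injects_into_reals_fm (gimel kappa_plus))"
proof -
  obtain H where H: "Dfn (\<lambda>v. H (v 0) (v 1))" "\<And>X z. H X z \<Longrightarrow> z \<in> ext kappa"
    "\<And>X Y. X \<in> ext kappa_plus \<Longrightarrow> Y \<in> ext kappa_plus \<Longrightarrow> \<exists>z. H X z \<and> (H Y z \<longrightarrow> X = Y)"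
    using kappa_antichain by blast
  \<comment> \<open>The realizer is closed, so its environment may be any sequence of terms;
    \<open>cI\<close> is a convenient one.\<close>
  have "ty (\<lambda>_. cI) main_t (Countable_fm (gimel kappa) \<^bold>\<rightarrow> Injects_into_reals_fm (gimel kappa_plus))"
    by (rule ty_main_t[of H]) (fact H)+
  then have "ev (\<lambda>_. cI) main_t \<tturnstile> tv (Countable_fm (gimel kappa) \<^bold>\<rightarrow> Injects_into_reals_fm (gimel kappa_plus))"
    by (rule ty_tyv[unfolded tyv_def, rule_format]) simp
  then show ?thesis unfolding realized_def using ev_closed[OF fv_main_t] by blast
qed

end

theorem theorem32:
  fixes mem :: "'m \<Rightarrow> 'm \<Rightarrow> bool"
    and Lam Pi Proc :: 'm
    and app push proc :: "'m \<Rightarrow> 'm \<Rightarrow> 'm"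
    and cont :: "'m \<Rightarrow> 'm"
    and cB cC cI cK cW cc pole QP :: 'm
  assumes "coherent_realizability_algebra mem Lam Pi Proc app push proc cont
             cB cC cI cK cW cc pole QP"
  shows "realizability_structure.realized mem Lam Pi push proc pole QP
           (Imp (membership.Countable_fm mem
                   (realizability_structure.gimel mem Pi
                      (realizability_structure.kappa mem Lam Pi)))
                (membership.Injects_into_reals_fm mem
                   (realizability_structure.gimel mem Pi
                      (realizability_structure.kappa_plus mem Lam Pi))))"
proof -
  interpret coherent_realizability_algebra mem Lam Pi Proc app push proc cont
    cB cC cI cK cW cc pole QP by (rule assms)
  show ?thesis by (rule injection_into_reals_realized)
qed

end
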